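(* Let $z\in\mathbb C$ with $|z|\le 1$ and let $\mathcal M_z$ act on $\mathcal F_\theta(\Sigma)$. 1. The spectral radius of $\mathcal M_z$ is bounded above by $\exp P(|z|)$. 2. The essential spectral radius of $\mathcal M_z$ is bounded above by $\theta\,\exp P(|z|)$. 3. There is at most one eigenvalue of $\mathcal M_z$ of modulus $\exp P(|z|)$, which is simple, and there is exactly one, located at $\exp P(z)$, if $z$ is real and positive. The rest of the spectrum is contained in a disc of radius strictly smaller than $\exp P(|z|)$. In addition, if $|z|\le 1$ but $z\neq 1$, then $1$ is not an eigenvalue of $\mathcal M_z$.
   Context: Shift and potential. $\Omega=\{0,1\}^{\{0,1,2,\dots\}}$, $T$ is the left shift, $0^\infty=(000\dots)$, $\tau(\omega)=1+\inf\{i\ge 0:\omega_i=1\}$ (with $\inf\emptyset=\infty$), $A_k=\{\omega:\tau(\omega)=k\}$ for $k\ge1$. Let $\Omega_*$ be the set of $\omega\in\Omega$ with infinitely many $1$'s. For $\omega\in\Omega_*$ the times between passages are $\sigma_k(\omega)=\tau\big((T^\tau)^k\omega\big)$, $k\ge 0$, where $T^\tau\omega=T^{\tau(\omega)}\omega$. A potential $V:\Omega\to\mathbb R$ is given, with induced version $W(\omega)=\sum_{k=0}^{\tau(\omega)-1}V(T^k\omega)$, satisfying: (1) $V$ is continuous, $-C_1\le V\le 0$ for some constant $C_1>0$, and $V(0^\infty)=0$; (2) $\sum_{n\ge1}\exp(\sup_{A_n}W)<C_2$ for some constant $C_2$; (3) for some $0<\theta<1$ and $C_3>0$, for all $n\ge1$,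 $\mathrm{Var}_nW\le C_3\theta^n$, where $\mathrm{Var}_nW=\sup\{|W(\omega)-W(\omega')|:\inf\{k\ge0:\sigma_k(\omega)\ne\sigma_k(\omega')\}=n\}$; (4) the limit $\lim_n\frac1n\log\sum_{\omega_0,\dots,\omega_{n-1}}\exp\big(\sup_{\omega'\in\Omega}\sum_{i=0}^{n-1}V(\omega_i\dots\omega_{n-1}\omega')\big)$ exists and equals $0$. The number $\theta$ is the one in (3). Induced space and operator. $\Sigma=\{1,2,3,\dots\}^{\{0,1,2,\dots\}}$ with left shift $S$; $\iota:\Omega_*\to\Sigma$, $\iota(\omega)=(\sigma_0(\omega)\sigma_1(\omega)\dots)$ is a bijection conjugating $T^\tau$ to $S$. $W$ is also viewed as a function on $\Sigma$ through $\iota$, and $\psi=\exp W$. $\mathcal F_\theta(\Sigma)$ is the Banach space of bounded complex functions $U$ on $\Sigma$ which are Lipschitz for the metric $d_\theta(\sigma,\sigma')=\theta^{\inf\{j\ge0:\sigma_j\neq\sigma'_j\}}$, with norm $\|U\|_\theta=|U|_\infty+|U|_\theta$, $|U|_\theta$ the least Lipschitz constant. For $|z|\le1$, $(\mathcal M_zf)(\sigma)=\sum_{n\ge1}z^n\psi(n\sigma)f(n\sigma)$, where $n\sigma=(n\sigma_0\sigma_1\dots)$; it is a bounded operator on $\mathcal F_\theta(\Sigma)$. Pressure. For $z\in[0,1]$, $\Lambda_n(z)=\sup_{\sigma\in\Sigma}\sum_{k_1\ge1}\cdots\sum_{k_n\ge1}z^{k_1+\cdots+k_n}\prod_{i=1}^n\psi(k_i\dots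 k_n\sigma)$ and $P(z)=\lim_n\frac1n\log\Lambda_n(z)\in[-\infty,\infty)$ (the limit exists by submultiplicativity; $\exp(-\infty)=0$). The essential spectrum of a bounded operator is the complement, in the spectrum, of the set of isolated eigenvalues of finite multiplicity; the essential spectral radius is the supremum of $|\lambda|$ over it.
   Formalization: Simplicity of the eigenvalue of modulus exp P(|z|) is asserted only for z ≠ 0; at z = 0 the operator is zero, exp P(0) = 0, and the eigenvalue 0 has infinite multiplicity, so that clause fails there. *)

theory Defs
  imports
    "HOL-Complex_Analysis.Complex_Analysis"
    "HOL-Library.Extended_Nat"
    "HOL-Library.Function_Algebras"
begin

section \<open>Shift space and induced potential\<close>

text \<open>
  The space \<open>\<Omega>\<close> is the type \<^typ>\<open>nat \<Rightarrow> bool\<close> with the product topology; \<^const>\<open>True\<close>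
  is the symbol 1.
\<close>

definition shift :: "(nat \<Rightarrow> 'a) \<Rightarrow> nat \<Rightarrow> 'a" where
  "shift \<omega> = (\<lambda>i. \<omega> (Suc i))"

definition prepend :: "'a list \<Rightarrow> (nat \<Rightarrow> 'a) \<Rightarrow> nat \<Rightarrow> 'a" where
  "prepend w \<omega> = (\<lambda>i. if i < length w then w ! i else \<omega> (i - length w))"

text \<open>In \<^typ>\<open>enat\<close> the infimum of the empty set is \<open>\<infinity>\<close>.\<close>

definition tau :: "(nat \<Rightarrow> bool) \<Rightarrow> enat" where
  "tau \<omega> = 1 + Inf (enat ` {i. \<omega> i})"

definition A_set :: "nat \<Rightarrow> (nat \<Rightarrow> bool) set" where
  "A_set k = {\<omega>. tau \<omega> = enat k}"

definition Omega_star :: "(nat \<Rightarrow> bool) set" where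
  "Omega_star = {\<omega>. infinite {i. \<omega> i}}"

text \<open>
  The next two definitions are only meaningful for \<open>tau \<omega> < \<infinity>\<close>. The only excluded
  point is \<open>0\<^sup>\<infinity>\<close>, whose value of \<open>W\<close> is \<open>0\<close> anyway when \<open>V(0\<^sup>\<infinity>) = 0\<close>.
\<close>

definition T_tau :: "(nat \<Rightarrow> bool) \<Rightarrow> nat \<Rightarrow> bool" where
  "T_tau \<omega> = (shift ^^ the_enat (tau \<omega>)) \<omega>"

definition W :: "((nat \<Rightarrow> bool) \<Rightarrow> real) \<Rightarrow> (nat \<Rightarrow> bool) \<Rightarrow> real" where
  "W V \<omega> = (\<Sum>k<the_enat (tau \<omega>). V ((shift ^^ k) \<omega>))"

definition passage :: "(nat \<Rightarrow> bool) \<Rightarrow> nat \<Rightarrow> nat" where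
  "passage \<omega> k = the_enat (tau ((T_tau ^^ k) \<omega>))"

definition Var_W :: "((nat \<Rightarrow> bool) \<Rightarrow> real) \<Rightarrow> nat \<Rightarrow> ereal" where
  "Var_W V n = Sup {ereal \<bar>W V \<omega> - W V \<omega>'\<bar> | \<omega> \<omega>'. \<omega> \<in> Omega_star \<and> \<omega>' \<in> Omega_star \<and>
      Inf (enat ` {k. passage \<omega> k \<noteq> passage \<omega>' k}) = enat n}"

definition partition_sum :: "((nat \<Rightarrow> bool) \<Rightarrow> real) \<Rightarrow> nat \<Rightarrow> real" where
  "partition_sum V n =
     (\<Sum>w\<in>{w :: bool list. length w = n}. exp (SUP \<omega>'. \<Sum>i<n. V (prepend (drop i w) \<omega>')))"


section \<open>Induced space, transfer operator and pressure\<close>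

definition Sigma_space :: "(nat \<Rightarrow> nat) set" where
  "Sigma_space = {\<sigma>. \<forall>j. 1 \<le> \<sigma> j}"

text \<open>
  The coding map \<open>\<iota>\<close> sends \<open>\<omega>\<close> to \<open>passage \<omega>\<close>; it is a bijection from \<^const>\<open>Omega_star\<close>
  to \<^const>\<open>Sigma_space\<close>, and the induced potential is transported along its inverse.
\<close>

definition psi :: "((nat \<Rightarrow> bool) \<Rightarrow> real) \<Rightarrow> (nat \<Rightarrow> nat) \<Rightarrow> real" where
  "psi V \<sigma> = exp (W V (inv_into Omega_star passage \<sigma>))"

definition d_theta :: "real \<Rightarrow> (nat \<Rightarrow> nat) \<Rightarrow> (nat \<Rightarrow> nat) \<Rightarrow> real" where
  "d_theta \<theta> \<sigma> \<sigma>' = (if \<sigma> = \<sigma>' then 0 else \<theta> ^ (LEAST j. \<sigma> j \<noteq> \<sigma>' j))"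

definition lip_const :: "real \<Rightarrow> ((nat \<Rightarrow> nat) \<Rightarrow> complex) \<Rightarrow> real \<Rightarrow> bool" where
  "lip_const \<theta> U L \<longleftrightarrow> 0 \<le> L \<and>
     (\<forall>\<sigma>\<in>Sigma_space. \<forall>\<sigma>'\<in>Sigma_space. norm (U \<sigma> - U \<sigma>') \<le> L * d_theta \<theta> \<sigma> \<sigma>')"

text \<open>
  Functions on \<^const>\<open>Sigma_space\<close> are represented by total functions vanishing outside it,
  so that equality of functions is equality on \<^const>\<open>Sigma_space\<close>.
\<close>

definition F_theta :: "real \<Rightarrow> ((nat \<Rightarrow> nat) \<Rightarrow> complex) set" where
  "F_theta \<theta> = {U. (\<forall>\<sigma>. \<sigma> \<notin> Sigma_space \<longrightarrow> U \<sigma> = 0) \<and> bounded (U ` Sigma_space) \<and>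
      (\<exists>L. lip_const \<theta> U L)}"

definition norm_theta :: "real \<Rightarrow> ((nat \<Rightarrow> nat) \<Rightarrow> complex) \<Rightarrow> real" where
  "norm_theta \<theta> U = (SUP \<sigma>\<in>Sigma_space. norm (U \<sigma>)) + Inf {L. lip_const \<theta> U L}"

definition M_op :: "((nat \<Rightarrow> bool) \<Rightarrow> real) \<Rightarrow> complex \<Rightarrow>
    ((nat \<Rightarrow> nat) \<Rightarrow> complex) \<Rightarrow> (nat \<Rightarrow> nat) \<Rightarrow> complex" where
  "M_op V z f = (\<lambda>\<sigma>. if \<sigma> \<in> Sigma_space
     then \<Sum>\<^sub>\<infinity>n\<in>{1..}. z ^ n * complex_of_real (psi V (prepend [n] \<sigma>)) * f (prepend [n] \<sigma>)
     else 0)"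

text \<open>The iterated sum over \<open>k\<^sub>1, \<dots>, k\<^sub>n \<ge> 1\<close> (of nonnegative terms) is a sum over words.\<close>

definition Lambda_n :: "((nat \<Rightarrow> bool) \<Rightarrow> real) \<Rightarrow> nat \<Rightarrow> real \<Rightarrow> real" where
  "Lambda_n V n z = (SUP \<sigma>\<in>Sigma_space.
     \<Sum>\<^sub>\<infinity>ks\<in>{ks. length ks = n \<and> set ks \<subseteq> {1..}}.
       z ^ sum_list ks * (\<Prod>i<n. psi V (prepend (drop i ks) \<sigma>)))"

definition ext_ln :: "real \<Rightarrow> ereal" where
  "ext_ln x = (if x = 0 then - \<infinity> else ereal (ln x))"

text \<open>The real exponential extended by \<open>exp (- \<infinity>) = 0\<close>; it is not meant for \<open>\<infinity>\<close>.\<close>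

definition ext_exp :: "ereal \<Rightarrow> real" where
  "ext_exp x = (if x = - \<infinity> then 0 else exp (real_of_ereal x))"

definition pressure :: "((nat \<Rightarrow> bool) \<Rightarrow> real) \<Rightarrow> real \<Rightarrow> ereal" where
  "pressure V z = lim (\<lambda>n. ext_ln (Lambda_n V n z) / ereal (real n))"


section \<open>Spectral theory of operators on a normed space of functions\<close>

text \<open>
  Below, \<open>X\<close> is a linear space of complex functions on \<^typ>\<open>'a\<close>, \<open>N\<close> is a complete norm on
  it, and \<open>A\<close> is an operator on \<open>X\<close>; the values of \<open>N\<close> and \<open>A\<close> outside \<open>X\<close> are irrelevant.
\<close>

definition cscale :: "complex \<Rightarrow> ('a \<Rightarrow> complex) \<Rightarrow> 'a \<Rightarrow> complex" where
  "cscale c f = (\<lambda>x. c * f x)"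

interpretation cfun: vector_space "cscale :: complex \<Rightarrow> ('a \<Rightarrow> complex) \<Rightarrow> 'a \<Rightarrow> complex"
  by unfold_locales (auto simp: cscale_def fun_eq_iff algebra_simps)

definition bounded_op ::
    "('a \<Rightarrow> complex) set \<Rightarrow> (('a \<Rightarrow> complex) \<Rightarrow> real) \<Rightarrow> (('a \<Rightarrow> complex) \<Rightarrow> 'a \<Rightarrow> complex) \<Rightarrow> bool" where
  "bounded_op X N A \<longleftrightarrow> (\<forall>f\<in>X. A f \<in> X) \<and>
     (\<forall>f\<in>X. \<forall>g\<in>X. A (f + g) = A f + A g) \<and>
     (\<forall>c. \<forall>f\<in>X. A (cscale c f) = cscale c (A f)) \<and>
     (\<exists>B. \<forall>f\<in>X. N (A f) \<le> B * N f)"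

definition is_resolvent_at ::
    "('a \<Rightarrow> complex) set \<Rightarrow> (('a \<Rightarrow> complex) \<Rightarrow> real) \<Rightarrow> (('a \<Rightarrow> complex) \<Rightarrow> 'a \<Rightarrow> complex) \<Rightarrow>
     complex \<Rightarrow> (('a \<Rightarrow> complex) \<Rightarrow> 'a \<Rightarrow> complex) \<Rightarrow> bool" where
  "is_resolvent_at X N A \<mu> R \<longleftrightarrow> bounded_op X N R \<and>
     (\<forall>f\<in>X. R (cscale \<mu> f - A f) = f \<and> cscale \<mu> (R f) - A (R f) = f)"

definition spectrum_on ::
    "('a \<Rightarrow> complex) set \<Rightarrow> (('a \<Rightarrow> complex) \<Rightarrow> real) \<Rightarrow> (('a \<Rightarrow> complex) \<Rightarrow> 'a \<Rightarrow> complex) \<Rightarrow>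
     complex set" where
  "spectrum_on X N A = {\<mu>. \<nexists>R. is_resolvent_at X N A \<mu> R}"

definition eigenvalue_on ::
    "('a \<Rightarrow> complex) set \<Rightarrow> (('a \<Rightarrow> complex) \<Rightarrow> 'a \<Rightarrow> complex) \<Rightarrow> complex \<Rightarrow> bool" where
  "eigenvalue_on X A \<mu> \<longleftrightarrow> (\<exists>f\<in>X. f \<noteq> 0 \<and> A f = cscale \<mu> f)"

definition resolvent_on ::
    "('a \<Rightarrow> complex) set \<Rightarrow> (('a \<Rightarrow> complex) \<Rightarrow> real) \<Rightarrow> (('a \<Rightarrow> complex) \<Rightarrow> 'a \<Rightarrow> complex) \<Rightarrow>
     complex \<Rightarrow> ('a \<Rightarrow> complex) \<Rightarrow> 'a \<Rightarrow> complex" where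
  "resolvent_on X N A \<mu> = (SOME R. is_resolvent_at X N A \<mu> R)"

text \<open>
  The Riesz projection: the integral of the resolvent over the circle of radius \<open>r\<close> about \<open>\<mu>\<close>,
  divided by \<open>2\<pi>i\<close>. The vector-valued integral is computed pointwise, which is
  legitimate when the evaluations \<open>f \<mapsto> f x\<close> are continuous on \<open>X\<close>, as they are
  on \<^const>\<open>F_theta\<close>.
\<close>

definition riesz_projection ::
    "('a \<Rightarrow> complex) set \<Rightarrow> (('a \<Rightarrow> complex) \<Rightarrow> real) \<Rightarrow> (('a \<Rightarrow> complex) \<Rightarrow> 'a \<Rightarrow> complex) \<Rightarrow>
     complex \<Rightarrow> real \<Rightarrow> ('a \<Rightarrow> complex) \<Rightarrow> 'a \<Rightarrow> complex" where
  "riesz_projection X N A \<mu> r f = (\<lambda>x.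
     contour_integral (circlepath \<mu> r) (\<lambda>\<zeta>. resolvent_on X N A \<zeta> f x) / (2 * of_real pi * \<i>))"

text \<open>
  An eigenvalue which is an isolated point of the spectrum and has algebraic multiplicity \<open>m\<close>,
  i.e. the range of its Riesz projection has finite dimension \<open>m\<close>. The choice of \<open>r\<close> is
  immaterial.
\<close>

definition isolated_eigenvalue_mult ::
    "('a \<Rightarrow> complex) set \<Rightarrow> (('a \<Rightarrow> complex) \<Rightarrow> real) \<Rightarrow> (('a \<Rightarrow> complex) \<Rightarrow> 'a \<Rightarrow> complex) \<Rightarrow>
     complex \<Rightarrow> nat \<Rightarrow> bool" where
  "isolated_eigenvalue_mult X N A \<mu> m \<longleftrightarrow> eigenvalue_on X A \<mu> \<and>
     (\<exists>r>0. cball \<mu> r \<inter> spectrum_on X N A = {\<mu>} \<and>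
       (\<exists>B. finite B \<and> card B = m \<and> cfun.independent B \<and>
            cfun.span B = riesz_projection X N A \<mu> r ` X))"

definition ess_spectrum_on ::
    "('a \<Rightarrow> complex) set \<Rightarrow> (('a \<Rightarrow> complex) \<Rightarrow> real) \<Rightarrow> (('a \<Rightarrow> complex) \<Rightarrow> 'a \<Rightarrow> complex) \<Rightarrow>
     complex set" where
  "ess_spectrum_on X N A =
     spectrum_on X N A - {\<mu>. \<exists>m. isolated_eigenvalue_mult X N A \<mu> m}"

text \<open>
  Suprema in \<^typ>\<open>ereal\<close>, so that an unbounded set has radius \<open>\<infinity>\<close> rather than an
  unspecified real number.
\<close>

definition spectral_radius_on ::
    "('a \<Rightarrow> complex) set \<Rightarrow> (('a \<Rightarrow> complex) \<Rightarrow> real) \<Rightarrow> (('a \<Rightarrow> complex) \<Rightarrow> 'a \<Rightarrow> complex) \<Rightarrow>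
     ereal" where
  "spectral_radius_on X N A = (SUP \<mu>\<in>spectrum_on X N A. ereal (norm \<mu>))"

definition ess_spectral_radius_on ::
    "('a \<Rightarrow> complex) set \<Rightarrow> (('a \<Rightarrow> complex) \<Rightarrow> real) \<Rightarrow> (('a \<Rightarrow> complex) \<Rightarrow> 'a \<Rightarrow> complex) \<Rightarrow>
     ereal" where
  "ess_spectral_radius_on X N A = (SUP \<mu>\<in>ess_spectrum_on X N A. ereal (norm \<mu>))"

end

theory Submission
  imports Defs
begin

text \<open>
  The induced system is a full shift, so the weights of words have bounded distortion, uniformly
  in the point to which the word is prepended. Hence the sums defining \<open>\<Lambda>\<^sub>n\<close> are almost
  multiplicative, and for \<open>M = M\<^sub>r\<close>, \<open>r = |z|\<close>, a positive function \<open>v\<close> with \<open>Mv \<ge> \<rho>v\<close> is obtained as a limit superior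
  of \<open>M\<^sup>n1/\<rho>\<^sup>n\<close>; the increasing limit of \<open>M\<^sup>nv/\<rho>\<^sup>n\<close> is a Perron eigenfunction \<open>h\<close>.

  Freezing the argument of \<open>f\<close> at a reference point in finitely many summands of \<open>M\<^sub>z\<^sup>n f\<close>, and
  dropping the others, gives an operator of finite rank built from point evaluations. For any
  \<open>q > \<theta>\<rho>\<close> and suitable \<open>n\<close> it differs from \<open>M\<^sub>z\<^sup>n\<close> by an operator \<open>E\<close> of norm at most \<open>q\<^sup>n\<close>.
  Adding the rank-one pieces one at a time to the Neumann series of \<open>E\<close> exhibits the resolvent, for \<open>|\<zeta>| > q\<close>, as a
  holomorphic family divided by a scalar holomorphic function; this gives the discreteness of the
  spectrum, and the principal parts at its poles give the finite rank of the Riesz projections.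

  If \<open>M\<^sub>zf = \<mu>f\<close> with \<open>|\<mu>| = \<rho>\<close>, then \<open>|f|\<close> is a multiple of \<open>h\<close> and all terms of the sum
  \<open>M\<^sub>zf\<close> have the same argument. So \<open>f/h\<close> is multiplied by a constant phase along each inverse
  branch, hence is constant by continuity, which forces \<open>z > 0\<close>. Finally \<open>\<rho> \<le> 1\<close> for \<open>z = 1\<close>,
  because for \<open>s < 1\<close> the powers of \<open>M\<^sub>s\<close> are dominated by tails of \<open>\<Sum>\<^sub>m s\<^sup>m Z\<^sub>m\<close>, with \<open>Z\<^sub>m\<close> the
  partition sums of the pressure condition.
\<close>

section \<open>Perturbation theory in Banach spaces of functions\<close>

text \<open>The alphabet is infinite, so \<open>Sigma_space\<close> is not compact and bounded
  Lipschitz families need not have uniformly convergent subsequences. For the eigenfunction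
  monotonicity takes the place of compactness: the suprema of tails decrease, and the iterates of v
  increase because of the inequality that v satisfies. For the spectrum compactness comes back
  through the summability of the weights, which makes all but finitely many words of a given length
  negligible. The splitting concerns a power \<open>M ^^ n\<close>, because its error carries a
  constant that \<theta>^n beats only for large n; the polynomial \<open>power_sum\<close> brings
  the inverse back to \<open>M\<close>. Simplicity is meant algebraically: the bound
  \<open>C * \<rho> ^ k\<close> on the powers forces a simple pole of the resolvent, so that the
  Riesz projection is a limit along a real ray and its values are eigenvectors. The value 1 is
  excluded for |z| < 1 by the same tails of partition sums; for |z| = 1 the bound \<rho> \<le> 1
  makes an eigenvalue 1 peripheral, which forces z = 1.\<close>

lemma cscale_apply [simp]: "cscale c f x = c * f x"
  by (simp add: cscale_def)

text \<open>Completeness enters as \<open>series\<close>: an absolutely convergent series with a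
  pointwise sum has this sum in \<open>X\<close>, with the expected norm bound. In a space of
  functions with continuous evaluations (\<open>eval_le\<close>) limits are met in this form;
  \<open>eval_le\<close> also makes \<open>N\<close> definite.\<close>

locale function_banach_space =
  fixes X :: "('a \<Rightarrow> complex) set" and N :: "('a \<Rightarrow> complex) \<Rightarrow> real"
  assumes zero_mem: "0 \<in> X"
    and add_mem: "\<And>f g. f \<in> X \<Longrightarrow> g \<in> X \<Longrightarrow> f + g \<in> X"
    and scale_mem: "\<And>f c. f \<in> X \<Longrightarrow> cscale c f \<in> X"
    and N_add: "\<And>f g. f \<in> X \<Longrightarrow> g \<in> X \<Longrightarrow> N (f + g) \<le> N f + N g"
    and N_scale: "\<And>f c. f \<in> X \<Longrightarrow> N (cscale c f) = norm c * N f"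
    and eval_le: "\<And>f x. f \<in> X \<Longrightarrow> norm (f x) \<le> N f"
    and series: "\<And>F b g. (\<And>k. F k \<in> X) \<Longrightarrow> (\<And>k. N (F k) \<le> b k) \<Longrightarrow> summable b \<Longrightarrow>
      (\<And>x. (\<lambda>k. F k x) sums g x) \<Longrightarrow> g \<in> X \<and> N g \<le> suminf b"
begin

lemma minus_mem: "f \<in> X \<Longrightarrow> g \<in> X \<Longrightarrow> f - g \<in> X"
proof -
  assume "f \<in> X" "g \<in> X"
  moreover have "f - g = f + cscale (-1) g"
    by (auto simp: fun_eq_iff)
  ultimately show ?thesis
    using add_mem scale_mem by metis
qed

lemma sum_mem: "(\<And>j. j \<in> J \<Longrightarrow> f j \<in> X) \<Longrightarrow> sum f J \<in> X"
  by (induction J rule: infinite_finite_induct) (auto simp: zero_mem add_mem)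

lemma N_nonneg: "f \<in> X \<Longrightarrow> 0 \<le> N f"
  using eval_le[of f undefined] norm_ge_zero order_trans by blast

lemma N_zero: "N 0 = 0"
proof -
  have "N (cscale 0 0) = 0"
    by (subst N_scale) (auto simp: zero_mem)
  moreover have "cscale 0 0 = (0 :: 'a \<Rightarrow> complex)"
    by (auto simp: fun_eq_iff)
  ultimately show ?thesis
    by simp
qed

lemma N_minus: "f \<in> X \<Longrightarrow> g \<in> X \<Longrightarrow> N (f - g) \<le> N f + N g"
proof -
  assume fg: "f \<in> X" "g \<in> X"
  have eq: "f - g = f + cscale (-1) g"
    by (auto simp: fun_eq_iff)
  have "N (cscale (-1) g) = N g"
    using fg by (subst N_scale) auto
  with N_add[OF fg(1) scale_mem[OF fg(2), of "-1"]] show ?thesis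
    unfolding eq by (simp only:)
qed

lemma N_sum: "(\<And>j. j \<in> J \<Longrightarrow> f j \<in> X) \<Longrightarrow> N (sum f J) \<le> (\<Sum>j\<in>J. N (f j))"
proof (induction J rule: infinite_finite_induct)
  case (insert j J)
  have "N (f j + sum f J) \<le> N (f j) + N (sum f J)"
    using insert by (intro N_add sum_mem) auto
  also have "\<dots> \<le> N (f j) + (\<Sum>j\<in>J. N (f j))"
    using insert by simp
  finally show ?case
    by (simp only: sum.insert[OF insert.hyps])
qed (auto simp: N_zero)

lemma N_eq_0_imp: "f \<in> X \<Longrightarrow> N f \<le> 0 \<Longrightarrow> f = 0"
proof
  fix x assume "f \<in> X" "N f \<le> 0"
  with eval_le[of f x] have "norm (f x) \<le> 0"
    by linarith
  then show "f x = 0 x"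
    by simp
qed

lemma bounded_op_mem: "bounded_op X N A \<Longrightarrow> f \<in> X \<Longrightarrow> A f \<in> X"
  and bounded_op_add: "bounded_op X N A \<Longrightarrow> f \<in> X \<Longrightarrow> g \<in> X \<Longrightarrow> A (f + g) = A f + A g"
  and bounded_op_scale: "bounded_op X N A \<Longrightarrow> f \<in> X \<Longrightarrow> A (cscale c f) = cscale c (A f)"
  by (auto simp: bounded_op_def)

lemma bounded_op_bound:
  assumes "bounded_op X N A"
  obtains B where "0 \<le> B" "\<And>f. f \<in> X \<Longrightarrow> N (A f) \<le> B * N f"
proof -
  from assms obtain B where B: "\<forall>f\<in>X. N (A f) \<le> B * N f"
    by (auto simp: bounded_op_def)
  show ?thesis
  proof (rule that[of "max B 0"])
    fix f assume "f \<in> X"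
    with B have "N (A f) \<le> B * N f" by auto
    also have "\<dots> \<le> max B 0 * N f"
      using N_nonneg[OF \<open>f \<in> X\<close>] by (intro mult_right_mono) auto
    finally show "N (A f) \<le> max B 0 * N f" .
  qed auto
qed

lemma bounded_op_minus:
  assumes "bounded_op X N A" "f \<in> X" "g \<in> X"
  shows "A (f - g) = A f - A g"
proof -
  have "f - g = f + cscale (-1) g"
    by (auto simp: fun_eq_iff)
  then have "A (f - g) = A (f + cscale (-1) g)"
    by (rule arg_cong)
  also have "\<dots> = A f + A (cscale (-1) g)"
    using assms by (intro bounded_op_add scale_mem)
  also have "\<dots> = A f + cscale (-1) (A g)"
    using bounded_op_scale[OF assms(1,2), of "-1"] bounded_op_scale[OF assms(1,3), of "-1"] by simp
  also have "\<dots> = A f - A g"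
    by (auto simp: fun_eq_iff)
  finally show ?thesis .
qed

lemma bounded_op_zero: "bounded_op X N A \<Longrightarrow> A 0 = 0"
  using bounded_op_minus[of A 0 0] zero_mem by simp

lemma bounded_op_sum:
  assumes "bounded_op X N A" "\<And>j. j \<in> J \<Longrightarrow> f j \<in> X"
  shows "A (sum f J) = (\<Sum>j\<in>J. A (f j))"
  using assms(2)
  by (induction J rule: infinite_finite_induct)
     (auto simp: bounded_op_zero[OF assms(1)] bounded_op_add[OF assms(1)] sum_mem)

lemma bounded_opI:
  assumes "\<And>f. f \<in> X \<Longrightarrow> A f \<in> X" "\<And>f g. f \<in> X \<Longrightarrow> g \<in> X \<Longrightarrow> A (f + g) = A f + A g"
    "\<And>c f. f \<in> X \<Longrightarrow> A (cscale c f) = cscale c (A f)" "\<And>f. f \<in> X \<Longrightarrow> N (A f) \<le> B * N f"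
  shows "bounded_op X N A"
  unfolding bounded_op_def using assms by blast

lemma bounded_op_id: "bounded_op X N (\<lambda>f. f)"
  by (rule bounded_opI[where B = 1]) auto

lemma bounded_op_comp:
  assumes "bounded_op X N A" "bounded_op X N B"
  shows "bounded_op X N (\<lambda>f. A (B f))"
proof -
  obtain a where a: "0 \<le> a" "\<And>f. f \<in> X \<Longrightarrow> N (A f) \<le> a * N f"
    using bounded_op_bound[OF assms(1)] by blast
  obtain b where b: "0 \<le> b" "\<And>f. f \<in> X \<Longrightarrow> N (B f) \<le> b * N f"
    using bounded_op_bound[OF assms(2)] by blast
  show ?thesis
  proof (rule bounded_opI[where B = "a * b"])
    fix f assume f: "f \<in> X"
    have "N (A (B f)) \<le> a * N (B f)"
      by (intro a bounded_op_mem[OF assms(2)] f)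
    also have "\<dots> \<le> a * (b * N f)"
      by (intro mult_left_mono a b f)
    finally show "N (A (B f)) \<le> a * b * N f"
      by (simp add: mult_ac)
  qed (simp_all add: assms bounded_op_mem bounded_op_add[OF assms(1)] bounded_op_add[OF assms(2)]
         bounded_op_scale[OF assms(1)] bounded_op_scale[OF assms(2)])
qed

lemma bounded_op_cscale:
  assumes "bounded_op X N A"
  shows "bounded_op X N (\<lambda>f. cscale c (A f))"
proof -
  obtain a where a: "0 \<le> a" "\<And>f. f \<in> X \<Longrightarrow> N (A f) \<le> a * N f"
    using bounded_op_bound[OF assms(1)] by blast
  show ?thesis
  proof (rule bounded_opI[where B = "norm c * a"])
    fix f assume f: "f \<in> X"
    show "N (cscale c (A f)) \<le> norm c * a * N f"
      using mult_left_mono[OF a(2)[OF f], of "norm c"]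
      by (simp add: N_scale bounded_op_mem[OF assms f] mult_ac)
  qed (auto simp: assms bounded_op_mem bounded_op_add bounded_op_scale scale_mem
         fun_eq_iff algebra_simps)
qed

lemma bounded_op_plus:
  assumes "bounded_op X N A" "bounded_op X N B"
  shows "bounded_op X N (\<lambda>f. A f + B f)"
proof -
  obtain a where a: "0 \<le> a" "\<And>f. f \<in> X \<Longrightarrow> N (A f) \<le> a * N f"
    using bounded_op_bound[OF assms(1)] by blast
  obtain b where b: "0 \<le> b" "\<And>f. f \<in> X \<Longrightarrow> N (B f) \<le> b * N f"
    using bounded_op_bound[OF assms(2)] by blast
  show ?thesis
  proof (rule bounded_opI[where B = "a + b"])
    fix f assume f: "f \<in> X"
    have "N (A f + B f) \<le> N (A f) + N (B f)"
      by (intro N_add bounded_op_mem[OF assms(2)] bounded_op_mem[OF assms(1)] f)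
    also have "\<dots> \<le> a * N f + b * N f"
      by (intro add_mono a b f)
    finally show "N (A f + B f) \<le> (a + b) * N f"
      by (simp add: algebra_simps)
  qed (auto simp: assms bounded_op_mem bounded_op_add bounded_op_scale add_mem
         fun_eq_iff algebra_simps)
qed

text \<open>With \<open>A\<close> the identity these are the rank-one operators built from a point
  evaluation, the pieces from which the finite-rank part is assembled.\<close>

lemma bounded_op_eval:
  assumes "bounded_op X N A" "u \<in> X"
  shows "bounded_op X N (\<lambda>f. cscale (A f x) u)"
proof -
  obtain a where a: "0 \<le> a" "\<And>f. f \<in> X \<Longrightarrow> N (A f) \<le> a * N f"
    using bounded_op_bound[OF assms(1)] by blast
  show ?thesis
  proof (rule bounded_opI[where B = "a * N u"])
    fix f assume f: "f \<in> X"
    have "norm (A f x) \<le> a * N f"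
      using eval_le[OF bounded_op_mem[OF assms(1) f]] a(2)[OF f] order_trans by blast
    then have "norm (A f x) * N u \<le> a * N f * N u"
      using N_nonneg[OF assms(2)] by (rule mult_right_mono)
    then show "N (cscale (A f x) u) \<le> a * N u * N f"
      by (simp add: N_scale assms mult_ac)
  qed (auto simp: assms bounded_op_add bounded_op_scale scale_mem fun_eq_iff algebra_simps)
qed

lemma bounded_op_sum_ops:
  assumes "\<And>j. j \<in> J \<Longrightarrow> bounded_op X N (A j)"
  shows "bounded_op X N (\<lambda>f. \<Sum>j\<in>J. A j f)"
proof -
  have zero: "bounded_op X N (\<lambda>f. 0)"
    by (rule bounded_opI[where B = 0]) (auto simp: N_zero zero_mem fun_eq_iff)
  show ?thesis
    using assms
  proof (induction J rule: infinite_finite_induct)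
    case (insert j J)
    then have "bounded_op X N (\<lambda>f. A j f + (\<Sum>j\<in>J. A j f))"
      by (intro bounded_op_plus) auto
    then show ?case
      by (simp only: sum.insert[OF insert.hyps])
  qed (auto simp: zero)
qed

lemma bounded_op_funpow: "bounded_op X N A \<Longrightarrow> bounded_op X N (A ^^ k)"
proof (induction k)
  case 0
  show ?case
    using bounded_op_id by (simp add: id_def)
next
  case (Suc k)
  show ?case
    using bounded_op_comp[OF Suc.prems Suc.IH[OF Suc.prems]] by (simp add: comp_def)
qed

section \<open>Resolvents and holomorphic families of inverses\<close>

lemma resolvent_unique:
  assumes "is_resolvent_at X N A \<zeta> R" "is_resolvent_at X N A \<zeta> R'" "f \<in> X"
  shows "R f = R' f"
proof -
  have "R' f \<in> X"
    using assms bounded_op_mem unfolding is_resolvent_at_def by blast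
  then have "R (cscale \<zeta> (R' f) - A (R' f)) = R' f"
    using assms unfolding is_resolvent_at_def by blast
  moreover have "cscale \<zeta> (R' f) - A (R' f) = f"
    using assms unfolding is_resolvent_at_def by blast
  ultimately show ?thesis
    by simp
qed

lemma is_resolvent_resolvent_on:
  assumes "is_resolvent_at X N A \<zeta> R"
  shows "is_resolvent_at X N A \<zeta> (resolvent_on X N A \<zeta>)"
  unfolding resolvent_on_def using someI[of "is_resolvent_at X N A \<zeta>", OF assms] by simp

lemma resolvent_on_eq:
  assumes "is_resolvent_at X N A \<zeta> R" "f \<in> X"
  shows "resolvent_on X N A \<zeta> f = R f"
  using resolvent_unique[OF is_resolvent_resolvent_on] assms by blast

text \<open>Where \<open>d w \<noteq> 0\<close>, the operator \<open>H w\<close> divided by \<open>d w\<close> is the resolvent of \<open>T\<close> at \<open>w\<close>.\<close>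

definition inverse_family where
  "inverse_family e T d H \<longleftrightarrow> d holomorphic_on {w. e < norm w} \<and>
     (\<forall>f\<in>X. \<forall>x. (\<lambda>w. H w f x) holomorphic_on {w. e < norm w}) \<and>
     (\<forall>w. e < norm w \<longrightarrow> bounded_op X N (H w) \<and>
       (\<forall>f\<in>X. cscale w (H w f) - T (H w f) = cscale (d w) f \<and>
              H w (cscale w f - T f) = cscale (d w) f))"

lemma inverse_familyD:
  assumes "inverse_family e T d H"
  shows "d holomorphic_on {w. e < norm w}"
    "\<And>f x. f \<in> X \<Longrightarrow> (\<lambda>w. H w f x) holomorphic_on {w. e < norm w}"
    "\<And>w. e < norm w \<Longrightarrow> bounded_op X N (H w)"
    "\<And>w f. e < norm w \<Longrightarrow> f \<in> X \<Longrightarrow> cscale w (H w f) - T (H w f) = cscale (d w) f"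
    "\<And>w f. e < norm w \<Longrightarrow> f \<in> X \<Longrightarrow> H w (cscale w f - T f) = cscale (d w) f"
  using assms unfolding inverse_family_def by blast+

text \<open>\<open>H w f\<close> is the pointwise sum of E^k f / w^(k+1), dominated by a geometric
  series, and \<open>series\<close> places it in \<open>X\<close>. Shifting the index gives w H f =
  f + H (E f), which is one of the two inverse relations; the other follows once \<open>E\<close>
  and \<open>H w\<close> commute.\<close>

lemma neumann_inverse_family:
  assumes E: "bounded_op X N E" and e: "0 < e" and E_le: "\<And>f. f \<in> X \<Longrightarrow> N (E f) \<le> e * N f"
  shows "\<exists>H. inverse_family e E (\<lambda>_. 1) H"
proof -
  define H where "H w f = (\<lambda>x. \<Sum>k. (E ^^ k) f x / w ^ Suc k)" for w f
  have lt1: "e / norm w < 1" if "e < norm w" for w :: complex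
  proof -
    from e that have "0 < norm w" by linarith
    with that show ?thesis by (simp add: divide_less_eq_1_pos)
  qed
  have pow_mem: "(E ^^ k) f \<in> X" if "f \<in> X" for k f
    using bounded_op_mem[OF bounded_op_funpow[OF E]] that .
  have pow_le: "N ((E ^^ k) f) \<le> e ^ k * N f" if "f \<in> X" for k f
  proof (induction k)
    case (Suc k)
    have "N ((E ^^ Suc k) f) \<le> e * N ((E ^^ k) f)"
      using E_le[OF pow_mem[OF that]] by simp
    also have "\<dots> \<le> e * (e ^ k * N f)"
      using Suc e by (intro mult_left_mono) auto
    finally show ?case
      by (simp add: mult_ac)
  qed simp
  have ev_le: "norm ((E ^^ k) f x) \<le> e ^ k * N f" if "f \<in> X" for k f x
    using eval_le[OF pow_mem[OF that], of k x] pow_le[OF that, of k] by linarith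
  have geom: "(\<lambda>k. e ^ k * c / r ^ Suc k) sums (c / (r - e))" if "e < r" for r c
  proof -
    have "(\<lambda>k. c / r * (e / r) ^ k) sums (c / r * (1 / (1 - e / r)))"
      using e that by (intro sums_mult geometric_sums) auto
    moreover have "c / r * (1 / (1 - e / r)) = c / (r - e)"
    proof -
      have "r * (1 - e / r) = r - e" "r \<noteq> 0"
        using e that by (auto simp: field_simps)
      then show ?thesis
        by (metis mult.right_neutral times_divide_times_eq)
    qed
    moreover have "c / r * (e / r) ^ k = e ^ k * c / r ^ Suc k" for k
      by (simp add: power_divide mult_ac)
    ultimately show ?thesis
      by (simp only:)
  qed
  have sums: "(\<lambda>k. (E ^^ k) f x / w ^ Suc k) sums H w f x" if "e < norm w" "f \<in> X" for w f x
  proof -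
    have "summable (\<lambda>k. (E ^^ k) f x / w ^ Suc k)"
    proof (rule summable_comparison_test)
      show "summable (\<lambda>k. e ^ k * N f / norm w ^ Suc k)"
        using geom[OF that(1)] sums_summable by blast
      show "\<exists>N'. \<forall>k\<ge>N'. norm ((E ^^ k) f x / w ^ Suc k) \<le> e ^ k * N f / norm w ^ Suc k"
        using ev_le[OF that(2)] by (auto simp: norm_divide norm_mult norm_power intro!: divide_right_mono)
    qed
    then show ?thesis
      unfolding H_def by (rule summable_sums)
  qed
  have H: "H w f \<in> X \<and> N (H w f) \<le> 1 / (norm w - e) * N f" if "e < norm w" "f \<in> X" for w f
  proof -
    have "H w f \<in> X \<and> N (H w f) \<le> (\<Sum>k. e ^ k * N f / norm w ^ Suc k)"
    proof (rule series)
      show "cscale (1 / w ^ Suc k) ((E ^^ k) f) \<in> X" for k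
        by (intro scale_mem pow_mem that)
      show "N (cscale (1 / w ^ Suc k) ((E ^^ k) f)) \<le> e ^ k * N f / norm w ^ Suc k" for k
        using pow_le[OF that(2), of k]
        by (subst N_scale) (auto intro: pow_mem[OF that(2)] simp: norm_divide norm_mult norm_power divide_right_mono)
      show "summable (\<lambda>k. e ^ k * N f / norm w ^ Suc k)"
        using geom[OF that(1)] sums_summable by blast
      show "(\<lambda>k. cscale (1 / w ^ Suc k) ((E ^^ k) f) x) sums H w f x" for x
        using sums[OF that, of x] by simp
    qed
    then show ?thesis
      using sums_unique[OF geom[OF that(1), of "N f"]] by simp
  qed
  have H_bop: "bounded_op X N (H w)" if w: "e < norm w" for w
  proof (rule bounded_opI[where B = "1 / (norm w - e)"])
    show "H w (f + g) = H w f + H w g" if "f \<in> X" "g \<in> X" for f g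
    proof
      fix x
      have "(\<lambda>k. (E ^^ k) (f + g) x / w ^ Suc k) sums (H w f x + H w g x)"
        using sums_add[OF sums[OF w that(1), of x] sums[OF w that(2), of x]]
        by (simp add: bounded_op_add[OF bounded_op_funpow[OF E]] that add_divide_distrib)
      from sums_unique2[OF sums[OF w add_mem[OF that], of x] this]
      show "H w (f + g) x = (H w f + H w g) x"
        by simp
    qed
    show "H w (cscale c f) = cscale c (H w f)" if "f \<in> X" for f c
    proof
      fix x
      have "(\<lambda>k. (E ^^ k) (cscale c f) x / w ^ Suc k) sums (c * H w f x)"
        using sums_mult[OF sums[OF w that, of x], of c]
        by (simp add: bounded_op_scale[OF bounded_op_funpow[OF E]] that)
      from sums_unique2[OF sums[OF w scale_mem[OF that, of c], of x] this]
      show "H w (cscale c f) x = cscale c (H w f) x"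
        by simp
    qed
  qed (use H[OF w] in auto)
  have E_comm: "(E ^^ k) (E f) = E ((E ^^ k) f)" for k f
    by (rule funpow_swap1[symmetric])
  have rec: "cscale w (H w f) = f + H w (E f)" if w: "e < norm w" and f: "f \<in> X" for w f
  proof
    fix x
    have "w \<noteq> 0" using w e by auto
    have "(\<lambda>k. (E ^^ Suc k) f x / w ^ Suc (Suc k)) sums (H w f x - f x / w)"
      using sums_Suc_iff[of "\<lambda>k. (E ^^ k) f x / w ^ Suc k" "H w f x - f x / w"]
        sums[OF w f, of x] by simp
    then have "(\<lambda>k. w * ((E ^^ Suc k) f x / w ^ Suc (Suc k))) sums (w * (H w f x - f x / w))"
      by (rule sums_mult)
    moreover have "w * ((E ^^ Suc k) f x / w ^ Suc (Suc k)) = (E ^^ k) (E f) x / w ^ Suc k" for k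
      using \<open>w \<noteq> 0\<close> by (simp add: E_comm)
    moreover have "w * (H w f x - f x / w) = w * H w f x - f x"
      using \<open>w \<noteq> 0\<close> by (simp add: right_diff_distrib)
    ultimately have "(\<lambda>k. (E ^^ k) (E f) x / w ^ Suc k) sums (w * H w f x - f x)"
      by (simp only:)
    with sums[OF w bounded_op_mem[OF E f], of x] have "H w (E f) x = w * H w f x - f x"
      using sums_unique2 by blast
    then show "cscale w (H w f) x = (f + H w (E f)) x"
      by simp
  qed
  \<comment> \<open>The commutator \<open>G\<close> satisfies w G = G E, so w^k G f = G (E^k f) has
    norm at most C e^k N f. As e < norm w, dividing by w^k forces G f = 0. In this way
    \<open>E\<close> is never moved inside the pointwise sum.\<close>
  have comm: "E (H w f) = H w (E f)" if w: "e < norm w" and f: "f \<in> X" for w f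
  proof -
    define G where "G f = E (H w f) - H w (E f)" for f
    have "w \<noteq> 0" using w e by auto
    have G: "bounded_op X N G"
    proof -
      have "bounded_op X N (\<lambda>f. E (H w f) + cscale (-1) (H w (E f)))"
        by (rule bounded_op_plus[OF bounded_op_comp[OF E H_bop[OF w]]
              bounded_op_cscale[OF bounded_op_comp[OF H_bop[OF w] E]]])
      moreover have "(\<lambda>f. E (H w f) + cscale (-1) (H w (E f))) = G"
        by (auto simp: G_def fun_eq_iff)
      ultimately show ?thesis by simp
    qed
    obtain C where C: "0 \<le> C" "\<And>f. f \<in> X \<Longrightarrow> N (G f) \<le> C * N f"
      using bounded_op_bound[OF G] by blast
    have G_rec: "cscale w (G f) = G (E f)" if f: "f \<in> X" for f
    proof -
      note m = bounded_op_mem[OF E] bounded_op_mem[OF H_bop[OF w]]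
      have "cscale w (E (H w f)) = E (cscale w (H w f))"
        using f by (simp add: bounded_op_scale[OF E] m)
      also have "\<dots> = E f + E (H w (E f))"
        using f by (simp add: rec[OF w] bounded_op_add[OF E] m)
      finally have 1: "cscale w (E (H w f)) = E f + E (H w (E f))" .
      have 2: "cscale w (H w (E f)) = E f + H w (E (E f))"
        using f by (simp add: rec[OF w] m)
      have "w * E (H w f) x = E f x + E (H w (E f)) x" "w * H w (E f) x = E f x + H w (E (E f)) x" for x
        using 1 2 by (auto simp: fun_eq_iff)
      then show ?thesis
        by (auto simp: G_def fun_eq_iff right_diff_distrib)
    qed
    have G_pow: "cscale (w ^ k) (G f) = G ((E ^^ k) f)" for k
    proof (induction k)
      case (Suc k)
      have "cscale (w ^ Suc k) (G f) = cscale w (cscale (w ^ k) (G f))"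
        by (auto simp: fun_eq_iff)
      also have "\<dots> = G ((E ^^ Suc k) f)"
        by (simp only: Suc G_rec[OF pow_mem[OF f]] funpow.simps comp_apply)
      finally show ?case .
    qed (auto simp: fun_eq_iff)
    have "N (G f) \<le> C * N f * (e / norm w) ^ k" for k
    proof -
      have "norm w ^ k * N (G f) = N (G ((E ^^ k) f))"
        using N_scale[OF bounded_op_mem[OF G f], of "w ^ k"] by (simp add: G_pow norm_power)
      also have "\<dots> \<le> C * (e ^ k * N f)"
        using C(2)[OF pow_mem[OF f, of k]] mult_left_mono[OF pow_le[OF f, of k] C(1)] by linarith
      finally show ?thesis
        using \<open>w \<noteq> 0\<close> by (simp add: field_simps)
    qed
    moreover have "(\<lambda>k. C * N f * (e / norm w) ^ k) \<longlonglongrightarrow> C * N f * 0"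
      using w e by (intro tendsto_mult_left LIMSEQ_power_zero) (auto simp: lt1)
    ultimately have "N (G f) \<le> C * N f * 0"
      by (intro LIMSEQ_le_const) auto
    then have "G f = 0"
      using bounded_op_mem[OF G f] by (intro N_eq_0_imp) auto
    then show ?thesis
      by (simp add: G_def)
  qed
  \<comment> \<open>In the variable 1/w the series is a power series that converges on the disc of
    radius 1/e.\<close>
  have hol: "(\<lambda>w. H w f x) holomorphic_on {w. e < norm w}" if f: "f \<in> X" for f x
  proof -
    define a where "a v = (\<Sum>k. (E ^^ k) f x * v ^ k)" for v
    have "(\<lambda>k. (E ^^ k) f x * (v - 0) ^ k) sums a v" if v: "v \<in> ball 0 (1 / e)" for v
    proof -
      have "norm v * e < 1"
        using v e by (simp add: field_simps)
      have "summable (\<lambda>k. (E ^^ k) f x * v ^ k)"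
      proof (rule summable_comparison_test)
        show "summable (\<lambda>k. N f * (e * norm v) ^ k)"
          using \<open>norm v * e < 1\<close> e by (intro summable_mult summable_geometric) (auto simp: mult_ac)
        have "norm ((E ^^ k) f x * v ^ k) \<le> N f * (e * norm v) ^ k" for k
          using mult_right_mono[OF ev_le[OF f, of k x], of "norm v ^ k"]
          by (simp add: norm_mult norm_power power_mult_distrib mult_ac)
        then show "\<exists>N'. \<forall>k\<ge>N'. norm ((E ^^ k) f x * v ^ k) \<le> N f * (e * norm v) ^ k"
          by blast
      qed
      then show ?thesis
        unfolding a_def by (simp add: summable_sums)
    qed
    then have "a holomorphic_on ball 0 (1 / e)"
      by (rule power_series_holomorphic)
    then have "(\<lambda>w. (1 / w) * a (1 / w)) holomorphic_on {w. e < norm w}"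
      using e by (intro holomorphic_intros holomorphic_on_compose_gen[of "\<lambda>w. 1 / w" _ a "ball 0 (1 / e)", unfolded comp_def])
        (auto simp: norm_divide field_simps lt1)
    moreover have "(1 / w) * a (1 / w) = H w f x" if w: "e < norm w" for w
    proof -
      have "1 / w \<in> ball 0 (1 / e)"
        using w e by (auto simp: norm_divide field_simps lt1)
      then have "(\<lambda>k. (E ^^ k) f x * (1 / w - 0) ^ k) sums a (1 / w)"
        using \<open>\<And>v. v \<in> ball 0 (1 / e) \<Longrightarrow> (\<lambda>k. (E ^^ k) f x * (v - 0) ^ k) sums a v\<close> by blast
      then have "(\<lambda>k. (1 / w) * ((E ^^ k) f x * (1 / w) ^ k)) sums ((1 / w) * a (1 / w))"
        by (intro sums_mult) simp
      then have "(\<lambda>k. (E ^^ k) f x / w ^ Suc k) sums ((1 / w) * a (1 / w))"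
        by (simp add: power_divide mult_ac)
      with sums[OF w f, of x] show ?thesis
        using sums_unique2 by blast
    qed
    ultimately show ?thesis
      by (rule holomorphic_transform) auto
  qed
  have "inverse_family e E (\<lambda>_. 1) H"
    unfolding inverse_family_def
  proof (intro conjI ballI allI impI)
    fix w :: complex and f assume w: "e < norm w" and f: "f \<in> X"
    show "cscale w (H w f) - E (H w f) = cscale 1 f"
      by (simp add: comm[OF w f] rec[OF w f] fun_eq_iff)
    have "H w (cscale w f - E f) = cscale w (H w f) - H w (E f)"
      using f by (simp add: bounded_op_minus[OF H_bop[OF w]] bounded_op_scale[OF H_bop[OF w]]
          scale_mem bounded_op_mem[OF E])
    then show "H w (cscale w f - E f) = cscale 1 f"
      by (simp add: rec[OF w f] fun_eq_iff)
  qed (use hol H_bop in auto)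
  then show ?thesis
    by blast
qed

end

text \<open>In closed form this is the sum of \<zeta>^(n-1-j) M^j over j < n, the quotient of
  \<zeta>^n - M^n by \<zeta> - M. It turns an inverse of \<zeta>^n - M^n into one of \<zeta> -
  M.\<close>

primrec power_sum ::
    "(('a \<Rightarrow> complex) \<Rightarrow> 'a \<Rightarrow> complex) \<Rightarrow> complex \<Rightarrow> nat \<Rightarrow> ('a \<Rightarrow> complex) \<Rightarrow> 'a \<Rightarrow> complex" where
  "power_sum M \<zeta> 0 f = 0"
| "power_sum M \<zeta> (Suc n) f = cscale \<zeta> (power_sum M \<zeta> n f) + (M ^^ n) f"

section \<open>Finite-rank perturbation of an inverse family\<close>

context function_banach_space
begin

lemma bounded_op_lin_apply:
  assumes "bounded_op X N A" "f \<in> X" "g \<in> X"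
  shows "A (cscale a f + cscale b g) x = a * A f x + b * A g x"
  using bounded_op_add[OF assms(1) scale_mem[OF assms(2), of a] scale_mem[OF assms(3), of b]]
    bounded_op_scale[OF assms(1,2), of a] bounded_op_scale[OF assms(1,3), of b]
  by (simp only: plus_fun_apply cscale_apply)

text \<open>This is the Sherman--Morrison formula with denominators cleared.\<close>

lemma inverse_family_rank_one:
  assumes T: "bounded_op X N T" and fam: "inverse_family e T d H" and u: "u \<in> X"
  shows "inverse_family e (\<lambda>f. T f + cscale (f p) u) (\<lambda>w. d w * (d w - H w u p))
           (\<lambda>w f. cscale (d w - H w u p) (H w f) + cscale (H w f p) (H w u))"
proof -
  note D = inverse_familyD[OF fam]
  have mem: "H w f \<in> X" if "e < norm w" "f \<in> X" for w f
    using bounded_op_mem[OF D(3)] that by blast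
  have right: "w * H w f x - T (H w f) x = d w * f x" if "e < norm w" "f \<in> X" for w f x
    using fun_cong[OF D(4)[OF that], of x] by (simp only: minus_apply cscale_apply)
  show ?thesis
    unfolding inverse_family_def
  proof (intro conjI ballI allI impI)
    show "(\<lambda>w. d w * (d w - H w u p)) holomorphic_on {w. e < norm w}"
      by (intro holomorphic_intros D u)
    show "(\<lambda>w. (cscale (d w - H w u p) (H w f) + cscale (H w f p) (H w u)) x)
        holomorphic_on {w. e < norm w}" if "f \<in> X" for f x
      unfolding plus_fun_apply cscale_apply by (intro holomorphic_intros D u that)
    fix w :: complex assume w: "e < norm w"
    show "bounded_op X N (\<lambda>f. cscale (d w - H w u p) (H w f) + cscale (H w f p) (H w u))"
      by (rule bounded_op_plus[OF bounded_op_cscale[OF D(3)[OF w]]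
            bounded_op_eval[OF D(3)[OF w] mem[OF w u]]])
    fix f assume f: "f \<in> X"
    show "cscale w (cscale (d w - H w u p) (H w f) + cscale (H w f p) (H w u)) -
        (T (cscale (d w - H w u p) (H w f) + cscale (H w f p) (H w u)) +
         cscale ((cscale (d w - H w u p) (H w f) + cscale (H w f p) (H w u)) p) u) =
        cscale (d w * (d w - H w u p)) f"
    proof
      fix x
      \<comment> \<open>Applied with a = d w - H w u p and b = H w f p. Then c, the value of a H w f
        + b H w u at p, equals d w * b, and the multiples of \<open>u\<close> cancel.\<close>
      have "w * (a * H w f x + b * H w u x) - (a * T (H w f) x + b * T (H w u) x + c * u x) =
          d w * (a * f x + b * u x) - c * u x" for a b c
        using right[OF w f, of x] right[OF w u, of x] by algebra
      then show "(cscale w (cscale (d w - H w u p) (H w f) + cscale (H w f p) (H w u)) -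
        (T (cscale (d w - H w u p) (H w f) + cscale (H w f p) (H w u)) +
         cscale ((cscale (d w - H w u p) (H w f) + cscale (H w f p) (H w u)) p) u)) x =
        cscale (d w * (d w - H w u p)) f x"
        unfolding plus_fun_apply cscale_apply minus_apply
          bounded_op_lin_apply[OF T mem[OF w f] mem[OF w u]]
        by (simp only:) (simp add: algebra_simps)
    qed
    define g where "g = cscale w f - (T f + cscale (f p) u)"
    have Tf: "cscale w f - T f \<in> X"
      by (intro minus_mem scale_mem bounded_op_mem[OF T] f)
    have "g = cscale 1 (cscale w f - T f) + cscale (- f p) u"
      by (auto simp: g_def fun_eq_iff)
    then have "H w g x = 1 * H w (cscale w f - T f) x + (- f p) * H w u x" for x
      by (simp only: bounded_op_lin_apply[OF D(3)[OF w] Tf u])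
    then have Hg: "H w g x = d w * f x - f p * H w u x" for x
      unfolding D(5)[OF w f] by simp
    then show "cscale (d w - H w u p) (H w (cscale w f - (T f + cscale (f p) u))) +
        cscale (H w (cscale w f - (T f + cscale (f p) u)) p) (H w u) =
        cscale (d w * (d w - H w u p)) f"
      unfolding g_def[symmetric] fun_eq_iff plus_fun_apply cscale_apply
      by (simp only: Hg) (simp add: algebra_simps)
  qed
qed

text \<open>The second conclusion keeps \<open>d\<close> from vanishing identically, so that its
  zeros will be isolated. It holds where norm w exceeds a bound for the operator norm: a zero of a
  factor of \<open>d\<close> there would produce an eigenvector whose eigenvalue w is too
  large.\<close>

lemma finite_rank_inverse_family:
  assumes E: "bounded_op X N E" and e: "0 < e" and E_le: "\<And>f. f \<in> X \<Longrightarrow> N (E f) \<le> e * N f"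
    and J: "finite J" and u: "\<And>j. j \<in> J \<Longrightarrow> u j \<in> X"
  shows "\<exists>d H. inverse_family e (\<lambda>f. E f + (\<Sum>j\<in>J. cscale (f (p j)) (u j))) d H \<and>
     (\<forall>w. e + (\<Sum>j\<in>J. N (u j)) < norm w \<longrightarrow> d w \<noteq> 0)"
  using J u
proof (induction J)
  case empty
  obtain H where "inverse_family e E (\<lambda>_. 1) H"
    using neumann_inverse_family[OF E e E_le] by blast
  then show ?case
    by (intro exI[of _ "\<lambda>_. 1"] exI[of _ H]) simp
next
  case (insert j J)
  define T where "T f = E f + (\<Sum>j\<in>J. cscale (f (p j)) (u j))" for f
  define T' where "T' f = T f + cscale (f (p j)) (u j)" for f
  have u: "u j \<in> X" "\<And>i. i \<in> J \<Longrightarrow> u i \<in> X"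
    using insert.prems by auto
  obtain d H where fam: "inverse_family e T d H"
    and d: "\<And>w. e + (\<Sum>j\<in>J. N (u j)) < norm w \<Longrightarrow> d w \<noteq> 0"
    using insert.IH u(2) unfolding T_def by blast
  have rank1: "bounded_op X N (\<lambda>f. cscale (f (p j)) (u j))" if "u j \<in> X" for j
    by (rule bounded_op_eval[OF bounded_op_id that])
  have T: "bounded_op X N T"
    unfolding T_def by (rule bounded_op_plus[OF E bounded_op_sum_ops[OF rank1[OF u(2)]]])
  have T'_le: "N (T' f) \<le> (e + (\<Sum>j\<in>insert j J. N (u j))) * N f" if f: "f \<in> X" for f
  proof -
    have le: "N (cscale (f (p i)) (u i)) \<le> N (u i) * N f" if "u i \<in> X" for i
      using mult_left_mono[OF eval_le[OF f, of "p i"] N_nonneg[OF that]]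
      by (simp add: N_scale[OF that] mult.commute)
    have "N (T' f) \<le> N (T f) + N (cscale (f (p j)) (u j))"
      unfolding T'_def by (intro N_add bounded_op_mem[OF T] scale_mem u f)
    also have "N (T f) \<le> N (E f) + N (\<Sum>j\<in>J. cscale (f (p j)) (u j))"
      unfolding T_def by (intro N_add bounded_op_mem[OF E] sum_mem scale_mem u f)
    also have "N (\<Sum>j\<in>J. cscale (f (p j)) (u j)) \<le> (\<Sum>j\<in>J. N (cscale (f (p j)) (u j)))"
      by (intro N_sum scale_mem u)
    also have "\<dots> \<le> (\<Sum>j\<in>J. N (u j) * N f)"
      by (intro sum_mono le u)
    finally have "N (T' f) \<le> N (E f) + (\<Sum>j\<in>J. N (u j) * N f) + N (cscale (f (p j)) (u j))"
      by - linarith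
    also have "\<dots> \<le> e * N f + (\<Sum>j\<in>J. N (u j)) * N f + N (u j) * N f"
      unfolding sum_distrib_right by (intro add_mono order_refl E_le f le u)
    finally show ?thesis
      using insert.hyps by (simp add: algebra_simps)
  qed
  have fam': "inverse_family e T' (\<lambda>w. d w * (d w - H w (u j) (p j)))
     (\<lambda>w f. cscale (d w - H w (u j) (p j)) (H w f) + cscale (H w f (p j)) (H w (u j)))"
    unfolding T'_def by (rule inverse_family_rank_one[OF T fam u(1)])
  have T'_eq: "T' = (\<lambda>f. E f + (\<Sum>j\<in>insert j J. cscale (f (p j)) (u j)))"
    using insert.hyps by (auto simp: T'_def T_def fun_eq_iff)
  have "d w * (d w - H w (u j) (p j)) \<noteq> 0" if w: "e + (\<Sum>j\<in>insert j J. N (u j)) < norm w" for w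
  proof
    assume 0: "d w * (d w - H w (u j) (p j)) = 0"
    have sum: "(\<Sum>j\<in>insert j J. N (u j)) = N (u j) + (\<Sum>j\<in>J. N (u j))"
      using insert.hyps by simp
    have nonneg: "0 \<le> N (u j)" "0 \<le> (\<Sum>j\<in>J. N (u j))"
      by (intro N_nonneg sum_nonneg u; assumption)+
    have "d w \<noteq> 0"
      using w nonneg sum by (intro d) linarith
    with 0 have eq: "H w (u j) (p j) = d w"
      by simp
    have ew: "e < norm w"
      using w nonneg sum by linarith
    have Hu: "H w (u j) \<in> X"
      using bounded_op_mem[OF inverse_familyD(3)[OF fam ew] u(1)] .
    have "cscale w (H w (u j)) - T (H w (u j)) = cscale (d w) (u j)"
      by (rule inverse_familyD(4)[OF fam ew u(1)])
    \<comment> \<open>Where the new factor vanishes, \<open>H w (u j)\<close> takes the value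
      \<open>d w\<close> at \<open>p j\<close>, and the rank-one term restores exactly the multiple
      of \<open>u j\<close> by which \<open>T\<close> fails to act as w.\<close>
    then have "T' (H w (u j)) = cscale w (H w (u j))"
      unfolding T'_def eq by (auto simp: fun_eq_iff algebra_simps)
    then have "norm w * N (H w (u j)) \<le> (e + (\<Sum>j\<in>insert j J. N (u j))) * N (H w (u j))"
      using T'_le[OF Hu] N_scale[OF Hu, of w] by simp
    moreover have "0 < N (H w (u j))"
      using eval_le[OF Hu, of "p j"] \<open>d w \<noteq> 0\<close> eq by (metis order_less_le_trans zero_less_norm_iff)
    ultimately show False
      using w by (simp add: mult_le_cancel_right)
  qed
  with fam' show ?case
    unfolding T'_eq[symmetric] by blast
qed

section \<open>From a power of an operator back to the operator\<close>

lemma bounded_op_zero_op: "bounded_op X N (\<lambda>_. 0)"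
proof (rule bounded_opI[where B = 0])
  show "0 \<in> X" "N 0 \<le> 0 * N f" for f
    using N_zero zero_mem by simp_all
qed (auto simp: fun_eq_iff)

lemma bounded_op_power_sum:
  assumes M: "bounded_op X N M"
  shows "bounded_op X N (power_sum M \<zeta> n)"
proof (induction n)
  case 0
  have "power_sum M \<zeta> 0 = (\<lambda>_. 0)"
    by (rule ext) (rule power_sum.simps)
  then show ?case
    by (simp only: bounded_op_zero_op)
next
  case (Suc n)
  have "bounded_op X N (\<lambda>f. cscale \<zeta> (power_sum M \<zeta> n f) + (M ^^ n) f)"
    by (rule bounded_op_plus[OF bounded_op_cscale[OF Suc] bounded_op_funpow[OF M]])
  moreover have "power_sum M \<zeta> (Suc n) = (\<lambda>f. cscale \<zeta> (power_sum M \<zeta> n f) + (M ^^ n) f)"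
    by (rule ext) (rule power_sum.simps)
  ultimately show ?case
    by (simp only:)
qed

lemma power_sum_right:
  assumes M: "bounded_op X N M" and f: "f \<in> X"
  shows "power_sum M \<zeta> n (cscale \<zeta> f - M f) = cscale (\<zeta> ^ n) f - (M ^^ n) f"
proof (induction n)
  case (Suc n)
  have "(M ^^ n) (cscale \<zeta> f - M f) = cscale \<zeta> ((M ^^ n) f) - (M ^^ Suc n) f"
    using bounded_op_minus[OF bounded_op_funpow[OF M, of n] scale_mem[OF f, of \<zeta>] bounded_op_mem[OF M f]]
      bounded_op_scale[OF bounded_op_funpow[OF M, of n] f, of \<zeta>]
    by (simp only: funpow_Suc_right comp_apply)
  then show ?case
    unfolding power_sum.simps Suc by (auto simp: fun_eq_iff algebra_simps)
qed (auto simp: fun_eq_iff)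

lemma power_sum_left:
  assumes M: "bounded_op X N M" and f: "f \<in> X"
  shows "cscale \<zeta> (power_sum M \<zeta> n f) - M (power_sum M \<zeta> n f) = cscale (\<zeta> ^ n) f - (M ^^ n) f"
proof (induction n)
  case 0
  show ?case
    unfolding power_sum.simps bounded_op_zero[OF M] by (auto simp: fun_eq_iff)
next
  case (Suc n)
  have mem: "power_sum M \<zeta> n f \<in> X" "(M ^^ n) f \<in> X"
    using bounded_op_mem[OF bounded_op_power_sum[OF M] f] bounded_op_mem[OF bounded_op_funpow[OF M] f]
    by auto
  have "power_sum M \<zeta> (Suc n) f = cscale \<zeta> (power_sum M \<zeta> n f) + cscale 1 ((M ^^ n) f)"
    by (auto simp: fun_eq_iff)
  then have 1: "M (power_sum M \<zeta> (Suc n) f) x = \<zeta> * M (power_sum M \<zeta> n f) x + 1 * M ((M ^^ n) f) x" for x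
    using bounded_op_lin_apply[OF M mem, of \<zeta> 1 x] by (simp only:)
  have 2: "\<zeta> * (\<zeta> * power_sum M \<zeta> n f x - M (power_sum M \<zeta> n f) x) =
      \<zeta> * (\<zeta> ^ n * f x - (M ^^ n) f x)" for x
    using fun_cong[OF Suc, of x] by (simp only: minus_apply cscale_apply)
  have 3: "power_sum M \<zeta> (Suc n) f x = \<zeta> * power_sum M \<zeta> n f x + (M ^^ n) f x" for x
    by simp
  have 4: "(M ^^ Suc n) f x = M ((M ^^ n) f) x" for x
    by simp
  have "\<zeta> * power_sum M \<zeta> (Suc n) f x - M (power_sum M \<zeta> (Suc n) f) x =
      \<zeta> ^ Suc n * f x - (M ^^ Suc n) f x" for x
    using 2[of x] by (simp only: 1 3 4 power_Suc) (simp add: algebra_simps)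
  then show ?case
    by (intro ext) (simp only: minus_apply cscale_apply)
qed

end

section \<open>Quasi-compact operators\<close>

text \<open>Bolzano-Weierstrass, one index at a time: a further subsequence keeps the limits already
  found. The spectral argument asks for compactness only of these finitely many scalars.\<close>

lemma finite_family_convergent_subsequence:
  fixes c :: "nat \<Rightarrow> 'j \<Rightarrow> complex"
  assumes "finite J" "\<And>j k. j \<in> J \<Longrightarrow> norm (c k j) \<le> C"
  shows "\<exists>r l. strict_mono (r :: nat \<Rightarrow> nat) \<and> (\<forall>j\<in>J. (\<lambda>k. c (r k) j) \<longlonglongrightarrow> l j)"
  using assms
proof (induction J)
  case empty
  show ?case
    by (intro exI[of _ "\<lambda>k. k"]) (auto simp: strict_mono_def)
next
  case (insert j J)
  then obtain r l where r: "strict_mono (r :: nat \<Rightarrow> nat)" and l: "\<forall>j\<in>J. (\<lambda>k. c (r k) j) \<longlonglongrightarrow> l j"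
    by auto
  have "bounded (range (\<lambda>k. c (r k) j))"
    using insert.prems by (auto intro!: boundedI[of _ C])
  then obtain s m where s: "strict_mono (s :: nat \<Rightarrow> nat)" and m: "((\<lambda>k. c (r k) j) \<circ> s) \<longlonglongrightarrow> m"
    using bounded_imp_convergent_subsequence by blast
  have "\<forall>i\<in>insert j J. (\<lambda>k. c ((r \<circ> s) k) i) \<longlonglongrightarrow> (if i = j then m else l i)"
  proof
    fix i assume i: "i \<in> insert j J"
    show "(\<lambda>k. c ((r \<circ> s) k) i) \<longlonglongrightarrow> (if i = j then m else l i)"
    proof (cases "i = j")
      case False
      with i l have "(\<lambda>k. c (r k) i) \<longlonglongrightarrow> l i"
        by auto
      from LIMSEQ_subseq_LIMSEQ[OF this s] show ?thesis
        using False by (simp add: o_def)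
    qed (use m in \<open>simp add: o_def\<close>)
  qed
  with strict_mono_o[OF r s] show ?case
    by (intro exI[of _ "r \<circ> s"] exI[of _ "\<lambda>i. if i = j then m else l i"] conjI)
qed

text \<open>As long as the exponent exceeds 1, the bound along the ray forces
  \<open>Y \<mu> = 0\<close> and a factor can be divided out. The induction ends at a simple pole,
  where the residue is the limit of t G(\<mu> + t) and Cauchy's formula gives the integral. The
  bound is asked for on one ray only, because resolvents will be controlled only outside the disc of
  radius \<rho>.\<close>

lemma simple_pole_residue:
  assumes "Y holomorphic_on ball \<mu> R" "0 < r" "r < R"
    and "\<And>\<zeta>. \<zeta> \<in> ball \<mu> R - {\<mu>} \<Longrightarrow> G \<zeta> = Y \<zeta> / (\<zeta> - \<mu>) ^ Suc k"
    and "\<And>t. 0 < t \<Longrightarrow> t < R \<Longrightarrow> t * norm (G (\<mu> + of_real t)) \<le> C"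
  shows "\<exists>c. ((\<lambda>t. of_real t * G (\<mu> + of_real t)) \<longlongrightarrow> c) (at_right 0) \<and>
     contour_integral (circlepath \<mu> r) G = 2 * of_real pi * \<i> * c"
  using assms
proof (induction k arbitrary: Y)
  case 0
  have mu: "\<mu> \<in> ball \<mu> R"
    using 0 by auto
  have cont: "isCont Y \<mu>"
    using 0(1) mu holomorphic_on_imp_continuous_on continuous_on_interior
    by (metis interior_ball)
  have "((\<lambda>t::real. \<mu> + of_real t) \<longlongrightarrow> \<mu> + of_real 0) (at_right 0)"
    by (intro tendsto_intros)
  then have lim: "((\<lambda>t. Y (\<mu> + of_real t)) \<longlongrightarrow> Y \<mu>) (at_right (0::real))"
    using isCont_tendsto_compose[OF cont, of "\<lambda>t. \<mu> + of_real t"] by simp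
  have "eventually (\<lambda>t. t \<in> {0<..<R}) (at_right 0)"
    using 0 by (intro eventually_at_right_real) auto
  then have "eventually (\<lambda>t. Y (\<mu> + of_real t) = of_real t * G (\<mu> + of_real t)) (at_right 0)"
    by eventually_elim (use 0(4) in \<open>auto simp: dist_norm\<close>)
  with lim have lim: "((\<lambda>t. of_real t * G (\<mu> + of_real t)) \<longlongrightarrow> Y \<mu>) (at_right 0)"
    using tendsto_cong by force
  have "((\<lambda>u. Y u / (u - \<mu>)) has_contour_integral (2 * of_real pi * \<i> * Y \<mu>)) (circlepath \<mu> r)"
    using 0 by (intro Cauchy_integral_circlepath)
      (auto intro!: holomorphic_on_imp_continuous_on elim!: holomorphic_on_subset)
  moreover have "Y u / (u - \<mu>) = G u" if "u \<in> path_image (circlepath \<mu> r)" for u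
    using that 0 by (subst 0(4)) (auto simp: dist_norm norm_minus_commute)
  ultimately have "(G has_contour_integral (2 * of_real pi * \<i> * Y \<mu>)) (circlepath \<mu> r)"
    by (rule has_contour_integral_eq)
  with lim show ?case
    using contour_integral_unique by blast
next
  case (Suc k)
  have mu: "\<mu> \<in> ball \<mu> R"
    using Suc.prems by auto
  have cont: "isCont Y \<mu>"
    using Suc.prems(1) mu holomorphic_on_imp_continuous_on continuous_on_interior
    by (metis interior_ball)
  have "((\<lambda>t::real. \<mu> + of_real t) \<longlongrightarrow> \<mu> + of_real 0) (at_right 0)"
    by (intro tendsto_intros)
  then have lim: "((\<lambda>t. Y (\<mu> + of_real t)) \<longlongrightarrow> Y \<mu>) (at_right (0::real))"
    using isCont_tendsto_compose[OF cont, of "\<lambda>t. \<mu> + of_real t"] by simp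
  have "eventually (\<lambda>t. t \<in> {0<..<R}) (at_right 0)"
    using Suc.prems by (intro eventually_at_right_real) auto
  then have "eventually (\<lambda>t. norm (Y (\<mu> + of_real t)) \<le> C * t ^ Suc k) (at_right 0)"
  proof eventually_elim
    case (elim t)
    then have "Y (\<mu> + of_real t) = of_real t * G (\<mu> + of_real t) * of_real t ^ Suc k"
      using Suc.prems(4)[of "\<mu> + of_real t"] by (auto simp: dist_norm)
    then have "norm (Y (\<mu> + of_real t)) = t * norm (G (\<mu> + of_real t)) * t ^ Suc k"
      using elim by (simp add: norm_mult norm_power)
    also have "\<dots> \<le> C * t ^ Suc k"
      using elim Suc.prems(5)[of t] by (intro mult_right_mono) auto
    finally show ?case .
  qed
  then have "norm (Y \<mu>) \<le> C * 0 ^ Suc k"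
    by (rule tendsto_le[OF trivial_limit_at_right_real _ tendsto_norm[OF lim], rotated])
      (intro tendsto_intros)
  then have Y0: "Y \<mu> = 0"
    by simp
  define Y1 where "Y1 = (\<lambda>z. if z = \<mu> then deriv Y \<mu> else (Y z - Y \<mu>) / (z - \<mu>))"
  show ?case
  proof (rule Suc.IH)
    show "Y1 holomorphic_on ball \<mu> R"
      unfolding Y1_def by (rule pole_lemma_open) (use Suc.prems in auto)
    show "G \<zeta> = Y1 \<zeta> / (\<zeta> - \<mu>) ^ Suc k" if "\<zeta> \<in> ball \<mu> R - {\<mu>}" for \<zeta>
      using that Suc.prems(4)[OF that] by (simp add: Y1_def Y0)
  qed (use Suc.prems in auto)
qed

text \<open>A splitting of \<open>M ^^ n\<close> into \<open>E\<close>, whose spectrum lies in the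
  disc of radius \<open>q ^ n\<close>, and evaluations at finitely many points \<open>p j\<close>.
  \<open>H\<close> over \<open>d\<close> inverts w minus the whole sum, \<open>H0\<close> inverts w
  minus \<open>E\<close> alone. Both are carried: \<open>H\<close> produces the resolvent, and
  \<open>H0\<close>, which has no denominator, shows that its singularities are
  finite-dimensional.\<close>

locale power_inverse_family = function_banach_space X N
  for X :: "('a \<Rightarrow> complex) set" and N +
  fixes M E :: "('a \<Rightarrow> complex) \<Rightarrow> 'a \<Rightarrow> complex" and n :: nat and q :: real
    and J :: "'j set" and p :: "'j \<Rightarrow> 'a" and u :: "'j \<Rightarrow> 'a \<Rightarrow> complex"
    and d :: "complex \<Rightarrow> complex" and H H0 :: "complex \<Rightarrow> ('a \<Rightarrow> complex) \<Rightarrow> 'a \<Rightarrow> complex"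
    and B :: real
  assumes M: "bounded_op X N M" and n: "0 < n" and q: "0 < q" and J: "finite J"
    and u: "\<And>j. j \<in> J \<Longrightarrow> u j \<in> X"
    and M_pow: "\<And>f. f \<in> X \<Longrightarrow> (M ^^ n) f = E f + (\<Sum>j\<in>J. cscale (f (p j)) (u j))"
    and fam: "inverse_family (q ^ n) (\<lambda>f. E f + (\<Sum>j\<in>J. cscale (f (p j)) (u j))) d H"
    and fam0: "inverse_family (q ^ n) E (\<lambda>_. 1) H0"
    and d_large: "\<And>w. B < norm w \<Longrightarrow> d w \<noteq> 0"
begin

lemma pow_gt: "q < norm \<zeta> \<Longrightarrow> q ^ n < norm (\<zeta> ^ n)" for \<zeta> :: complex
  using power_strict_mono[of q "norm \<zeta>" n] n q by (simp add: norm_power)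

abbreviation outside :: "complex set" where "outside \<equiv> {\<zeta>. q < norm \<zeta>}"

lemma outside_eq: "outside = - cball 0 q"
  by auto

lemma open_outside: "open outside"
  unfolding outside_eq by auto

lemma connected_outside: "connected outside"
  unfolding outside_eq by (rule connected_complement_bounded_convex) auto

lemma bop_H: "q < norm \<zeta> \<Longrightarrow> bounded_op X N (H (\<zeta> ^ n))"
  and bop_H0: "q < norm \<zeta> \<Longrightarrow> bounded_op X N (H0 (\<zeta> ^ n))"
  using inverse_familyD(3)[OF fam] inverse_familyD(3)[OF fam0] pow_gt by blast+

lemma bop_S: "bounded_op X N (power_sum M \<zeta> n)"
  by (rule bounded_op_power_sum[OF M])

lemmas mem_M = bounded_op_mem[OF M]
lemmas mem_Mk = bounded_op_mem[OF bounded_op_funpow[OF M]]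
lemmas mem_H = bounded_op_mem[OF bop_H]
lemmas mem_H0 = bounded_op_mem[OF bop_H0]
lemmas mem_S = bounded_op_mem[OF bop_S]

lemma H_right: "q < norm \<zeta> \<Longrightarrow> f \<in> X \<Longrightarrow> cscale (\<zeta> ^ n) (H (\<zeta> ^ n) f) - (M ^^ n) (H (\<zeta> ^ n) f) = cscale (d (\<zeta> ^ n)) f"
  using inverse_familyD(4)[OF fam pow_gt] by (simp only: M_pow mem_H)

lemma H_left: "q < norm \<zeta> \<Longrightarrow> f \<in> X \<Longrightarrow> H (\<zeta> ^ n) (cscale (\<zeta> ^ n) f - (M ^^ n) f) = cscale (d (\<zeta> ^ n)) f"
  using inverse_familyD(5)[OF fam pow_gt] by (simp only: M_pow)

lemma cscale_left_cancel: "c \<noteq> 0 \<Longrightarrow> cscale c f = cscale c g \<Longrightarrow> f = g"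
  by (simp add: fun_eq_iff)

text \<open>\<open>M\<close> commutes with \<zeta>^n - M^n and hence with its inverse. Cancelling
  the common factor is what requires \<open>d (\<zeta> ^ n)\<close> to be nonzero.\<close>

lemma H_M_commute:
  assumes \<zeta>: "q < norm \<zeta>" and d: "d (\<zeta> ^ n) \<noteq> 0" and f: "f \<in> X"
  shows "H (\<zeta> ^ n) (M f) = M (H (\<zeta> ^ n) f)"
proof -
  define g where "g = H (\<zeta> ^ n) f"
  have g: "g \<in> X"
    unfolding g_def by (rule mem_H[OF \<zeta> f])
  have "M (cscale (\<zeta> ^ n) g - (M ^^ n) g) = cscale (\<zeta> ^ n) (M g) - (M ^^ n) (M g)"
    by (simp only: bounded_op_minus[OF M scale_mem[OF g] mem_Mk[OF g]] bounded_op_scale[OF M g]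
        funpow_swap1)
  also have "cscale (\<zeta> ^ n) g - (M ^^ n) g = cscale (d (\<zeta> ^ n)) f"
    unfolding g_def by (rule H_right[OF \<zeta> f])
  finally have "H (\<zeta> ^ n) (cscale (d (\<zeta> ^ n)) (M f)) = cscale (d (\<zeta> ^ n)) (M g)"
    using H_left[OF \<zeta> mem_M[OF g]] by (simp only: bounded_op_scale[OF M f])
  then have "cscale (d (\<zeta> ^ n)) (H (\<zeta> ^ n) (M f)) = cscale (d (\<zeta> ^ n)) (M g)"
    by (simp only: bounded_op_scale[OF bop_H[OF \<zeta>] mem_M[OF f]])
  from cscale_left_cancel[OF d this] show ?thesis
    by (simp only: g_def)
qed

text \<open>The resolvent as the inverse of \<zeta>^n - M^n, which is \<open>H\<close> divided by
  \<open>d\<close>, applied after the quotient polynomial \<open>power_sum\<close>.\<close>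

definition res :: "complex \<Rightarrow> ('a \<Rightarrow> complex) \<Rightarrow> 'a \<Rightarrow> complex" where
  "res \<zeta> f = cscale (1 / d (\<zeta> ^ n)) (H (\<zeta> ^ n) (power_sum M \<zeta> n f))"

lemma is_resolvent_res:
  assumes \<zeta>: "q < norm \<zeta>" and d: "d (\<zeta> ^ n) \<noteq> 0"
  shows "is_resolvent_at X N M \<zeta> (res \<zeta>)"
  unfolding is_resolvent_at_def
proof (intro conjI ballI)
  show "bounded_op X N (res \<zeta>)"
    unfolding res_def[abs_def] by (rule bounded_op_cscale[OF bounded_op_comp[OF bop_H[OF \<zeta>] bop_S]])
  fix f assume f: "f \<in> X"
  have d1: "cscale (1 / d (\<zeta> ^ n)) (cscale (d (\<zeta> ^ n)) f) = f"
    using d by (simp add: fun_eq_iff)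
  show "res \<zeta> (cscale \<zeta> f - M f) = f"
    unfolding res_def power_sum_right[OF M f] H_left[OF \<zeta> f] by (rule d1)
  define s where "s = power_sum M \<zeta> n f"
  have s: "s \<in> X"
    unfolding s_def by (rule mem_S[OF f])
  have "cscale \<zeta> (res \<zeta> f) - M (res \<zeta> f) =
      cscale (1 / d (\<zeta> ^ n)) (cscale \<zeta> (H (\<zeta> ^ n) s) - M (H (\<zeta> ^ n) s))"
    unfolding res_def s_def[symmetric] bounded_op_scale[OF M mem_H[OF \<zeta> s]]
    by (simp add: fun_eq_iff right_diff_distrib)
  also have "cscale \<zeta> (H (\<zeta> ^ n) s) - M (H (\<zeta> ^ n) s) = H (\<zeta> ^ n) (cscale \<zeta> s - M s)"
    by (simp only: bounded_op_minus[OF bop_H[OF \<zeta>] scale_mem[OF s] mem_M[OF s]]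
        bounded_op_scale[OF bop_H[OF \<zeta>] s] H_M_commute[OF \<zeta> d s])
  also have "cscale \<zeta> s - M s = cscale (\<zeta> ^ n) f - (M ^^ n) f"
    unfolding s_def by (rule power_sum_left[OF M f])
  also have "H (\<zeta> ^ n) \<dots> = cscale (d (\<zeta> ^ n)) f"
    by (rule H_left[OF \<zeta> f])
  finally show "cscale \<zeta> (res \<zeta> f) - M (res \<zeta> f) = f"
    using d1 by (simp only:)
qed

lemma spectrum_imp_zero:
  "\<zeta> \<in> spectrum_on X N M \<Longrightarrow> q < norm \<zeta> \<Longrightarrow> d (\<zeta> ^ n) = 0"
  using is_resolvent_res unfolding spectrum_on_def by blast

lemma holomorphic_d: "(\<lambda>\<zeta>. d (\<zeta> ^ n)) holomorphic_on outside"
proof -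
  have "(d \<circ> (\<lambda>\<zeta>. \<zeta> ^ n)) holomorphic_on outside"
    by (rule holomorphic_on_compose_gen[OF _ inverse_familyD(1)[OF fam]])
      (use pow_gt in \<open>auto intro!: holomorphic_intros\<close>)
  then show ?thesis
    by (simp add: o_def)
qed

lemma holomorphic_H: "f \<in> X \<Longrightarrow> (\<lambda>\<zeta>. H (\<zeta> ^ n) f x) holomorphic_on outside"
proof -
  assume f: "f \<in> X"
  have "((\<lambda>w. H w f x) \<circ> (\<lambda>\<zeta>. \<zeta> ^ n)) holomorphic_on outside"
    by (rule holomorphic_on_compose_gen[OF _ inverse_familyD(2)[OF fam f]])
      (use pow_gt in \<open>auto intro!: holomorphic_intros\<close>)
  then show ?thesis
    by (simp add: o_def)
qed

lemma holomorphic_H0: "f \<in> X \<Longrightarrow> (\<lambda>\<zeta>. H0 (\<zeta> ^ n) f x) holomorphic_on outside"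
proof -
  assume f: "f \<in> X"
  have "((\<lambda>w. H0 w f x) \<circ> (\<lambda>\<zeta>. \<zeta> ^ n)) holomorphic_on outside"
    by (rule holomorphic_on_compose_gen[OF _ inverse_familyD(2)[OF fam0 f]])
      (use pow_gt in \<open>auto intro!: holomorphic_intros\<close>)
  then show ?thesis
    by (simp add: o_def)
qed

text \<open>Here the argument of \<open>A \<zeta>\<close> varies with \<zeta> too. By linearity the
  powers of \<zeta> come out in front, which leaves \<open>A \<zeta>\<close> applied to the fixed
  functions \<open>(M ^^ j) f\<close>.\<close>

lemma holomorphic_power_sum:
  assumes hol: "\<And>f x. f \<in> X \<Longrightarrow> (\<lambda>\<zeta>. A \<zeta> f x) holomorphic_on outside"
    and A: "\<And>\<zeta>. q < norm \<zeta> \<Longrightarrow> bounded_op X N (A \<zeta>)" and f: "f \<in> X"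
  shows "(\<lambda>\<zeta>. A \<zeta> (power_sum M \<zeta> k f) x) holomorphic_on outside"
proof (induction k)
  case 0
  have "A \<zeta> 0 x = 0" if "q < norm \<zeta>" for \<zeta>
    by (simp only: bounded_op_zero[OF A[OF that]] zero_fun_apply)
  then show ?case
    by (intro holomorphic_transform[OF holomorphic_on_const[of 0]]) (simp only: power_sum.simps mem_Collect_eq)
next
  case (Suc k)
  have eq: "\<zeta> * A \<zeta> (power_sum M \<zeta> k f) x + A \<zeta> ((M ^^ k) f) x = A \<zeta> (power_sum M \<zeta> (Suc k) f) x"
    if "q < norm \<zeta>" for \<zeta>
    using bounded_op_mem[OF bounded_op_power_sum[OF M] f, of \<zeta> k]
    by (simp only: power_sum.simps bounded_op_add[OF A[OF that]] bounded_op_scale[OF A[OF that]]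
        scale_mem mem_Mk[OF f] plus_fun_apply cscale_apply)
  have hol': "(\<lambda>\<zeta>. \<zeta> * A \<zeta> (power_sum M \<zeta> k f) x + A \<zeta> ((M ^^ k) f) x) holomorphic_on outside"
    by (intro holomorphic_intros Suc hol mem_Mk f)
  show ?case
    by (rule holomorphic_transform[OF hol']) (simp only: mem_Collect_eq eq)
qed

lemma d_nonconstant:
  assumes "\<zeta>0 \<in> outside" "d (\<zeta>0 ^ n) = 0"
  shows "\<not> (\<lambda>\<zeta>. d (\<zeta> ^ n)) constant_on outside"
proof
  assume "(\<lambda>\<zeta>. d (\<zeta> ^ n)) constant_on outside"
  then obtain c where c: "\<And>\<zeta>. \<zeta> \<in> outside \<Longrightarrow> d (\<zeta> ^ n) = c"
    by (auto simp: constant_on_def)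
  \<comment> \<open>R > 1 gives R \<le> R^n, so R^n exceeds \<open>B\<close> as well: the bound in
    \<open>d_large\<close> is on w = \<zeta>^n, not on \<zeta>.\<close>
  define R where "R = max 1 (max B q) + 1"
  have R: "1 < R" "B < R" "q < R"
    by (auto simp: R_def)
  have "R ^ 1 \<le> R ^ n"
    using R n by (intro power_increasing) auto
  then have "B < norm ((of_real R :: complex) ^ n)"
    using R by (simp add: norm_power)
  then have "d (of_real R ^ n) \<noteq> 0"
    by (rule d_large)
  moreover have "(of_real R :: complex) \<in> outside"
    using R by simp
  ultimately show False
    using c assms by metis
qed

text \<open>The spectrum there consists of zeros of a nonconstant holomorphic function, and all of
  them lie in a compact annulus because \<open>d\<close> has no zeros far out.\<close>

lemma finite_spectrum_outside:
  assumes q': "q < q'"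
  shows "finite {\<zeta> \<in> spectrum_on X N M. q' \<le> norm \<zeta>}"
proof (cases "\<exists>\<zeta>0\<in>outside. d (\<zeta>0 ^ n) = 0")
  case False
  then have "{\<zeta> \<in> spectrum_on X N M. q' \<le> norm \<zeta>} = {}"
    using spectrum_imp_zero q' by force
  then show ?thesis
    by (simp only: finite.emptyI)
next
  case True
  define R where "R = max 1 B"
  define K where "K = cball (0::complex) R - ball 0 q'"
  have "compact K"
    unfolding K_def by (intro compact_diff) auto
  moreover have "K \<subseteq> outside"
    using q' by (auto simp: K_def)
  ultimately have "finite {\<zeta> \<in> K. d (\<zeta> ^ n) = 0}"
    using True d_nonconstant
    by (intro holomorphic_compact_finite_zeros[OF holomorphic_d open_outside connected_outside]) auto
  moreover have "{\<zeta> \<in> spectrum_on X N M. q' \<le> norm \<zeta>} \<subseteq> {\<zeta> \<in> K. d (\<zeta> ^ n) = 0}"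
  proof safe
    fix \<zeta> assume \<zeta>: "\<zeta> \<in> spectrum_on X N M" "q' \<le> norm \<zeta>"
    show d0: "d (\<zeta> ^ n) = 0"
      using spectrum_imp_zero \<zeta> q' by auto
    have "norm \<zeta> \<le> R"
    proof (rule ccontr)
      assume "\<not> norm \<zeta> \<le> R"
      then have R: "1 < norm \<zeta>" "B < norm \<zeta>"
        by (auto simp: R_def)
      have "norm \<zeta> ^ 1 \<le> norm \<zeta> ^ n"
        using R n by (intro power_increasing) auto
      then have "B < norm (\<zeta> ^ n)"
        using R by (simp add: norm_power)
      with d_large d0 show False
        by blast
    qed
    then show "\<zeta> \<in> K"
      using \<zeta> by (auto simp: K_def)
  qed
  ultimately show ?thesis
    using finite_subset by blast
qed

text \<open>The order of the zero is positive, hence written \<open>Suc k\<close>; this is the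
  exponent in which Cauchy's formula for the k-th derivative will be used.\<close>

lemma punctured_neighbourhood:
  assumes \<mu>: "\<mu> \<in> spectrum_on X N M" "q < norm \<mu>"
  obtains R g k where "0 < R" "ball \<mu> R \<subseteq> outside" "g holomorphic_on ball \<mu> R"
    "\<And>\<zeta>. \<zeta> \<in> ball \<mu> R \<Longrightarrow> d (\<zeta> ^ n) = (\<zeta> - \<mu>) ^ Suc k * g \<zeta>"
    "\<And>\<zeta>. \<zeta> \<in> ball \<mu> R \<Longrightarrow> g \<zeta> \<noteq> 0"
proof -
  have 0: "d (\<mu> ^ n) = 0"
    by (rule spectrum_imp_zero[OF \<mu>])
  obtain g R m where *: "0 < m" "0 < R" "ball \<mu> R \<subseteq> outside" "g holomorphic_on ball \<mu> R"
    "\<And>w. w \<in> ball \<mu> R \<Longrightarrow> d (w ^ n) = (w - \<mu>) ^ m * g w" "\<And>w. w \<in> ball \<mu> R \<Longrightarrow> g w \<noteq> 0"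
    by (rule holomorphic_factor_zero_nonconstant[OF holomorphic_d open_outside connected_outside _ 0
          d_nonconstant[OF _ 0]]) (use \<mu> in auto)
  then obtain k where "m = Suc k"
    using gr0_implies_Suc by blast
  with * that show ?thesis
    by blast
qed

end

section \<open>Openness of the resolvent set, in quantitative form\<close>

context function_banach_space
begin

text \<open>With w = 1/(\<zeta> - \<mu>) one has R (\<mu> - A) = (w - R)/w, so the resolvent at
  \<mu> is w (w - R)^{-1} R. The inverse of w - R is a Neumann series, since closeness of \<zeta>
  and \<mu> means C < norm w.\<close>

lemma resolvent_perturbation:
  assumes A: "bounded_op X N A" and R: "is_resolvent_at X N A \<zeta> R" and C: "0 < C"
    and R_le: "\<And>f. f \<in> X \<Longrightarrow> N (R f) \<le> C * N f"
    and close: "C * norm (\<zeta> - \<mu>) < 1" "\<zeta> \<noteq> \<mu>"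
  shows "\<mu> \<notin> spectrum_on X N A"
proof -
  define w where "w = 1 / (\<zeta> - \<mu>)"
  have w0: "w \<noteq> 0" "1 / w = \<zeta> - \<mu>"
    using close by (auto simp: w_def)
  have bR: "bounded_op X N R" and R_left: "\<And>f. f \<in> X \<Longrightarrow> R (cscale \<zeta> f - A f) = f"
    and R_right: "\<And>f. f \<in> X \<Longrightarrow> cscale \<zeta> (R f) - A (R f) = f"
    using R unfolding is_resolvent_at_def by blast+
  obtain H where fam: "inverse_family C R (\<lambda>_. 1) H"
    using neumann_inverse_family[OF bR C R_le] by blast
  have wC: "C < norm w"
    using close C by (simp add: w_def norm_divide field_simps)
  define K where "K = H w"
  have one: "cscale 1 f = f" for f :: "'a \<Rightarrow> complex"
    by (simp add: fun_eq_iff)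
  have bK: "bounded_op X N K" and K_right: "\<And>f. f \<in> X \<Longrightarrow> cscale w (K f) - R (K f) = f"
    and K_left: "\<And>f. f \<in> X \<Longrightarrow> K (cscale w f - R f) = f"
    unfolding K_def using inverse_familyD(3,4,5)[OF fam wC] by (simp_all only: one)
  note mK = bounded_op_mem[OF bK] and mR = bounded_op_mem[OF bR] and mA = bounded_op_mem[OF A]
  have comm: "K (R f) = R (K f)" if f: "f \<in> X" for f
  proof -
    define g where "g = K f"
    have g: "g \<in> X" unfolding g_def by (rule mK[OF f])
    have "R f = R (cscale w g - R g)"
      by (simp only: g_def K_right[OF f])
    also have "\<dots> = cscale w (R g) - R (R g)"
      by (simp only: bounded_op_minus[OF bR scale_mem[OF g] mR[OF g]] bounded_op_scale[OF bR g])
    finally have "K (R f) = K (cscale w (R g) - R (R g))"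
      by (rule arg_cong)
    also have "\<dots> = R g"
      by (rule K_left[OF mR[OF g]])
    finally show ?thesis by (simp only: g_def)
  qed
  have "is_resolvent_at X N A \<mu> (\<lambda>f. cscale w (K (R f)))"
    unfolding is_resolvent_at_def
  proof (intro conjI ballI)
    show "bounded_op X N (\<lambda>f. cscale w (K (R f)))"
      by (rule bounded_op_cscale[OF bounded_op_comp[OF bK bR]])
    fix f assume f: "f \<in> X"
    have shift: "cscale \<mu> g - A g = (cscale \<zeta> g - A g) - cscale (1 / w) g" for g
      unfolding w0(2) by (auto simp: fun_eq_iff algebra_simps)
    have "R (cscale \<mu> f - A f) = R (cscale \<zeta> f - A f) - R (cscale (1 / w) f)"
      unfolding shift by (rule bounded_op_minus[OF bR minus_mem[OF scale_mem[OF f] mA[OF f]] scale_mem[OF f]])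
    then have "R (cscale \<mu> f - A f) = f - cscale (1 / w) (R f)"
      by (simp only: R_left[OF f] bounded_op_scale[OF bR f])
    moreover have "f - cscale (1 / w) (R f) = cscale (1 / w) (cscale w f - R f)"
      using w0(1) by (auto simp: fun_eq_iff field_simps)
    ultimately have "K (R (cscale \<mu> f - A f)) = cscale (1 / w) f"
      by (simp only: bounded_op_scale[OF bK minus_mem[OF scale_mem[OF f] mR[OF f]]] K_left[OF f])
    then show "cscale w (K (R (cscale \<mu> f - A f))) = f"
      using w0(1) by (simp only:) (simp add: fun_eq_iff)
    define g where "g = R (K f)"
    have g: "g \<in> X" unfolding g_def by (intro mR mK f)
    have 1: "A (cscale w g) = cscale w (A g)"
      by (rule bounded_op_scale[OF A g])
    have 2: "cscale \<zeta> g - A g = K f"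
      unfolding g_def by (rule R_right[OF mK[OF f]])
    have 3: "cscale w (K f) - g = f"
      unfolding g_def by (rule K_right[OF f])
    have "cscale \<mu> (cscale w g) - A (cscale w g) = f"
    proof
      fix x
      have "\<mu> * g x - A g x = K f x - 1 / w * g x"
        using fun_cong[OF shift[of g], of x] by (simp only: 2 minus_apply cscale_apply)
      then have "w * (\<mu> * g x - A g x) = w * K f x - g x"
        using w0(1) by (simp add: right_diff_distrib)
      also have "\<dots> = f x"
        using fun_cong[OF 3, of x] by (simp only: minus_apply cscale_apply)
      finally show "(cscale \<mu> (cscale w g) - A (cscale w g)) x = f x"
        by (simp only: 1 minus_apply cscale_apply) (simp add: algebra_simps)
    qed
    then show "cscale \<mu> (cscale w (K (R f))) - A (cscale w (K (R f))) = f"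
      by (simp only: comm[OF f] g_def)
  qed
  then show ?thesis
    unfolding spectrum_on_def by blast
qed

end

section \<open>Eigenvectors as limits of approximate eigenvectors\<close>

context power_inverse_family
begin

text \<open>Apply the inverse of \<zeta>^n - E to (\<zeta>^n - E) f = (\<zeta>^n - M^n) f + \<Sum>
  f(p j) u j. Thus \<open>f\<close> is determined by its residual and by its values at finitely many
  points.\<close>

lemma H0_decomposition:
  assumes \<zeta>: "q < norm \<zeta>" and f: "f \<in> X"
  shows "f = H0 (\<zeta> ^ n) (cscale (\<zeta> ^ n) f - (M ^^ n) f) + (\<Sum>j\<in>J. cscale (f (p j)) (H0 (\<zeta> ^ n) (u j)))"
proof -
  define r where "r = cscale (\<zeta> ^ n) f - (M ^^ n) f"
  have r: "r \<in> X"
    unfolding r_def by (intro minus_mem scale_mem mem_Mk f)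
  have s: "(\<Sum>j\<in>J. cscale (f (p j)) (u j)) \<in> X"
    by (intro sum_mem scale_mem u)
  have "cscale (\<zeta> ^ n) f - E f = r + (\<Sum>j\<in>J. cscale (f (p j)) (u j))"
    unfolding r_def M_pow[OF f] by (auto simp: fun_eq_iff algebra_simps)
  then have "cscale 1 f = H0 (\<zeta> ^ n) (r + (\<Sum>j\<in>J. cscale (f (p j)) (u j)))"
    using inverse_familyD(5)[OF fam0 pow_gt[OF \<zeta>] f] by (simp only:)
  also have "\<dots> = H0 (\<zeta> ^ n) r + H0 (\<zeta> ^ n) (\<Sum>j\<in>J. cscale (f (p j)) (u j))"
    by (rule bounded_op_add[OF bop_H0[OF \<zeta>] r s])
  also have "H0 (\<zeta> ^ n) (\<Sum>j\<in>J. cscale (f (p j)) (u j)) = (\<Sum>j\<in>J. H0 (\<zeta> ^ n) (cscale (f (p j)) (u j)))"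
    by (rule bounded_op_sum[OF bop_H0[OF \<zeta>]]) (intro scale_mem u)
  also have "\<dots> = (\<Sum>j\<in>J. cscale (f (p j)) (H0 (\<zeta> ^ n) (u j)))"
    by (intro sum.cong refl bounded_op_scale[OF bop_H0[OF \<zeta>]] u)
  finally have "cscale 1 f = H0 (\<zeta> ^ n) r + (\<Sum>j\<in>J. cscale (f (p j)) (H0 (\<zeta> ^ n) (u j)))" .
  then show ?thesis
    unfolding cfun.scale_one r_def .
qed

text \<open>In the decomposition of \<open>F k\<close> the residual part tends to 0 in norm and the
  coefficients \<open>F k (p j)\<close> converge, so convergence at finitely many points upgrades to
  convergence in \<open>N\<close>, with the explicit limit \<Sum> l j h j.\<close>

lemma approximate_eigenvector_limit:
  assumes \<mu>: "q < norm \<mu>" and F: "\<And>k. F k \<in> X"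
    and approx: "(\<lambda>k. N (cscale \<mu> (F k) - M (F k))) \<longlonglongrightarrow> 0"
    and l: "\<And>j. j \<in> J \<Longrightarrow> (\<lambda>k. F k (p j)) \<longlonglongrightarrow> l j"
  shows "\<exists>g\<in>X. (\<lambda>k. N (F k - g)) \<longlonglongrightarrow> 0 \<and> M g = cscale \<mu> g"
proof -
  define h where "h j = H0 (\<mu> ^ n) (u j)" for j
  have h: "h j \<in> X" if "j \<in> J" for j
    unfolding h_def by (rule mem_H0[OF \<mu> u[OF that]])
  define r where "r k = power_sum M \<mu> n (cscale \<mu> (F k) - M (F k))" for k
  have r: "r k \<in> X" for k
    unfolding r_def by (intro mem_S minus_mem scale_mem mem_M F)
  obtain S where S: "\<And>f. f \<in> X \<Longrightarrow> N (power_sum M \<mu> n f) \<le> S * N f"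
    using bounded_op_bound[OF bop_S] by blast
  obtain T where T: "0 \<le> T" "\<And>f. f \<in> X \<Longrightarrow> N (H0 (\<mu> ^ n) f) \<le> T * N f"
    using bounded_op_bound[OF bop_H0[OF \<mu>]] by blast
  obtain C where C: "0 \<le> C" "\<And>f. f \<in> X \<Longrightarrow> N (M f) \<le> C * N f"
    using bounded_op_bound[OF M] by blast
  have F_eq: "F k = H0 (\<mu> ^ n) (r k) + (\<Sum>j\<in>J. cscale (F k (p j)) (h j))" for k
    using H0_decomposition[OF \<mu> F, of k] power_sum_right[OF M F, of \<mu> n k]
    unfolding r_def h_def by (simp only:)
  define g where "g = (\<Sum>j\<in>J. cscale (l j) (h j))"
  have g: "g \<in> X"
    unfolding g_def by (intro sum_mem scale_mem h)
  have sum_apply: "(\<Sum>j\<in>J. G j) x = (\<Sum>j\<in>J. G j x)" for G :: "'j \<Rightarrow> 'a \<Rightarrow> complex" and x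
    by (induction J rule: infinite_finite_induct) auto
  have le: "N (F k - g) \<le> T * (S * N (cscale \<mu> (F k) - M (F k))) + (\<Sum>j\<in>J. norm (F k (p j) - l j) * N (h j))"
    for k
  proof -
    have "F k - g = H0 (\<mu> ^ n) (r k) + (\<Sum>j\<in>J. cscale (F k (p j) - l j) (h j))"
      by (subst F_eq) (simp add: g_def fun_eq_iff sum_apply algebra_simps sum_subtractf)
    then have "N (F k - g) = N (H0 (\<mu> ^ n) (r k) + (\<Sum>j\<in>J. cscale (F k (p j) - l j) (h j)))"
      by (rule arg_cong)
    also have "\<dots> \<le> N (H0 (\<mu> ^ n) (r k)) + N (\<Sum>j\<in>J. cscale (F k (p j) - l j) (h j))"
      by (intro N_add mem_H0 \<mu> r sum_mem scale_mem h)
    finally have 1: "N (F k - g) \<le> N (H0 (\<mu> ^ n) (r k)) + N (\<Sum>j\<in>J. cscale (F k (p j) - l j) (h j))" .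
    have 2: "N (H0 (\<mu> ^ n) (r k)) \<le> T * (S * N (cscale \<mu> (F k) - M (F k)))"
      using mult_left_mono[OF S[OF minus_mem[OF scale_mem[OF F] mem_M[OF F]]] T(1)] T(2)[OF r]
      unfolding r_def by (rule order_trans[rotated])
    have "N (\<Sum>j\<in>J. cscale (F k (p j) - l j) (h j)) \<le> (\<Sum>j\<in>J. N (cscale (F k (p j) - l j) (h j)))"
      by (intro N_sum scale_mem h)
    also have "\<dots> = (\<Sum>j\<in>J. norm (F k (p j) - l j) * N (h j))"
      by (intro sum.cong refl N_scale h)
    finally have 3: "N (\<Sum>j\<in>J. cscale (F k (p j) - l j) (h j)) \<le> (\<Sum>j\<in>J. norm (F k (p j) - l j) * N (h j))" .
    show ?thesis
      by (rule order_trans[OF 1 add_mono[OF 2 3]])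
  qed
  have lim0: "(\<lambda>k. T * (S * N (cscale \<mu> (F k) - M (F k))) + (\<Sum>j\<in>J. norm (F k (p j) - l j) * N (h j)))
      \<longlonglongrightarrow> T * (S * 0) + (\<Sum>j\<in>J. norm (l j - l j) * N (h j))"
    by (intro tendsto_intros approx l)
  have lim: "(\<lambda>k. N (F k - g)) \<longlonglongrightarrow> 0"
  proof (rule tendsto_sandwich[OF _ _ tendsto_const])
    show "\<forall>\<^sub>F k in sequentially. 0 \<le> N (F k - g)"
      by (intro always_eventually allI N_nonneg minus_mem F g)
    show "\<forall>\<^sub>F k in sequentially. N (F k - g) \<le> T * (S * N (cscale \<mu> (F k) - M (F k))) + (\<Sum>j\<in>J. norm (F k (p j) - l j) * N (h j))"
      using le by (intro always_eventually allI)
  qed (use lim0 in simp)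
  have "N (cscale \<mu> g - M g) \<le> (norm \<mu> + C) * N (F k - g) + N (cscale \<mu> (F k) - M (F k))" for k
  proof -
    define f where "f = F k - g"
    have f: "f \<in> X" unfolding f_def by (intro minus_mem F g)
    have "M f = M (F k) - M g"
      unfolding f_def by (rule bounded_op_minus[OF M F g])
    then have eq: "cscale \<mu> g - M g = (cscale \<mu> (F k) - M (F k)) - (cscale \<mu> f - M f)"
      by (auto simp: f_def fun_eq_iff algebra_simps)
    have 1: "N (cscale \<mu> g - M g) \<le> N (cscale \<mu> (F k) - M (F k)) + N (cscale \<mu> f - M f)"
      unfolding eq by (intro N_minus minus_mem scale_mem mem_M F f)
    have 2: "N (cscale \<mu> f - M f) \<le> N (cscale \<mu> f) + N (M f)"
      by (intro N_minus scale_mem mem_M f)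
    have 3: "N (cscale \<mu> f) + N (M f) \<le> (norm \<mu> + C) * N f"
      using C(2)[OF f] N_scale[OF f, of \<mu>] by (simp only: distrib_right add_mono order_refl)
    show ?thesis
      using 1 2 3 unfolding f_def by linarith
  qed
  moreover have "(\<lambda>k. (norm \<mu> + C) * N (F k - g) + N (cscale \<mu> (F k) - M (F k))) \<longlonglongrightarrow> (norm \<mu> + C) * 0 + 0"
    by (intro tendsto_intros lim approx)
  ultimately have "N (cscale \<mu> g - M g) \<le> (norm \<mu> + C) * 0 + 0"
    by (intro LIMSEQ_le_const) auto
  then have "cscale \<mu> g - M g = 0"
    using N_eq_0_imp[OF minus_mem[OF scale_mem[OF g] mem_M[OF g]]] by simp
  then have "M g = cscale \<mu> g"
    by (auto simp: fun_eq_iff)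
  with g lim show ?thesis by blast
qed

text \<open>
  Close to a spectral point the resolvents are unbounded, which yields approximate eigenvectors.
  The finite-rank part of the splitting makes a subsequence of them converge.
\<close>

lemma spectrum_imp_eigenvalue:
  assumes \<mu>: "\<mu> \<in> spectrum_on X N M" "q < norm \<mu>"
  shows "eigenvalue_on X M \<mu>"
proof -
  obtain R g m where R: "0 < R" "ball \<mu> R \<subseteq> outside"
    and d: "\<And>\<zeta>. \<zeta> \<in> ball \<mu> R \<Longrightarrow> d (\<zeta> ^ n) = (\<zeta> - \<mu>) ^ Suc m * g \<zeta>"
    and g: "\<And>\<zeta>. \<zeta> \<in> ball \<mu> R \<Longrightarrow> g \<zeta> \<noteq> 0"
    by (rule punctured_neighbourhood[OF \<mu>]) blast
  define t where "t k = R / real (k + 2)" for k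
  define \<zeta> where "\<zeta> k = \<mu> + of_real (t k)" for k
  have t: "0 < t k" "t k < R" for k
    using R mult_pos_pos[OF R(1), of "1 + real k"] by (auto simp: t_def field_simps)
  have \<zeta>: "\<zeta> k \<in> ball \<mu> R" "\<zeta> k \<noteq> \<mu>" "norm (\<zeta> k - \<mu>) = t k" for k
    using t[of k] by (auto simp: \<zeta>_def dist_norm)
  have t0: "t \<longlonglongrightarrow> 0"
    unfolding t_def by real_asymp
  have "\<exists>f\<in>X. N f = 1 \<and> N (cscale \<mu> f - M f) \<le> 3 * t k" for k
  proof -
    have out: "q < norm (\<zeta> k)"
      using R \<zeta>[of k] by auto
    have d0: "d (\<zeta> k ^ n) \<noteq> 0"
      using d[OF \<zeta>(1)] g[OF \<zeta>(1)] \<zeta>(2) by simp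
    note Res = is_resolvent_res[OF out d0]
    have bR: "bounded_op X N (res (\<zeta> k))" and right: "\<And>f. f \<in> X \<Longrightarrow> cscale (\<zeta> k) (res (\<zeta> k) f) - M (res (\<zeta> k) f) = f"
      using Res unfolding is_resolvent_at_def by blast+
    \<comment> \<open>Otherwise the resolvent at \<open>\<zeta> k\<close> would be bounded by 1/(2 t
      k); as \<open>\<zeta> k\<close> is at distance t k from \<mu>, the product is 1/2 < 1 and
      \<mu> would leave the spectrum.\<close>
    have "\<exists>f\<in>X. N f < 2 * t k * N (res (\<zeta> k) f)"
    proof (rule ccontr)
      assume "\<not> ?thesis"
      then have "N (res (\<zeta> k) f) \<le> 1 / (2 * t k) * N f" if "f \<in> X" for f
        using that t(1)[of k] by (auto simp: field_simps not_less)
      then have "\<mu> \<notin> spectrum_on X N M"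
        using t(1)[of k] \<zeta>[of k]
        by (intro resolvent_perturbation[OF M Res, of "1 / (2 * t k)"]) auto
      with \<mu> show False by blast
    qed
    then obtain f where f: "f \<in> X" "N f < 2 * t k * N (res (\<zeta> k) f)" by blast
    define v where "v = res (\<zeta> k) f"
    have v: "v \<in> X" unfolding v_def by (rule bounded_op_mem[OF bR f(1)])
    have "0 < 2 * t k * N v"
      using f N_nonneg[OF f(1)] by (simp add: v_def)
    then have Nv: "0 < N v"
      using t(1)[of k] by (simp add: zero_less_mult_iff)
    define c where "c = complex_of_real (1 / N v)"
    have c: "norm c = 1 / N v"
      using Nv by (simp add: c_def norm_divide)
    have "N (cscale c v) = 1"
      using Nv by (simp add: N_scale[OF v] c)
    \<comment> \<open>Two of the three t k bound the normalised right-hand side \<open>f\<close>;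
      the third is the cost of replacing \<open>\<zeta> k\<close> by \<mu>.\<close>
    moreover have "N (cscale \<mu> (cscale c v) - M (cscale c v)) \<le> 3 * t k"
    proof -
      have eq: "cscale (\<zeta> k) v - M v = f"
        unfolding v_def by (rule right[OF f(1)])
      have "cscale \<mu> (cscale c v) - M (cscale c v) = cscale c f - cscale (c * of_real (t k)) v"
        unfolding bounded_op_scale[OF M v] \<zeta>_def eq[symmetric] by (auto simp: fun_eq_iff algebra_simps)
      then have "N (cscale \<mu> (cscale c v) - M (cscale c v)) = N (cscale c f - cscale (c * of_real (t k)) v)"
        by (rule arg_cong)
      also have "\<dots> \<le> N (cscale c f) + N (cscale (c * of_real (t k)) v)"
        by (intro N_minus scale_mem f v)
      finally have 1: "N (cscale \<mu> (cscale c v) - M (cscale c v)) \<le>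
          N (cscale c f) + N (cscale (c * of_real (t k)) v)" .
      have 2: "N (cscale c f) = N f / N v"
        unfolding N_scale[OF f(1)] c by simp
      have 3: "N (cscale (c * of_real (t k)) v) = t k"
        using Nv t(1)[of k] unfolding N_scale[OF v] by (simp add: c norm_mult)
      have 4: "N f / N v \<le> 2 * t k"
        using f(2) Nv by (simp add: v_def[symmetric] field_simps)
      show ?thesis
        using 1 2 3 4 by linarith
    qed
    ultimately show ?thesis
      using scale_mem[OF v] by blast
  qed
  then obtain F where F: "\<And>k. F k \<in> X" "\<And>k. N (F k) = 1" "\<And>k. N (cscale \<mu> (F k) - M (F k)) \<le> 3 * t k"
    by metis
  have "norm (F k (p j)) \<le> 1" for k j
    using eval_le[OF F(1)] F(2) by metis
  then obtain s l where s: "strict_mono (s :: nat \<Rightarrow> nat)" and l: "\<forall>j\<in>J. (\<lambda>k. F (s k) (p j)) \<longlonglongrightarrow> l j"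
    using finite_family_convergent_subsequence[OF J, of "\<lambda>k j. F k (p j)" 1] by blast
  have approx: "(\<lambda>k. N (cscale \<mu> (F (s k)) - M (F (s k)))) \<longlonglongrightarrow> 0"
  proof (rule tendsto_sandwich[OF _ _ tendsto_const])
    show "\<forall>\<^sub>F k in sequentially. 0 \<le> N (cscale \<mu> (F (s k)) - M (F (s k)))"
      by (intro always_eventually allI N_nonneg minus_mem scale_mem mem_M F)
    show "\<forall>\<^sub>F k in sequentially. N (cscale \<mu> (F (s k)) - M (F (s k))) \<le> 3 * t (s k)"
      using F(3) by (intro always_eventually allI)
    show "(\<lambda>k. 3 * t (s k)) \<longlonglongrightarrow> 0"
      using tendsto_mult_right_zero[OF LIMSEQ_subseq_LIMSEQ[OF t0 s], of 3] by (simp add: o_def)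
  qed
  obtain v where v: "v \<in> X" "(\<lambda>k. N (F (s k) - v)) \<longlonglongrightarrow> 0" "M v = cscale \<mu> v"
    using approximate_eigenvector_limit[OF \<mu>(2), of "\<lambda>k. F (s k)" l] F(1) approx l by blast
  have "v \<noteq> 0"
  proof
    assume "v = 0"
    then have "(\<lambda>k. N (F (s k))) \<longlonglongrightarrow> 0"
      using v(2) by simp
    then have "(\<lambda>k. 1 :: real) \<longlonglongrightarrow> 0"
      by (simp only: F(2))
    from LIMSEQ_unique[OF tendsto_const this] show False
      by simp
  qed
  with v show ?thesis
    unfolding eigenvalue_on_def by blast
qed

end

lemma sum_fun_apply: "(\<Sum>j\<in>J. G j) x = (\<Sum>j\<in>J. G j x)" for G :: "'j \<Rightarrow> 'a \<Rightarrow> complex"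
  by (induction J rule: infinite_finite_induct) auto

section \<open>Poles of the resolvent and the Riesz projection\<close>

context power_inverse_family
begin

text \<open>All functions of \<zeta> built from \<open>H0\<close> extend holomorphically across a
  spectral point, so the singularity of the resolvent sits in the finitely many scalars
  \<open>res \<zeta> f (p j)\<close>. This is the source of the finite rank.\<close>

lemma res_decomposition:
  assumes \<zeta>: "q < norm \<zeta>" and d: "d (\<zeta> ^ n) \<noteq> 0" and f: "f \<in> X"
  shows "res \<zeta> f x = H0 (\<zeta> ^ n) (power_sum M \<zeta> n f) x +
     (\<Sum>j\<in>J. res \<zeta> f (p j) * H0 (\<zeta> ^ n) (u j) x)"
proof -
  define g where "g = res \<zeta> f"
  have bR: "bounded_op X N (res \<zeta>)" and right: "cscale \<zeta> (res \<zeta> f) - M (res \<zeta> f) = f"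
    using is_resolvent_res[OF \<zeta> d] f unfolding is_resolvent_at_def by blast+
  have g: "g \<in> X"
    unfolding g_def by (rule bounded_op_mem[OF bR f])
  have "cscale (\<zeta> ^ n) g - (M ^^ n) g = power_sum M \<zeta> n f"
    using power_sum_right[OF M g, of \<zeta> n] right by (simp only: g_def)
  then have "g = H0 (\<zeta> ^ n) (power_sum M \<zeta> n f) + (\<Sum>j\<in>J. cscale (g (p j)) (H0 (\<zeta> ^ n) (u j)))"
    using H0_decomposition[OF \<zeta> g] by (simp only:)
  then have "g x = (H0 (\<zeta> ^ n) (power_sum M \<zeta> n f) + (\<Sum>j\<in>J. cscale (g (p j)) (H0 (\<zeta> ^ n) (u j)))) x"
    by (rule fun_cong)
  then show ?thesis
    by (simp only: g_def plus_fun_apply sum_fun_apply cscale_apply)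
qed

text \<open>The denominator \<open>d\<close> is common to all functions and all points, so the
  exponent is uniform. By \<open>res_decomposition\<close>, Cauchy's formula for derivatives and the
  Leibniz rule, the contour integral is a combination of the derivatives at \<mu>, of order at most
  k, of the functions \<open>H0 (\<zeta> ^ n) (u j)\<close>. These derivatives form
  \<open>A\<close>.\<close>

lemma riesz_structure:
  assumes \<mu>: "\<mu> \<in> spectrum_on X N M" "q < norm \<mu>"
  obtains R k A where "0 < R"
    "\<And>\<zeta>. \<zeta> \<in> ball \<mu> R - {\<mu>} \<Longrightarrow> \<zeta> \<notin> spectrum_on X N M"
    "\<And>f x. f \<in> X \<Longrightarrow> \<exists>Y. Y holomorphic_on ball \<mu> R \<and>
       (\<forall>\<zeta> \<in> ball \<mu> R - {\<mu>}. resolvent_on X N M \<zeta> f x = Y \<zeta> / (\<zeta> - \<mu>) ^ Suc k)"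
    "finite A" "\<And>f r. f \<in> X \<Longrightarrow> 0 < r \<Longrightarrow> r < R \<Longrightarrow> riesz_projection X N M \<mu> r f \<in> cfun.span A"
proof -
  obtain R g k where R: "0 < R" "ball \<mu> R \<subseteq> outside" and g: "g holomorphic_on ball \<mu> R"
    and d: "\<And>\<zeta>. \<zeta> \<in> ball \<mu> R \<Longrightarrow> d (\<zeta> ^ n) = (\<zeta> - \<mu>) ^ Suc k * g \<zeta>"
    and g0: "\<And>\<zeta>. \<zeta> \<in> ball \<mu> R \<Longrightarrow> g \<zeta> \<noteq> 0"
    by (rule punctured_neighbourhood[OF \<mu>]) blast
  have out: "q < norm \<zeta>" if "\<zeta> \<in> ball \<mu> R" for \<zeta>
    using R that by blast
  have d0: "d (\<zeta> ^ n) \<noteq> 0" if "\<zeta> \<in> ball \<mu> R - {\<mu>}" for \<zeta>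
    using d[of \<zeta>] g0[of \<zeta>] that by simp
  have res: "is_resolvent_at X N M \<zeta> (res \<zeta>)" if "\<zeta> \<in> ball \<mu> R - {\<mu>}" for \<zeta>
    using that by (intro is_resolvent_res out d0) auto
  have resolvent_eq: "resolvent_on X N M \<zeta> f = res \<zeta> f" if "\<zeta> \<in> ball \<mu> R - {\<mu>}" "f \<in> X" for \<zeta> f
    by (rule resolvent_on_eq[OF res[OF that(1)] that(2)])
  define Y where "Y f x \<zeta> = H (\<zeta> ^ n) (power_sum M \<zeta> n f) x / g \<zeta>" for f x \<zeta>
  have Y_hol: "Y f x holomorphic_on ball \<mu> R" if "f \<in> X" for f x
    unfolding Y_def[abs_def]
    by (rule holomorphic_on_divide[OF holomorphic_on_subset[OF
            holomorphic_power_sum[OF holomorphic_H bop_H that] R(2)] g g0])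
  have Y: "resolvent_on X N M \<zeta> f x = Y f x \<zeta> / (\<zeta> - \<mu>) ^ Suc k"
    if "\<zeta> \<in> ball \<mu> R - {\<mu>}" "f \<in> X" for \<zeta> f x
    unfolding resolvent_eq[OF that] res_def Y_def using that d[of \<zeta>] by simp
  define a where "a j x \<zeta> = H0 (\<zeta> ^ n) (u j) x" for j x \<zeta>
  have a_hol: "a j x holomorphic_on ball \<mu> R" if "j \<in> J" for j x
    unfolding a_def[abs_def] by (rule holomorphic_on_subset[OF holomorphic_H0[OF u[OF that]] R(2)])
  define b where "b f x \<zeta> = H0 (\<zeta> ^ n) (power_sum M \<zeta> n f) x" for f x \<zeta>
  have b_hol: "b f x holomorphic_on ball \<mu> R" if "f \<in> X" for f x
    unfolding b_def[abs_def]
    by (rule holomorphic_on_subset[OF holomorphic_power_sum[OF holomorphic_H0 bop_H0 that] R(2)])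
  define D where "D l j x = (deriv ^^ l) (a j x) \<mu>" for l j x
  define A where "A = (\<lambda>(l, j). D l j) ` ({..k} \<times> J)"
  show ?thesis
  proof (rule that)
    show "0 < R" by (rule R)
    show "\<zeta> \<notin> spectrum_on X N M" if "\<zeta> \<in> ball \<mu> R - {\<mu>}" for \<zeta>
      using res[OF that] unfolding spectrum_on_def by blast
    show "\<exists>Y. Y holomorphic_on ball \<mu> R \<and>
       (\<forall>\<zeta> \<in> ball \<mu> R - {\<mu>}. resolvent_on X N M \<zeta> f x = Y \<zeta> / (\<zeta> - \<mu>) ^ Suc k)" if "f \<in> X" for f x
      using Y_hol[OF that] Y[OF _ that] by blast
    show "finite A"
      unfolding A_def using J by auto
    fix f r assume f: "f \<in> X" and r: "0 < r" "r < R"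
    define C where "C i j = of_nat (k choose i) * (deriv ^^ i) (Y f (p j)) \<mu> / fact k" for i j
    have sub: "cball \<mu> r \<subseteq> ball \<mu> R"
      using r by auto
    have mu: "\<mu> \<in> ball \<mu> R" "\<mu> \<in> ball \<mu> r"
      using r by auto
    have int_j: "((\<lambda>\<zeta>. Y f (p j) \<zeta> * a j x \<zeta> / (\<zeta> - \<mu>) ^ Suc k) has_contour_integral
        2 * of_real pi * \<i> * (\<Sum>i\<in>{0..k}. C i j * D (k - i) j x)) (circlepath \<mu> r)" if "j \<in> J" for j x
    proof -
      have hol: "(\<lambda>\<zeta>. Y f (p j) \<zeta> * a j x \<zeta>) holomorphic_on ball \<mu> R"
        by (rule holomorphic_on_mult[OF Y_hol[OF f] a_hol[OF that]])
      have "((\<lambda>\<zeta>. Y f (p j) \<zeta> * a j x \<zeta> / (\<zeta> - \<mu>) ^ Suc k) has_contour_integral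
          (2 * pi * \<i>) / fact k * (deriv ^^ k) (\<lambda>\<zeta>. Y f (p j) \<zeta> * a j x \<zeta>) \<mu>) (circlepath \<mu> r)"
        by (rule Cauchy_has_contour_integral_higher_derivative_circlepath)
          (use mu sub in \<open>auto intro!: holomorphic_on_imp_continuous_on holomorphic_on_subset[OF hol]\<close>)
      also have "(deriv ^^ k) (\<lambda>\<zeta>. Y f (p j) \<zeta> * a j x \<zeta>) \<mu> =
          (\<Sum>i = 0..k. of_nat (k choose i) * (deriv ^^ i) (Y f (p j)) \<mu> * (deriv ^^ (k - i)) (a j x) \<mu>)"
        by (rule higher_deriv_mult[OF Y_hol[OF f] a_hol[OF that] open_ball mu(1)])
      also have "(2 * pi * \<i>) / fact k * \<dots> = 2 * of_real pi * \<i> * (\<Sum>i\<in>{0..k}. C i j * D (k - i) j x)"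
        by (simp add: C_def D_def sum_distrib_left mult_ac)
      finally show ?thesis .
    qed
    have int_b: "(b f x has_contour_integral 0) (circlepath \<mu> r)" for x
      by (rule Cauchy_theorem_disc_simple[OF b_hol[OF f]]) (use r sub sphere_cball in auto)
    have "((\<lambda>\<zeta>. b f x \<zeta> + (\<Sum>j\<in>J. Y f (p j) \<zeta> * a j x \<zeta> / (\<zeta> - \<mu>) ^ Suc k)) has_contour_integral
        0 + (\<Sum>j\<in>J. 2 * of_real pi * \<i> * (\<Sum>i\<in>{0..k}. C i j * D (k - i) j x))) (circlepath \<mu> r)" for x
      by (intro has_contour_integral_add has_contour_integral_sum J int_b int_j)
    moreover have "b f x \<zeta> + (\<Sum>j\<in>J. Y f (p j) \<zeta> * a j x \<zeta> / (\<zeta> - \<mu>) ^ Suc k) = resolvent_on X N M \<zeta> f x"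
      if "\<zeta> \<in> path_image (circlepath \<mu> r)" for \<zeta> x
    proof -
      have \<zeta>: "\<zeta> \<in> ball \<mu> R - {\<mu>}"
        using that r by auto
      have "resolvent_on X N M \<zeta> f x = b f x \<zeta> + (\<Sum>j\<in>J. resolvent_on X N M \<zeta> f (p j) * a j x \<zeta>)"
        unfolding resolvent_eq[OF \<zeta> f] a_def b_def
        by (rule res_decomposition[OF _ d0[OF \<zeta>] f]) (use out \<zeta> in blast)
      then show ?thesis
        by (simp add: Y[OF \<zeta> f])
    qed
    ultimately have "((\<lambda>\<zeta>. resolvent_on X N M \<zeta> f x) has_contour_integral
        0 + (\<Sum>j\<in>J. 2 * of_real pi * \<i> * (\<Sum>i\<in>{0..k}. C i j * D (k - i) j x))) (circlepath \<mu> r)" for x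
      by (rule has_contour_integral_eq)
    then have "contour_integral (circlepath \<mu> r) (\<lambda>\<zeta>. resolvent_on X N M \<zeta> f x) =
        (\<Sum>j\<in>J. 2 * of_real pi * \<i> * (\<Sum>i\<in>{0..k}. C i j * D (k - i) j x))" for x
      by (simp add: contour_integral_unique)
    then have "riesz_projection X N M \<mu> r f x = (\<Sum>j\<in>J. \<Sum>i\<in>{0..k}. C i j * D (k - i) j x)" for x
      unfolding riesz_projection_def sum_distrib_left[symmetric] by simp
    then have "riesz_projection X N M \<mu> r f = (\<Sum>j\<in>J. \<Sum>i\<in>{0..k}. cscale (C i j) (D (k - i) j))"
      by (intro ext) (simp only: sum_fun_apply cscale_apply)
    also have "\<dots> \<in> cfun.span A"
      by (intro cfun.span_sum cfun.span_scale cfun.span_base) (auto simp: A_def)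
    finally show "riesz_projection X N M \<mu> r f \<in> cfun.span A" .
  qed
qed

text \<open>Additivity of contour integrals needs integrability of each summand; the quotient form
  of the resolvent provides it through Cauchy's formula.\<close>

lemma riesz_projection_linear:
  assumes R: "\<And>\<zeta>. \<zeta> \<in> ball \<mu> R - {\<mu>} \<Longrightarrow> \<zeta> \<notin> spectrum_on X N M"
    and Y: "\<And>f x. f \<in> X \<Longrightarrow> \<exists>Y. Y holomorphic_on ball \<mu> R \<and>
       (\<forall>\<zeta> \<in> ball \<mu> R - {\<mu>}. resolvent_on X N M \<zeta> f x = Y \<zeta> / (\<zeta> - \<mu>) ^ Suc k)"
    and r: "0 < r" "r < R"
  shows "\<And>f g. f \<in> X \<Longrightarrow> g \<in> X \<Longrightarrow> riesz_projection X N M \<mu> r (f + g) =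
       riesz_projection X N M \<mu> r f + riesz_projection X N M \<mu> r g"
    and "\<And>c f. f \<in> X \<Longrightarrow> riesz_projection X N M \<mu> r (cscale c f) = cscale c (riesz_projection X N M \<mu> r f)"
proof -
  have sphere: "\<zeta> \<in> ball \<mu> R - {\<mu>}" if "\<zeta> \<in> path_image (circlepath \<mu> r)" for \<zeta>
    using that r by auto
  have bR: "bounded_op X N (resolvent_on X N M \<zeta>)" if "\<zeta> \<in> path_image (circlepath \<mu> r)" for \<zeta>
    using R[OF sphere[OF that]] is_resolvent_resolvent_on
    unfolding spectrum_on_def is_resolvent_at_def by blast
  have integrable: "(\<lambda>\<zeta>. resolvent_on X N M \<zeta> f x) contour_integrable_on circlepath \<mu> r" if "f \<in> X" for f x
  proof -
    obtain Z where Z: "Z holomorphic_on ball \<mu> R"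
      "\<And>\<zeta>. \<zeta> \<in> ball \<mu> R - {\<mu>} \<Longrightarrow> resolvent_on X N M \<zeta> f x = Z \<zeta> / (\<zeta> - \<mu>) ^ Suc k"
      using Y[OF \<open>f \<in> X\<close>, of x] by blast
    have "((\<lambda>\<zeta>. Z \<zeta> / (\<zeta> - \<mu>) ^ Suc k) has_contour_integral
        (2 * pi * \<i>) / fact k * (deriv ^^ k) Z \<mu>) (circlepath \<mu> r)"
      by (rule Cauchy_has_contour_integral_higher_derivative_circlepath)
        (use r in \<open>auto intro!: holomorphic_on_imp_continuous_on holomorphic_on_subset[OF Z(1)]\<close>)
    then have "((\<lambda>\<zeta>. resolvent_on X N M \<zeta> f x) has_contour_integral
        (2 * pi * \<i>) / fact k * (deriv ^^ k) Z \<mu>) (circlepath \<mu> r)"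
      by (rule has_contour_integral_eq) (use Z(2)[OF sphere] in simp)
    then show ?thesis
      by (rule has_contour_integral_integrable)
  qed
  show "riesz_projection X N M \<mu> r (f + g) = riesz_projection X N M \<mu> r f + riesz_projection X N M \<mu> r g"
    if "f \<in> X" "g \<in> X" for f g
  proof
    fix x
    have "contour_integral (circlepath \<mu> r) (\<lambda>\<zeta>. resolvent_on X N M \<zeta> (f + g) x) =
        contour_integral (circlepath \<mu> r) (\<lambda>\<zeta>. resolvent_on X N M \<zeta> f x + resolvent_on X N M \<zeta> g x)"
      by (rule contour_integral_cong) (simp_all only: bounded_op_add[OF bR that] plus_fun_apply)
    also have "\<dots> = contour_integral (circlepath \<mu> r) (\<lambda>\<zeta>. resolvent_on X N M \<zeta> f x) +
        contour_integral (circlepath \<mu> r) (\<lambda>\<zeta>. resolvent_on X N M \<zeta> g x)"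
      by (intro contour_integral_add integrable that)
    finally show "riesz_projection X N M \<mu> r (f + g) x =
        (riesz_projection X N M \<mu> r f + riesz_projection X N M \<mu> r g) x"
      unfolding riesz_projection_def plus_fun_apply by (simp only: add_divide_distrib)
  qed
  show "riesz_projection X N M \<mu> r (cscale c f) = cscale c (riesz_projection X N M \<mu> r f)"
    if "f \<in> X" for c f
  proof
    fix x
    have "contour_integral (circlepath \<mu> r) (\<lambda>\<zeta>. resolvent_on X N M \<zeta> (cscale c f) x) =
        contour_integral (circlepath \<mu> r) (\<lambda>\<zeta>. c * resolvent_on X N M \<zeta> f x)"
      by (rule contour_integral_cong) (simp_all only: bounded_op_scale[OF bR that] cscale_apply)
    also have "\<dots> = c * contour_integral (circlepath \<mu> r) (\<lambda>\<zeta>. resolvent_on X N M \<zeta> f x)"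
      by (intro contour_integral_lmul integrable that)
    finally show "riesz_projection X N M \<mu> r (cscale c f) x = cscale c (riesz_projection X N M \<mu> r f) x"
      unfolding riesz_projection_def cscale_apply by simp
  qed
qed

text \<open>By linearity the range of the projection is a subspace, and it lies in the span of a
  finite set; so a maximal independent subset of it is a finite basis, and its size is the
  multiplicity.\<close>

theorem spectrum_imp_isolated_eigenvalue:
  assumes \<mu>: "\<mu> \<in> spectrum_on X N M" "q < norm \<mu>"
  shows "\<exists>m. isolated_eigenvalue_mult X N M \<mu> m"
proof -
  obtain R k A where R: "0 < R"
    and spec: "\<And>\<zeta>. \<zeta> \<in> ball \<mu> R - {\<mu>} \<Longrightarrow> \<zeta> \<notin> spectrum_on X N M"
    and Y: "\<And>f x. f \<in> X \<Longrightarrow> \<exists>Y. Y holomorphic_on ball \<mu> R \<and>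
       (\<forall>\<zeta> \<in> ball \<mu> R - {\<mu>}. resolvent_on X N M \<zeta> f x = Y \<zeta> / (\<zeta> - \<mu>) ^ Suc k)"
    and A: "finite A" "\<And>f r. f \<in> X \<Longrightarrow> 0 < r \<Longrightarrow> r < R \<Longrightarrow> riesz_projection X N M \<mu> r f \<in> cfun.span A"
    by (rule riesz_structure[OF \<mu>]) blast
  define r where "r = R / 2"
  have r: "0 < r" "r < R"
    using R by (auto simp: r_def)
  define P where "P = riesz_projection X N M \<mu> r ` X"
  have P: "cfun.subspace P"
  proof (rule cfun.subspaceI)
    have "riesz_projection X N M \<mu> r (cscale 0 0) = cscale 0 (riesz_projection X N M \<mu> r 0)"
      by (rule riesz_projection_linear(2)[OF spec Y r zero_mem])
    then have "riesz_projection X N M \<mu> r 0 = 0"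
      by simp
    then show "0 \<in> P"
      unfolding P_def using zero_mem by (metis imageI)
    show "f + g \<in> P" if fg: "f \<in> P" "g \<in> P" for f g
    proof -
      obtain f' g' where fg': "f' \<in> X" "g' \<in> X"
        "f = riesz_projection X N M \<mu> r f'" "g = riesz_projection X N M \<mu> r g'"
        using fg unfolding P_def by blast
      have "riesz_projection X N M \<mu> r (f' + g') = f + g"
        unfolding fg'(3,4) by (rule riesz_projection_linear(1)[OF spec Y r fg'(1,2)])
      then show ?thesis
        unfolding P_def using add_mem[OF fg'(1,2)] by (metis imageI)
    qed
    show "cscale c f \<in> P" if f: "f \<in> P" for c f
    proof -
      obtain f' where f': "f' \<in> X" "f = riesz_projection X N M \<mu> r f'"
        using f unfolding P_def by blast
      have "riesz_projection X N M \<mu> r (cscale c f') = cscale c f"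
        unfolding f'(2) by (rule riesz_projection_linear(2)[OF spec Y r f'(1)])
      then show ?thesis
        unfolding P_def using scale_mem[OF f'(1)] by (metis imageI)
    qed
  qed
  obtain B where B: "B \<subseteq> P" "cfun.independent B" "P \<subseteq> cfun.span B"
    using cfun.maximal_independent_subset[of P] by blast
  have "B \<subseteq> cfun.span A"
    using B(1) A(2) r unfolding P_def by blast
  then have "finite B"
    using cfun.independent_span_bound[OF A(1) B(2)] by blast
  moreover have "cfun.span B = P"
    using B cfun.span_minimal[OF B(1) P] by blast
  moreover have "cball \<mu> r \<inter> spectrum_on X N M = {\<mu>}"
  proof -
    have "\<mu> \<in> cball \<mu> r" using r by simp
    moreover have "\<zeta> = \<mu>" if "\<zeta> \<in> cball \<mu> r" "\<zeta> \<in> spectrum_on X N M" for \<zeta>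
      using spec[of \<zeta>] that r by force
    ultimately show ?thesis using \<mu>(1) by blast
  qed
  ultimately show ?thesis
    unfolding isolated_eigenvalue_mult_def P_def
    using spectrum_imp_eigenvalue[OF \<mu>] r(1) B(2) by blast
qed

end

section \<open>Growth of powers, resolvent bounds and simple poles\<close>

context function_banach_space
begin

text \<open>From \<open>power_sum\<close> one has \<zeta>^m g = power_sum f + A^m g. Estimating the
  first term by a geometric sum and the second by C \<rho>^m N g, then dividing by norm \<zeta>^m
  and letting m tend to infinity, gives the bound. It concerns any solution \<open>g\<close>, so
  existence of the resolvent is not presupposed.\<close>

lemma resolvent_power_bound:
  assumes A: "bounded_op X N A" and \<rho>: "0 < \<rho>" and A_pow: "\<And>k f. f \<in> X \<Longrightarrow> N ((A ^^ k) f) \<le> C * \<rho> ^ k * N f"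
    and \<zeta>: "\<rho> < norm \<zeta>" and g: "g \<in> X" and eq: "cscale \<zeta> g - A g = f"
  shows "(norm \<zeta> - \<rho>) * N g \<le> C * N f"
proof -
  define z where "z = norm \<zeta>"
  have z: "\<rho> < z" "0 < z" using \<zeta> \<rho> by (auto simp: z_def)
  have f: "f \<in> X"
    unfolding eq[symmetric] by (intro minus_mem scale_mem bounded_op_mem[OF A] g)
  note mS = bounded_op_mem[OF bounded_op_power_sum[OF A]]
  note mk = bounded_op_mem[OF bounded_op_funpow[OF A]]
  have S: "(z - \<rho>) * N (power_sum A \<zeta> m f) \<le> C * (z ^ m - \<rho> ^ m) * N f" for m
  proof (induction m)
    case 0
    show ?case unfolding power_sum.simps N_zero by simp
  next
    case (Suc m)
    have "N (power_sum A \<zeta> (Suc m) f) \<le> N (cscale \<zeta> (power_sum A \<zeta> m f)) + N ((A ^^ m) f)"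
      unfolding power_sum.simps by (intro N_add scale_mem mS mk f)
    also have "\<dots> \<le> z * N (power_sum A \<zeta> m f) + C * \<rho> ^ m * N f"
      using A_pow[OF f, of m] N_scale[OF mS[OF f], of \<zeta>] by (simp add: z_def)
    finally have "(z - \<rho>) * N (power_sum A \<zeta> (Suc m) f) \<le> (z - \<rho>) * (z * N (power_sum A \<zeta> m f) + C * \<rho> ^ m * N f)"
      using z by (intro mult_left_mono) auto
    also have "\<dots> = z * ((z - \<rho>) * N (power_sum A \<zeta> m f)) + (z - \<rho>) * (C * \<rho> ^ m * N f)"
      by (simp add: algebra_simps)
    also have "\<dots> \<le> z * (C * (z ^ m - \<rho> ^ m) * N f) + (z - \<rho>) * (C * \<rho> ^ m * N f)"
      using Suc z by (intro add_mono mult_left_mono order_refl) auto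
    also have "\<dots> = C * (z ^ Suc m - \<rho> ^ Suc m) * N f"
      by (simp add: algebra_simps)
    finally show ?case .
  qed
  have "(z - \<rho>) * N g \<le> C * (1 - (\<rho> / z) ^ m) * N f + (z - \<rho>) * (C * (\<rho> / z) ^ m * N g)" for m
  proof -
    have ps: "power_sum A \<zeta> m f = cscale (\<zeta> ^ m) g - (A ^^ m) g"
      unfolding eq[symmetric] by (rule power_sum_right[OF A g])
    have "cscale (\<zeta> ^ m) g = power_sum A \<zeta> m f + (A ^^ m) g"
      unfolding ps by (simp add: fun_eq_iff)
    then have "N (cscale (\<zeta> ^ m) g) = N (power_sum A \<zeta> m f + (A ^^ m) g)"
      by (rule arg_cong)
    also have "\<dots> \<le> N (power_sum A \<zeta> m f) + N ((A ^^ m) g)"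
      by (intro N_add mS mk f g)
    also have "\<dots> \<le> N (power_sum A \<zeta> m f) + C * \<rho> ^ m * N g"
      by (intro add_left_mono A_pow g)
    finally have "z ^ m * N g \<le> N (power_sum A \<zeta> m f) + C * \<rho> ^ m * N g"
      unfolding N_scale[OF g] by (simp add: z_def norm_power)
    then have "(z - \<rho>) * (z ^ m * N g) \<le> (z - \<rho>) * (N (power_sum A \<zeta> m f) + C * \<rho> ^ m * N g)"
      using z by (intro mult_left_mono) auto
    also have "\<dots> \<le> C * (z ^ m - \<rho> ^ m) * N f + (z - \<rho>) * (C * \<rho> ^ m * N g)"
      using S[of m] by (simp add: distrib_left)
    finally have "(z - \<rho>) * (z ^ m * N g) / z ^ m \<le> (C * (z ^ m - \<rho> ^ m) * N f + (z - \<rho>) * (C * \<rho> ^ m * N g)) / z ^ m"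
      using z by (intro divide_right_mono) auto
    also have "(z - \<rho>) * (z ^ m * N g) / z ^ m = (z - \<rho>) * N g"
      using z by simp
    also have "(C * (z ^ m - \<rho> ^ m) * N f + (z - \<rho>) * (C * \<rho> ^ m * N g)) / z ^ m =
        C * (1 - (\<rho> / z) ^ m) * N f + (z - \<rho>) * (C * (\<rho> / z) ^ m * N g)"
      using z by (simp add: power_divide field_simps)
    finally show ?thesis .
  qed
  moreover have "(\<lambda>m. C * (1 - (\<rho> / z) ^ m) * N f + (z - \<rho>) * (C * (\<rho> / z) ^ m * N g))
      \<longlonglongrightarrow> C * (1 - 0) * N f + (z - \<rho>) * (C * 0 * N g)"
    using z \<rho> by (intro tendsto_intros LIMSEQ_power_zero) auto
  ultimately have "(z - \<rho>) * N g \<le> C * (1 - 0) * N f + (z - \<rho>) * (C * 0 * N g)"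
    by (intro LIMSEQ_le_const) auto
  then show ?thesis
    by (simp add: z_def)
qed

text \<open>An eigenvector solves the resolvent equation with right-hand side 0, and the resolvent
  bound then kills it.\<close>

lemma eigenvalue_le_power_bound:
  assumes A: "bounded_op X N A" and \<rho>: "0 < \<rho>" and A_pow: "\<And>k f. f \<in> X \<Longrightarrow> N ((A ^^ k) f) \<le> C * \<rho> ^ k * N f"
    and ev: "eigenvalue_on X A \<mu>"
  shows "norm \<mu> \<le> \<rho>"
proof (rule ccontr)
  assume "\<not> norm \<mu> \<le> \<rho>"
  then have \<mu>: "\<rho> < norm \<mu>" by simp
  obtain f where f: "f \<in> X" "f \<noteq> 0" "A f = cscale \<mu> f"
    using ev unfolding eigenvalue_on_def by blast
  have eq: "cscale \<mu> f - A f = 0"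
    unfolding f(3) by simp
  have "(norm \<mu> - \<rho>) * N f \<le> C * N 0"
    by (rule resolvent_power_bound[OF A \<rho> A_pow \<mu> f(1) eq])
  then have "N f \<le> 0"
    using \<mu> by (simp add: N_zero mult_le_0_iff)
  with N_eq_0_imp[OF f(1)] f(2) show False by blast
qed

end

context power_inverse_family
begin

text \<open>The resolvent bound on the ray \<mu> + t makes the pole simple, so P f is the pointwise
  limit of t S(\<mu> + t) f. These functions are approximate eigenvectors; hence P f is an
  eigenvector and a multiple of \<open>h\<close>. Conversely \<open>P\<close> fixes the multiples of
  \<open>h\<close>. Uniqueness of the eigenvector alone would leave room for generalised
  eigenvectors.\<close>

theorem simple_isolated_eigenvalue:
  assumes \<rho>: "q < \<rho>" and M_le: "\<And>k f. f \<in> X \<Longrightarrow> N ((M ^^ k) f) \<le> C * \<rho> ^ k * N f"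
    and h: "h \<in> X" "h \<noteq> 0" "M h = cscale (of_real \<rho>) h"
    and unique: "\<And>f. f \<in> X \<Longrightarrow> M f = cscale (of_real \<rho>) f \<Longrightarrow> \<exists>c. f = cscale c h"
  shows "isolated_eigenvalue_mult X N M (of_real \<rho>) 1"
proof -
  define \<mu> where "\<mu> = complex_of_real \<rho>"
  have \<rho>0: "0 < \<rho>" using \<rho> q by linarith
  have ev: "eigenvalue_on X M \<mu>"
    unfolding eigenvalue_on_def \<mu>_def using h by blast
  have spec: "\<mu> \<in> spectrum_on X N M"
  proof (rule ccontr)
    assume "\<mu> \<notin> spectrum_on X N M"
    then obtain S where S: "is_resolvent_at X N M \<mu> S"
      unfolding spectrum_on_def by blast
    then have "S (cscale \<mu> h - M h) = h" and bS: "bounded_op X N S"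
      using h unfolding is_resolvent_at_def by blast+
    moreover have "cscale \<mu> h - M h = 0"
      unfolding h(3) \<mu>_def by simp
    ultimately have "h = 0"
      using bounded_op_zero[OF bS] by simp
    with h show False by blast
  qed
  have \<mu>q: "q < norm \<mu>"
    using \<rho> \<rho>0 by (simp add: \<mu>_def)
  obtain R k where R: "0 < R"
    and punct: "\<And>\<zeta>. \<zeta> \<in> ball \<mu> R - {\<mu>} \<Longrightarrow> \<zeta> \<notin> spectrum_on X N M"
    and Y: "\<And>f x. f \<in> X \<Longrightarrow> \<exists>Y. Y holomorphic_on ball \<mu> R \<and>
       (\<forall>\<zeta> \<in> ball \<mu> R - {\<mu>}. resolvent_on X N M \<zeta> f x = Y \<zeta> / (\<zeta> - \<mu>) ^ Suc k)"
    by (rule riesz_structure[OF spec \<mu>q]) blast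
  define r where "r = R / 2"
  have r: "0 < r" "r < R" using R by (auto simp: r_def)
  define S where "S \<zeta> = resolvent_on X N M \<zeta>" for \<zeta>
  have S: "is_resolvent_at X N M \<zeta> (S \<zeta>)" if "\<zeta> \<in> ball \<mu> R - {\<mu>}" for \<zeta>
    using punct[OF that] is_resolvent_resolvent_on unfolding spectrum_on_def S_def by blast
  have bS: "bounded_op X N (S \<zeta>)" and S_right: "\<And>f. f \<in> X \<Longrightarrow> cscale \<zeta> (S \<zeta> f) - M (S \<zeta> f) = f"
    and S_left: "\<And>f. f \<in> X \<Longrightarrow> S \<zeta> (cscale \<zeta> f - M f) = f"
    if "\<zeta> \<in> ball \<mu> R - {\<mu>}" for \<zeta>
    using S[OF that] unfolding is_resolvent_at_def by blast+
  have ray: "\<mu> + of_real t \<in> ball \<mu> R - {\<mu>}" "norm (\<mu> + of_real t) = \<rho> + t" if "0 < t" "t < R" for t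
  proof -
    show "\<mu> + of_real t \<in> ball \<mu> R - {\<mu>}" using that by (auto simp: dist_norm)
    have "\<mu> + of_real t = of_real (\<rho> + t)" by (simp add: \<mu>_def)
    then show "norm (\<mu> + of_real t) = \<rho> + t"
      using that \<rho>0 by (simp only: norm_of_real)
  qed
  have bound: "t * N (S (\<mu> + of_real t) f) \<le> C * N f" if t: "0 < t" "t < R" and f: "f \<in> X" for t f
    using resolvent_power_bound[OF M \<rho>0 M_le _ bounded_op_mem[OF bS[OF ray(1)[OF t]] f] S_right[OF ray(1)[OF t] f]]
      ray(2)[OF t] t by simp
  define P where "P = riesz_projection X N M \<mu> r"
  have lim: "((\<lambda>t. of_real t * S (\<mu> + of_real t) f x) \<longlongrightarrow> P f x) (at_right 0)" if f: "f \<in> X" for f x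
  proof -
    obtain Z where Z: "Z holomorphic_on ball \<mu> R"
      "\<And>\<zeta>. \<zeta> \<in> ball \<mu> R - {\<mu>} \<Longrightarrow> S \<zeta> f x = Z \<zeta> / (\<zeta> - \<mu>) ^ Suc k"
      using Y[OF f, of x] unfolding S_def by blast
    have "t * norm (S (\<mu> + of_real t) f x) \<le> C * N f" if t: "0 < t" "t < R" for t
    proof -
      have "t * norm (S (\<mu> + of_real t) f x) \<le> t * N (S (\<mu> + of_real t) f)"
        using t by (intro mult_left_mono eval_le bounded_op_mem[OF bS[OF ray(1)[OF t]] f]) auto
      also have "\<dots> \<le> C * N f" by (rule bound[OF t f])
      finally show ?thesis .
    qed
    from simple_pole_residue[OF Z(1) r Z(2) this] obtain c where
      c: "((\<lambda>t. of_real t * S (\<mu> + of_real t) f x) \<longlongrightarrow> c) (at_right 0)"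
        "contour_integral (circlepath \<mu> r) (\<lambda>\<zeta>. S \<zeta> f x) = 2 * of_real pi * \<i> * c"
      by blast
    have "P f x = c"
      using c(2) unfolding P_def riesz_projection_def S_def by simp
    with c(1) show ?thesis by simp
  qed
  have P_h: "P (cscale c h) = cscale c h" for c
  proof
    fix x
    have ch: "cscale c h \<in> X" by (intro scale_mem h)
    have "of_real t * S (\<mu> + of_real t) (cscale c h) x = c * h x" if t: "0 < t" "t < R" for t
    proof -
      \<comment> \<open>On eigenvectors t S(\<mu> + t) is the identity for every t, before any
        limit.\<close>
      have "cscale (\<mu> + of_real t) (cscale c h) - M (cscale c h) = cscale (of_real t) (cscale c h)"
        unfolding bounded_op_scale[OF M h(1)] h(3) \<mu>_def by (auto simp: fun_eq_iff algebra_simps)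
      then have "cscale (of_real t) (S (\<mu> + of_real t) (cscale c h)) = cscale c h"
        using S_left[OF ray(1)[OF t] ch] by (simp only: bounded_op_scale[OF bS[OF ray(1)[OF t]] ch])
      from fun_cong[OF this, of x] show ?thesis by (simp only: cscale_apply)
    qed
    then have "eventually (\<lambda>t. of_real t * S (\<mu> + of_real t) (cscale c h) x = c * h x) (at_right 0)"
      using eventually_at_right_real[OF R] by (auto elim!: eventually_mono)
    then have "((\<lambda>t. c * h x) \<longlongrightarrow> P (cscale c h) x) (at_right (0::real))"
      by (rule Lim_transform_eventually[OF lim[OF ch, of x]])
    then show "P (cscale c h) x = cscale c h x"
      using tendsto_unique[OF trivial_limit_at_right_real tendsto_const] by force
  qed
  have P_range: "\<exists>c. P f = cscale c h" if f: "f \<in> X" for f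
  proof -
    define t where "t k = R / real (k + 2)" for k
    have t: "0 < t k" "t k < R" for k
      using R mult_pos_pos[OF R(1), of "1 + real k"] by (auto simp: t_def field_simps)
    have "t \<longlonglongrightarrow> 0" unfolding t_def by real_asymp
    then have tlim: "filterlim t (at_right 0) sequentially"
      using t by (intro tendsto_imp_filterlim_at_right always_eventually) auto
    define F where "F k = cscale (of_real (t k)) (S (\<mu> + of_real (t k)) f)" for k
    have mS: "S (\<mu> + of_real (t k)) f \<in> X" for k
      by (rule bounded_op_mem[OF bS[OF ray(1)[OF t]] f])
    have F: "F k \<in> X" for k unfolding F_def by (intro scale_mem mS)
    have N_F: "N (F k) \<le> C * N f" for k
      unfolding F_def N_scale[OF mS] using bound[OF t f, of k] t(1)[of k] by simp
    have F_lim: "(\<lambda>k. F k x) \<longlonglongrightarrow> P f x" for x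
      unfolding F_def cscale_apply using filterlim_compose[OF lim[OF f, of x] tlim] .
    have le: "N (cscale \<mu> (F k) - M (F k)) \<le> t k * (N f + C * N f)" for k
    proof -
      \<comment> \<open>This is the resolvent equation multiplied by t k. As \<open>F k\<close>
        stays bounded, the defect is O(t k).\<close>
      have "cscale \<mu> (F k) - M (F k) = cscale (of_real (t k)) (f - F k)"
      proof
        fix x
        define g where "g = S (\<mu> + of_real (t k)) f"
        have "(\<mu> + of_real (t k)) * g x - M g x = f x"
          using fun_cong[OF S_right[OF ray(1)[OF t] f], of k x] unfolding g_def
          by (simp only: minus_apply cscale_apply)
        then have "of_real (t k) * ((\<mu> + of_real (t k)) * g x - M g x) = of_real (t k) * f x"
          by (rule arg_cong)
        moreover have "M (F k) x = of_real (t k) * M g x"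
          unfolding F_def g_def bounded_op_scale[OF M mS] by (rule cscale_apply)
        moreover have "F k x = of_real (t k) * g x"
          unfolding F_def g_def by (rule cscale_apply)
        ultimately show "(cscale \<mu> (F k) - M (F k)) x = cscale (of_real (t k)) (f - F k) x"
          by (simp only: minus_apply cscale_apply) (simp add: algebra_simps)
      qed
      then have "N (cscale \<mu> (F k) - M (F k)) = t k * N (f - F k)"
        using N_scale[OF minus_mem[OF f F], of "of_real (t k)" k] t(1)[of k] by simp
      also have "\<dots> \<le> t k * (N f + C * N f)"
        using N_minus[OF f F, of k] N_F[of k] t(1)[of k] by (intro mult_left_mono) auto
      finally show ?thesis .
    qed
    have approx: "(\<lambda>k. N (cscale \<mu> (F k) - M (F k))) \<longlonglongrightarrow> 0"
    proof (rule tendsto_sandwich[OF _ _ tendsto_const])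
      show "\<forall>\<^sub>F k in sequentially. 0 \<le> N (cscale \<mu> (F k) - M (F k))"
        by (intro always_eventually allI N_nonneg minus_mem scale_mem mem_M F)
      show "\<forall>\<^sub>F k in sequentially. N (cscale \<mu> (F k) - M (F k)) \<le> t k * (N f + C * N f)"
        using le by (intro always_eventually allI)
      show "(\<lambda>k. t k * (N f + C * N f)) \<longlonglongrightarrow> 0"
        using tendsto_mult_left_zero[OF \<open>t \<longlonglongrightarrow> 0\<close>] .
    qed
    obtain g where g: "g \<in> X" "(\<lambda>k. N (F k - g)) \<longlonglongrightarrow> 0" "M g = cscale \<mu> g"
      using approximate_eigenvector_limit[OF \<mu>q F approx F_lim] by blast
    have "P f = g"
    proof
      fix x
      have "norm (F k x - g x) \<le> N (F k - g)" for k
        using eval_le[OF minus_mem[OF F g(1)], of k x] by (simp only: minus_apply)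
      then have "(\<lambda>k. F k x - g x) \<longlonglongrightarrow> 0"
        by (intro Lim_null_comparison[OF always_eventually g(2)]) auto
      then have "(\<lambda>k. F k x) \<longlonglongrightarrow> g x"
        by (rule Lim_null[THEN iffD2])
      from LIMSEQ_unique[OF F_lim this] show "P f x = g x" .
    qed
    with unique[OF g(1)] g(3) show ?thesis unfolding \<mu>_def by blast
  qed
  have "P ` X = cfun.span {h}"
    unfolding cfun.span_singleton
  proof (intro equalityI subsetI)
    fix f assume "f \<in> P ` X"
    with P_range show "f \<in> range (\<lambda>c. cscale c h)" by blast
  next
    fix f assume "f \<in> range (\<lambda>c. cscale c h)"
    then obtain c where "f = cscale c h" by blast
    then have "f = P (cscale c h)" by (simp only: P_h)
    then show "f \<in> P ` X" using scale_mem[OF h(1)] by blast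
  qed
  moreover have "cball \<mu> r \<inter> spectrum_on X N M = {\<mu>}"
  proof -
    have "\<mu> \<in> cball \<mu> r" using r by simp
    moreover have "\<zeta> = \<mu>" if "\<zeta> \<in> cball \<mu> r" "\<zeta> \<in> spectrum_on X N M" for \<zeta>
      using punct[of \<zeta>] that r by force
    ultimately show ?thesis using spec by blast
  qed
  moreover have "cfun.independent {h}"
    using h(2) cfun.dependent_single by blast
  moreover have "finite {h}" "card {h} = 1"
    by simp_all
  ultimately show ?thesis
    unfolding isolated_eigenvalue_mult_def \<mu>_def[symmetric] P_def
    using ev r(1) by metis
qed

end

section \<open>Lipschitz functions on the induced shift space\<close>

lemma prepend_Nil [simp]: "prepend [] \<sigma> = \<sigma>"
  by (simp add: prepend_def)

lemma prepend_append: "prepend (v @ w) \<sigma> = prepend v (prepend w \<sigma>)"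
  by (auto simp: prepend_def fun_eq_iff nth_append)

lemma prepend_Cons: "prepend (k # ks) \<sigma> = prepend [k] (prepend ks \<sigma>)"
  using prepend_append[of "[k]" ks \<sigma>] by simp

lemma prepend_single_0 [simp]: "prepend [k] \<sigma> 0 = k"
  and prepend_single_Suc [simp]: "prepend [k] \<sigma> (Suc j) = \<sigma> j"
  by (simp_all add: prepend_def)

lemma prepend_mem: "set w \<subseteq> {1..} \<Longrightarrow> \<sigma> \<in> Sigma_space \<Longrightarrow> prepend w \<sigma> \<in> Sigma_space"
  by (auto simp: Sigma_space_def prepend_def subset_iff)

lemma prepend_single_mem: "1 \<le> k \<Longrightarrow> \<sigma> \<in> Sigma_space \<Longrightarrow> prepend [k] \<sigma> \<in> Sigma_space"
  by (rule prepend_mem) auto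

lemma ones_mem: "(\<lambda>_. 1) \<in> Sigma_space"
  by (simp add: Sigma_space_def)

lemma Sigma_space_nonempty: "Sigma_space \<noteq> {}"
  using ones_mem by blast

lemma d_theta_self [simp]: "d_theta \<theta> \<sigma> \<sigma> = 0"
  by (simp add: d_theta_def)

lemma d_theta_nonneg: "0 < \<theta> \<Longrightarrow> 0 \<le> d_theta \<theta> \<sigma> \<sigma>'"
  by (simp add: d_theta_def)

lemma d_theta_le_1: "0 < \<theta> \<Longrightarrow> \<theta> < 1 \<Longrightarrow> d_theta \<theta> \<sigma> \<sigma>' \<le> 1"
  by (simp add: d_theta_def power_le_one)

lemma d_theta_commute: "d_theta \<theta> \<sigma> \<sigma>' = d_theta \<theta> \<sigma>' \<sigma>"
  by (simp add: d_theta_def eq_commute)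

lemma d_theta_le_power:
  assumes "0 < \<theta>" "\<theta> < 1" "\<And>i. i < n \<Longrightarrow> \<sigma> i = \<sigma>' i"
  shows "d_theta \<theta> \<sigma> \<sigma>' \<le> \<theta> ^ n"
proof (cases "\<sigma> = \<sigma>'")
  case False
  then obtain j where "\<sigma> j \<noteq> \<sigma>' j" by auto
  then have "\<sigma> (LEAST j. \<sigma> j \<noteq> \<sigma>' j) \<noteq> \<sigma>' (LEAST j. \<sigma> j \<noteq> \<sigma>' j)"
    by (rule LeastI)
  then have "n \<le> (LEAST j. \<sigma> j \<noteq> \<sigma>' j)"
    using assms(3) by (meson not_le)
  with False assms show ?thesis
    by (simp add: d_theta_def power_decreasing)
qed (use assms in auto)

lemma d_theta_prepend_single: "d_theta \<theta> (prepend [k] \<sigma>) (prepend [k] \<sigma>') = \<theta> * d_theta \<theta> \<sigma> \<sigma>'"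
proof (cases "\<sigma> = \<sigma>'")
  case False
  then obtain j where j: "\<sigma> j \<noteq> \<sigma>' j" by auto
  have "prepend [k] \<sigma> \<noteq> prepend [k] \<sigma>'"
    using j by (metis prepend_single_Suc)
  moreover have "(LEAST j. prepend [k] \<sigma> j \<noteq> prepend [k] \<sigma>' j) =
      Suc (LEAST j. prepend [k] \<sigma> (Suc j) \<noteq> prepend [k] \<sigma>' (Suc j))"
    by (rule Least_Suc[of _ "Suc j"]) (use j in auto)
  ultimately show ?thesis
    using False by (simp add: d_theta_def)
qed auto

lemma d_theta_prepend: "d_theta \<theta> (prepend w \<sigma>) (prepend w \<sigma>') = \<theta> ^ length w * d_theta \<theta> \<sigma> \<sigma>'"
proof (induction w)
  case (Cons k w)
  then show ?case
    by (simp only: prepend_Cons[of k w] d_theta_prepend_single length_Cons power_Suc mult.assoc)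
qed auto

context
  fixes \<theta> :: real
  assumes \<theta>: "0 < \<theta>" "\<theta> < 1"
begin

definition sup_norm :: "((nat \<Rightarrow> nat) \<Rightarrow> complex) \<Rightarrow> real" where
  "sup_norm f = (SUP \<sigma>\<in>Sigma_space. norm (f \<sigma>))"

definition lip_seminorm :: "((nat \<Rightarrow> nat) \<Rightarrow> complex) \<Rightarrow> real" where
  "lip_seminorm f = Inf {L. lip_const \<theta> f L}"

lemma norm_theta_eq: "norm_theta \<theta> f = sup_norm f + lip_seminorm f"
  by (simp add: norm_theta_def sup_norm_def lip_seminorm_def)

lemma lip_seminorm_nonneg: "f \<in> F_theta \<theta> \<Longrightarrow> 0 \<le> lip_seminorm f"
  unfolding lip_seminorm_def F_theta_def by (auto intro!: cInf_greatest simp: lip_const_def)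

lemma F_theta_outside: "f \<in> F_theta \<theta> \<Longrightarrow> \<sigma> \<notin> Sigma_space \<Longrightarrow> f \<sigma> = 0"
  by (simp add: F_theta_def)

lemma F_theta_sup:
  assumes "f \<in> F_theta \<theta>" "\<sigma> \<in> Sigma_space"
  shows "norm (f \<sigma>) \<le> sup_norm f"
  unfolding sup_norm_def
proof (rule cSUP_upper[OF assms(2)])
  have "bounded (f ` Sigma_space)"
    using assms by (simp add: F_theta_def)
  then show "bdd_above ((\<lambda>\<sigma>. norm (f \<sigma>)) ` Sigma_space)"
    by (auto simp: bounded_iff bdd_above_def)
qed

lemma sup_norm_nonneg: "f \<in> F_theta \<theta> \<Longrightarrow> 0 \<le> sup_norm f"
  using F_theta_sup[OF _ ones_mem] norm_ge_zero order_trans by blast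

text \<open>Divided by the positive distance, the increment is one number lying below every
  admissible constant, hence below their infimum.\<close>

lemma F_theta_lip:
  assumes "f \<in> F_theta \<theta>" "\<sigma> \<in> Sigma_space" "\<sigma>' \<in> Sigma_space"
  shows "norm (f \<sigma> - f \<sigma>') \<le> lip_seminorm f * d_theta \<theta> \<sigma> \<sigma>'"
proof (cases "\<sigma> = \<sigma>'")
  case False
  then have d: "0 < d_theta \<theta> \<sigma> \<sigma>'"
    using \<theta> by (simp add: d_theta_def)
  have "norm (f \<sigma> - f \<sigma>') / d_theta \<theta> \<sigma> \<sigma>' \<le> lip_seminorm f"
    unfolding lip_seminorm_def
  proof (rule cInf_greatest)
    show "{L. lip_const \<theta> f L} \<noteq> {}"
      using assms(1) by (auto simp: F_theta_def)
    show "norm (f \<sigma> - f \<sigma>') / d_theta \<theta> \<sigma> \<sigma>' \<le> L" if "L \<in> {L. lip_const \<theta> f L}" for L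
      using that assms d by (auto simp: lip_const_def divide_le_eq)
  qed
  then show ?thesis
    using d by (simp add: divide_le_eq)
qed auto

lemma F_thetaI:
  assumes zero: "\<And>\<sigma>. \<sigma> \<notin> Sigma_space \<Longrightarrow> f \<sigma> = 0"
    and A: "\<And>\<sigma>. \<sigma> \<in> Sigma_space \<Longrightarrow> norm (f \<sigma>) \<le> A"
    and B: "\<And>\<sigma> \<sigma>'. \<sigma> \<in> Sigma_space \<Longrightarrow> \<sigma>' \<in> Sigma_space \<Longrightarrow> norm (f \<sigma> - f \<sigma>') \<le> B * d_theta \<theta> \<sigma> \<sigma>'"
    and "0 \<le> B"
  shows "f \<in> F_theta \<theta>" and "norm_theta \<theta> f \<le> A + B"
proof -
  have lip: "lip_const \<theta> f B"
    using assms by (simp add: lip_const_def)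
  show "f \<in> F_theta \<theta>"
    using zero A lip unfolding F_theta_def by (auto intro!: boundedI[of _ A])
  have "sup_norm f \<le> A"
    unfolding sup_norm_def by (intro cSUP_least Sigma_space_nonempty A)
  moreover have "lip_seminorm f \<le> B"
    unfolding lip_seminorm_def
    by (rule cInf_lower) (use lip in \<open>auto simp: bdd_below_def lip_const_def\<close>)
  ultimately show "norm_theta \<theta> f \<le> A + B"
    by (simp add: norm_theta_eq)
qed

lemma norm_theta_nonneg: "f \<in> F_theta \<theta> \<Longrightarrow> 0 \<le> norm_theta \<theta> f"
  using sup_norm_nonneg lip_seminorm_nonneg by (simp add: norm_theta_eq)

lemma F_theta_eval: "f \<in> F_theta \<theta> \<Longrightarrow> norm (f \<sigma>) \<le> norm_theta \<theta> f"
  using F_theta_sup[of f \<sigma>] F_theta_outside[of f \<sigma>] lip_seminorm_nonneg[of f] norm_theta_nonneg[of f]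
  by (cases "\<sigma> \<in> Sigma_space") (auto simp: norm_theta_eq)

lemma F_theta_scale:
  assumes f: "f \<in> F_theta \<theta>"
  shows "cscale c f \<in> F_theta \<theta>" and "norm_theta \<theta> (cscale c f) \<le> norm c * norm_theta \<theta> f"
proof -
  have 1: "norm (cscale c f \<sigma>) \<le> norm c * sup_norm f" if "\<sigma> \<in> Sigma_space" for \<sigma>
    using F_theta_sup[OF f that] by (simp add: norm_mult mult_left_mono)
  have 2: "norm (cscale c f \<sigma> - cscale c f \<sigma>') \<le> norm c * lip_seminorm f * d_theta \<theta> \<sigma> \<sigma>'"
    if "\<sigma> \<in> Sigma_space" "\<sigma>' \<in> Sigma_space" for \<sigma> \<sigma>'
    using mult_left_mono[OF F_theta_lip[OF f that], of "norm c"]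
    by (simp add: norm_mult mult.assoc flip: right_diff_distrib)
  have 3: "0 \<le> norm c * lip_seminorm f"
    using lip_seminorm_nonneg[OF f] by simp
  have 4: "cscale c f \<sigma> = 0" if "\<sigma> \<notin> Sigma_space" for \<sigma>
    using F_theta_outside[OF f that] by simp
  show "cscale c f \<in> F_theta \<theta>"
    by (rule F_thetaI[OF 4 1 2 3])
  show "norm_theta \<theta> (cscale c f) \<le> norm c * norm_theta \<theta> f"
    using F_thetaI(2)[of "cscale c f", OF 4 1 2 3] by (simp add: norm_theta_eq distrib_left)
qed

lemma function_banach_space_F_theta: "function_banach_space (F_theta \<theta>) (norm_theta \<theta>)"
proof
  show "(0 :: (nat \<Rightarrow> nat) \<Rightarrow> complex) \<in> F_theta \<theta>"
    by (rule F_thetaI[of _ 0 0]) auto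
next
  fix f g assume f: "f \<in> F_theta \<theta>" and g: "g \<in> F_theta \<theta>"
  have 1: "norm ((f + g) \<sigma>) \<le> sup_norm f + sup_norm g" if "\<sigma> \<in> Sigma_space" for \<sigma>
    using F_theta_sup[OF f that] F_theta_sup[OF g that] norm_triangle_ineq[of "f \<sigma>" "g \<sigma>"]
    by (simp only: plus_fun_apply)
  have 2: "norm ((f + g) \<sigma> - (f + g) \<sigma>') \<le> (lip_seminorm f + lip_seminorm g) * d_theta \<theta> \<sigma> \<sigma>'"
    if "\<sigma> \<in> Sigma_space" "\<sigma>' \<in> Sigma_space" for \<sigma> \<sigma>'
  proof -
    have "norm ((f + g) \<sigma> - (f + g) \<sigma>') = norm ((f \<sigma> - f \<sigma>') + (g \<sigma> - g \<sigma>'))"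
      by (simp add: algebra_simps)
    also have "\<dots> \<le> norm (f \<sigma> - f \<sigma>') + norm (g \<sigma> - g \<sigma>')"
      by (rule norm_triangle_ineq)
    also have "\<dots> \<le> (lip_seminorm f + lip_seminorm g) * d_theta \<theta> \<sigma> \<sigma>'"
      unfolding distrib_right by (intro add_mono F_theta_lip f g that)
    finally show ?thesis .
  qed
  have 3: "0 \<le> lip_seminorm f + lip_seminorm g"
    using lip_seminorm_nonneg[OF f] lip_seminorm_nonneg[OF g] by simp
  have 4: "(f + g) \<sigma> = 0" if "\<sigma> \<notin> Sigma_space" for \<sigma>
    using F_theta_outside[OF f that] F_theta_outside[OF g that] by simp
  show "f + g \<in> F_theta \<theta>"
    by (rule F_thetaI[OF 4 1 2 3])
  show "norm_theta \<theta> (f + g) \<le> norm_theta \<theta> f + norm_theta \<theta> g"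
    using F_thetaI(2)[of "f + g", OF 4 1 2 3] by (simp add: norm_theta_eq)
next
  fix f and c :: complex assume f: "f \<in> F_theta \<theta>"
  show "cscale c f \<in> F_theta \<theta>"
    by (rule F_theta_scale[OF f])
  show "norm_theta \<theta> (cscale c f) = norm c * norm_theta \<theta> f"
  proof (cases "c = 0")
    case True
    then have "norm_theta \<theta> (cscale c f) \<le> 0"
      using F_theta_scale(2)[OF f, of c] by simp
    then show ?thesis
      using norm_theta_nonneg[OF F_theta_scale(1)[OF f, of c]] True by simp
  next
    case False
    \<comment> \<open>The reverse inequality is the one for scaling by 1/c.\<close>
    have "cscale (1 / c) (cscale c f) = f"
      using False by (simp add: fun_eq_iff)
    then have "norm_theta \<theta> f \<le> norm (1 / c) * norm_theta \<theta> (cscale c f)"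
      using F_theta_scale(2)[OF F_theta_scale(1)[OF f, of c], of "1 / c"] by simp
    then have "norm c * norm_theta \<theta> f \<le> norm_theta \<theta> (cscale c f)"
      using False by (simp add: norm_divide field_simps)
    with F_theta_scale(2)[OF f, of c] show ?thesis
      by simp
  qed
next
  fix f \<sigma> assume "f \<in> F_theta \<theta>"
  then show "norm (f \<sigma>) \<le> norm_theta \<theta> f"
    by (rule F_theta_eval)
next
  fix F :: "nat \<Rightarrow> (nat \<Rightarrow> nat) \<Rightarrow> complex" and b g
  assume F: "\<And>k. F k \<in> F_theta \<theta>" and b: "\<And>k. norm_theta \<theta> (F k) \<le> b k" "summable b"
    and g: "\<And>x. (\<lambda>k. F k x) sums g x"
  \<comment> \<open>The two parts of the norm are summed separately; each is dominated by
    \<open>b\<close>, and together they give back the sum of the norms.\<close>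
  have s: "summable (\<lambda>k. sup_norm (F k))" "summable (\<lambda>k. lip_seminorm (F k))"
  proof -
    have "norm (sup_norm (F k)) \<le> b k" "norm (lip_seminorm (F k)) \<le> b k" for k
      using b(1)[of k] sup_norm_nonneg[OF F, of k] lip_seminorm_nonneg[OF F, of k]
      unfolding norm_theta_eq by auto
    then show "summable (\<lambda>k. sup_norm (F k))" "summable (\<lambda>k. lip_seminorm (F k))"
      by (auto intro: summable_comparison_test'[OF b(2)])
  qed
  have 1: "norm (g \<sigma>) \<le> (\<Sum>k. sup_norm (F k))" if "\<sigma> \<in> Sigma_space" for \<sigma>
    using g[of \<sigma>] F_theta_sup[OF F that] s(1)
    by (metis norm_suminf_le sums_unique)
  have 2: "norm (g \<sigma> - g \<sigma>') \<le> (\<Sum>k. lip_seminorm (F k)) * d_theta \<theta> \<sigma> \<sigma>'"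
    if "\<sigma> \<in> Sigma_space" "\<sigma>' \<in> Sigma_space" for \<sigma> \<sigma>'
  proof -
    have "g \<sigma> - g \<sigma>' = (\<Sum>k. F k \<sigma> - F k \<sigma>')"
      by (intro sums_unique sums_diff g)
    moreover have "norm (\<Sum>k. F k \<sigma> - F k \<sigma>') \<le> (\<Sum>k. lip_seminorm (F k) * d_theta \<theta> \<sigma> \<sigma>')"
      by (rule norm_suminf_le) (rule F_theta_lip[OF F that], rule summable_mult2[OF s(2)])
    moreover have "(\<Sum>k. lip_seminorm (F k) * d_theta \<theta> \<sigma> \<sigma>') = (\<Sum>k. lip_seminorm (F k)) * d_theta \<theta> \<sigma> \<sigma>'"
      by (rule suminf_mult2[OF s(2), symmetric])
    ultimately show ?thesis
      by (simp only:)
  qed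
  have 3: "0 \<le> (\<Sum>k. lip_seminorm (F k))"
    by (intro suminf_nonneg s lip_seminorm_nonneg F)
  have 4: "g \<sigma> = 0" if "\<sigma> \<notin> Sigma_space" for \<sigma>
    using g[of \<sigma>] F_theta_outside[OF F that] sums_unique2[OF _ sums_zero] by auto
  have "norm_theta \<theta> g \<le> (\<Sum>k. sup_norm (F k)) + (\<Sum>k. lip_seminorm (F k))"
    by (rule F_thetaI(2)[OF 4 1 2 3])
  also have "\<dots> = (\<Sum>k. norm_theta \<theta> (F k))"
    unfolding norm_theta_eq by (rule suminf_add[OF s])
  also have "\<dots> \<le> suminf b"
    using summable_add[OF s] b by (intro suminf_le) (auto simp: norm_theta_eq)
  finally show "g \<in> F_theta \<theta> \<and> norm_theta \<theta> g \<le> suminf b"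
    using F_thetaI(1)[OF 4 1 2 3] by blast
qed

end

section \<open>Weighted sums over words\<close>

definition words :: "nat \<Rightarrow> nat list set" where
  "words n = {ks. length ks = n \<and> set ks \<subseteq> {1..}}"

lemma words_0: "words 0 = {[]}"
  by (auto simp: words_def)

lemma words_Suc: "words (Suc n) = (\<lambda>(ks, k). k # ks) ` (words n \<times> {1..})"
  by (auto simp: words_def length_Suc_conv image_iff)

lemma inj_Cons_swap: "inj_on (\<lambda>(ks, k). k # ks) A"
  by (auto simp: inj_on_def)

lemma words_sum_list_ge: "ks \<in> words n \<Longrightarrow> n \<le> sum_list ks"
proof (induction ks arbitrary: n)
  case (Cons k ks)
  then have "length ks \<le> sum_list ks" "1 \<le> k"
    by (auto simp: words_def)
  with Cons.prems show ?case
    by (auto simp: words_def)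
qed (auto simp: words_def)

lemma summable_on_minus:
  fixes f g :: "'b \<Rightarrow> 'a::banach"
  assumes "f summable_on A" "g summable_on A"
  shows "(\<lambda>x. f x - g x) summable_on A"
  using summable_on_add[OF assms(1) summable_on_uminus[THEN iffD2, OF assms(2)]] by simp

lemma infsum_minus:
  fixes f g :: "'b \<Rightarrow> 'a::banach"
  assumes "f summable_on A" "g summable_on A"
  shows "infsum (\<lambda>x. f x - g x) A = infsum f A - infsum g A"
  using infsum_add[OF assms(1) summable_on_uminus[THEN iffD2, OF assms(2)]]
  by (simp add: infsum_uminus)

text \<open>Converts multiplicative distortion into a Lipschitz estimate, uniformly for distances x
  at most 1.\<close>

lemma exp_minus_one_le:
  fixes x K :: real
  assumes "0 \<le> x" "x \<le> 1" "0 \<le> K"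
  shows "exp (K * x) - 1 \<le> K * exp K * x"
proof -
  have "1 - K * x \<le> exp (- (K * x))"
    using exp_ge_add_one_self[of "- (K * x)"] by simp
  then have "(1 - K * x) * exp (K * x) \<le> exp (- (K * x)) * exp (K * x)"
    by (intro mult_right_mono) auto
  then have "exp (K * x) - 1 \<le> K * x * exp (K * x)"
    by (simp add: exp_minus algebra_simps)
  also have "\<dots> \<le> K * x * exp K"
    using assms by (intro mult_left_mono) (auto simp: mult_left_le)
  finally show ?thesis
    by (simp add: mult_ac)
qed

text \<open>\<open>b k\<close> majorises the weight uniformly on the cylinder of the letter
  \<open>k\<close>, and its summability stands in for a finite alphabet. The exponent
  \<open>C * \<theta> * d_theta\<close> is a variation bound C \<theta>^n, in which n is one more
  than the first index where \<sigma> and \<sigma>' differ.\<close>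

locale induced_weight =
  fixes \<theta> C :: real and \<psi> :: "(nat \<Rightarrow> nat) \<Rightarrow> real" and b :: "nat \<Rightarrow> real"
  assumes \<theta>: "0 < \<theta>" "\<theta> < 1" and C: "0 < C"
    and \<psi>_pos: "\<And>\<sigma>. \<sigma> \<in> Sigma_space \<Longrightarrow> 0 < \<psi> \<sigma>"
    and \<psi>_le: "\<And>\<sigma> k. \<sigma> \<in> Sigma_space \<Longrightarrow> 1 \<le> k \<Longrightarrow> \<psi> (prepend [k] \<sigma>) \<le> b k"
    and b_summable: "b summable_on {1..}"
    and \<psi>_distortion: "\<And>\<sigma> \<sigma>' k. \<sigma> \<in> Sigma_space \<Longrightarrow> \<sigma>' \<in> Sigma_space \<Longrightarrow> 1 \<le> k \<Longrightarrow>
       \<psi> (prepend [k] \<sigma>) \<le> exp (C * \<theta> * d_theta \<theta> \<sigma> \<sigma>') * \<psi> (prepend [k] \<sigma>')"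
begin

section \<open>Weights of words and their distortion\<close>

lemma b_nonneg: "1 \<le> k \<Longrightarrow> 0 \<le> b k"
  using \<psi>_le[OF ones_mem, of k] \<psi>_pos[OF prepend_single_mem[OF _ ones_mem, of k]] by linarith

text \<open>The Birkhoff product of \<psi> along the first \<open>length ks\<close> points of the
  orbit of \<open>prepend ks \<sigma>\<close>: the weight of an inverse branch of an iterated
  shift.\<close>

definition weight :: "nat list \<Rightarrow> (nat \<Rightarrow> nat) \<Rightarrow> real" where
  "weight ks \<sigma> = (\<Prod>i<length ks. \<psi> (prepend (drop i ks) \<sigma>))"

lemma weight_Nil [simp]: "weight [] \<sigma> = 1"
  by (simp add: weight_def)

lemma weight_Cons: "weight (k # ks) \<sigma> = \<psi> (prepend [k] (prepend ks \<sigma>)) * weight ks \<sigma>"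
  unfolding weight_def length_Cons prod.lessThan_Suc_shift by (simp add: prepend_Cons[of k ks])

lemma weight_pos: "set ks \<subseteq> {1..} \<Longrightarrow> \<sigma> \<in> Sigma_space \<Longrightarrow> 0 < weight ks \<sigma>"
proof (induction ks)
  case (Cons k ks)
  then have "0 < weight ks \<sigma>" "prepend [k] (prepend ks \<sigma>) \<in> Sigma_space"
    by (auto intro!: prepend_single_mem prepend_mem)
  then show ?case
    by (simp add: weight_Cons \<psi>_pos)
qed simp

lemma weight_le: "set ks \<subseteq> {1..} \<Longrightarrow> \<sigma> \<in> Sigma_space \<Longrightarrow> weight ks \<sigma> \<le> prod_list (map b ks)"
proof (induction ks)
  case (Cons k ks)
  then have "1 \<le> k" "prepend ks \<sigma> \<in> Sigma_space" "weight ks \<sigma> \<le> prod_list (map b ks)" "0 < weight ks \<sigma>"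
    by (auto intro!: prepend_mem weight_pos)
  then show ?case
    unfolding weight_Cons by (auto intro!: mult_mono \<psi>_le b_nonneg)
qed simp

text \<open>The sum of the series of all C \<theta>^j with j \<ge> 1, hence a bound for the
  logarithmic distortion of words of any length.\<close>

definition K :: real where "K = C * \<theta> / (1 - \<theta>)"

lemma K_pos: "0 < K"
  using \<theta> C by (simp add: K_def)

lemma K_eq: "C * \<theta> = K * (1 - \<theta>)"
  using \<theta> by (simp add: K_def)

text \<open>The letter at distance j from the end of the word sees points that are \<theta>^j times
  closer, so the exponents form a partial geometric sum. The factor 1 - \<theta>^n is retained
  because for n = 1 it leaves exactly the room that invariance of the cone takes up.\<close>

lemma weight_distortion':
  assumes "set ks \<subseteq> {1..}" "\<sigma> \<in> Sigma_space" "\<sigma>' \<in> Sigma_space"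
  shows "weight ks \<sigma> \<le> exp (K * (1 - \<theta> ^ length ks) * d_theta \<theta> \<sigma> \<sigma>') * weight ks \<sigma>'"
  using assms(1)
proof (induction ks)
  case (Cons k ks)
  then have ks: "set ks \<subseteq> {1..}" and k: "1 \<le> k" by auto
  have mem: "prepend ks \<sigma> \<in> Sigma_space" "prepend ks \<sigma>' \<in> Sigma_space"
    using prepend_mem[OF ks] assms by auto
  have "weight (k # ks) \<sigma> \<le> (exp (C * \<theta> * d_theta \<theta> (prepend ks \<sigma>) (prepend ks \<sigma>')) * \<psi> (prepend [k] (prepend ks \<sigma>'))) *
      (exp (K * (1 - \<theta> ^ length ks) * d_theta \<theta> \<sigma> \<sigma>') * weight ks \<sigma>')"
    unfolding weight_Cons
    using Cons.IH[OF ks] \<psi>_distortion[OF mem k] weight_pos[OF ks assms(2)]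
      \<psi>_pos[OF prepend_single_mem[OF k mem(2)]]
    by (intro mult_mono) auto
  also have "\<dots> = exp (C * \<theta> * (\<theta> ^ length ks * d_theta \<theta> \<sigma> \<sigma>') + K * (1 - \<theta> ^ length ks) * d_theta \<theta> \<sigma> \<sigma>') * weight (k # ks) \<sigma>'"
    unfolding weight_Cons d_theta_prepend by (simp add: exp_add mult_ac)
  also have "C * \<theta> * (\<theta> ^ length ks * d_theta \<theta> \<sigma> \<sigma>') + K * (1 - \<theta> ^ length ks) * d_theta \<theta> \<sigma> \<sigma>' =
      K * (1 - \<theta> ^ length (k # ks)) * d_theta \<theta> \<sigma> \<sigma>'"
    unfolding K_eq by (simp add: algebra_simps)
  finally show ?case .
qed simp

lemma weight_distortion:
  assumes "set ks \<subseteq> {1..}" "\<sigma> \<in> Sigma_space" "\<sigma>' \<in> Sigma_space"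
  shows "weight ks \<sigma> \<le> exp (K * d_theta \<theta> \<sigma> \<sigma>') * weight ks \<sigma>'"
proof -
  have "K * (1 - \<theta> ^ length ks) * d_theta \<theta> \<sigma> \<sigma>' \<le> K * d_theta \<theta> \<sigma> \<sigma>'"
    using K_pos \<theta> d_theta_nonneg[OF \<theta>(1), of \<sigma> \<sigma>']
    by (intro mult_right_mono) (auto simp: mult_left_le)
  then have "exp (K * (1 - \<theta> ^ length ks) * d_theta \<theta> \<sigma> \<sigma>') * weight ks \<sigma>' \<le> exp (K * d_theta \<theta> \<sigma> \<sigma>') * weight ks \<sigma>'"
    using weight_pos[OF assms(1,3)] by (intro mult_right_mono) auto
  with weight_distortion'[OF assms] show ?thesis by linarith
qed

definition D :: real where "D = exp K"

lemma D_ge_1: "1 \<le> D" using K_pos by (simp add: D_def)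

lemma exp_K_le_D: "exp (K * d_theta \<theta> \<sigma> \<sigma>') \<le> D"
  using K_pos d_theta_le_1[OF \<theta>] by (simp add: D_def mult_left_le)

lemma weight_le_D:
  assumes "set ks \<subseteq> {1..}" "\<sigma> \<in> Sigma_space" "\<sigma>' \<in> Sigma_space"
  shows "weight ks \<sigma> \<le> D * weight ks \<sigma>'"
  using weight_distortion[OF assms] mult_right_mono[OF exp_K_le_D, of "weight ks \<sigma>'" \<sigma> \<sigma>']
    weight_pos[OF assms(1,3)] by linarith

text \<open>One factor \<open>D\<close> comes from linearising the exponential. The other exchanges
  \<sigma> for \<sigma>' when the difference has the opposite sign.\<close>

lemma weight_diff:
  assumes "set ks \<subseteq> {1..}" "\<sigma> \<in> Sigma_space" "\<sigma>' \<in> Sigma_space"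
  shows "\<bar>weight ks \<sigma> - weight ks \<sigma>'\<bar> \<le> K * D * D * d_theta \<theta> \<sigma> \<sigma>' * weight ks \<sigma>'"
proof -
  define x where "x = d_theta \<theta> \<sigma> \<sigma>'"
  have x: "0 \<le> x" "x \<le> 1" using d_theta_nonneg[OF \<theta>(1)] d_theta_le_1[OF \<theta>] by (auto simp: x_def)
  have e: "exp (K * x) - 1 \<le> K * D * x"
    unfolding D_def by (rule exp_minus_one_le) (use x K_pos in auto)
  have p: "0 < weight ks \<sigma>" "0 < weight ks \<sigma>'"
    by (rule weight_pos[OF assms(1,2)], rule weight_pos[OF assms(1,3)])
  have "weight ks \<sigma> - weight ks \<sigma>' \<le> (exp (K * x) - 1) * weight ks \<sigma>'"
    using weight_distortion[OF assms] by (simp add: x_def algebra_simps)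
  also have "\<dots> \<le> K * D * x * weight ks \<sigma>'"
    using e p by (intro mult_right_mono) auto
  also have "\<dots> \<le> K * D * x * weight ks \<sigma>' * D"
    using mult_left_mono[OF D_ge_1, of "K * D * x * weight ks \<sigma>'"] D_ge_1 K_pos x p by simp
  finally have 1: "weight ks \<sigma> - weight ks \<sigma>' \<le> K * D * D * x * weight ks \<sigma>'"
    by (simp add: mult_ac)
  have "weight ks \<sigma>' - weight ks \<sigma> \<le> (exp (K * x) - 1) * weight ks \<sigma>"
    using weight_distortion[OF assms(1,3,2)] by (simp add: x_def d_theta_commute[of \<theta> \<sigma>'] algebra_simps)
  also have "\<dots> \<le> K * D * x * weight ks \<sigma>"
    using e p by (intro mult_right_mono) auto
  also have "\<dots> \<le> K * D * x * (D * weight ks \<sigma>')"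
    using K_pos D_ge_1 x by (intro mult_left_mono weight_le_D assms) auto
  finally have 2: "weight ks \<sigma>' - weight ks \<sigma> \<le> K * D * D * x * weight ks \<sigma>'"
    by (simp add: mult_ac)
  show ?thesis
    using 1 2 unfolding x_def[symmetric] by linarith
qed

lemma prod_b_nonneg: "set ks \<subseteq> {1..} \<Longrightarrow> 0 \<le> prod_list (map b ks)"
  by (induction ks) (auto intro!: mult_nonneg_nonneg b_nonneg)

text \<open>Summing over the front letter first, each further letter multiplies the total by the sum
  of \<open>b\<close>.\<close>

lemma prod_b_summable: "(\<lambda>ks. prod_list (map b ks)) summable_on words n"
proof (induction n)
  case (Suc n)
  have "(\<lambda>(ks, k). prod_list (map b (k # ks))) summable_on (words n \<times> {1..})"
  proof (rule summable_on_SigmaI)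
    show "((\<lambda>k. case (ks, k) of (ks, k) \<Rightarrow> prod_list (map b (k # ks))) has_sum
        infsum b {1..} * prod_list (map b ks)) {1..}" for ks
      using has_sum_cmult_left[OF has_sum_infsum[OF b_summable]] by simp
    show "(\<lambda>ks. infsum b {1..} * prod_list (map b ks)) summable_on words n"
      by (rule summable_on_cmult_right[OF Suc])
    show "0 \<le> (case (ks, k) of (ks, k) \<Rightarrow> prod_list (map b (k # ks)))" if "ks \<in> words n" "k \<in> {1..}" for ks k
      using that prod_b_nonneg[of "k # ks"] by (auto simp: words_def)
  qed
  then show ?case
    unfolding words_Suc by (subst summable_on_reindex[OF inj_Cons_swap]) (simp add: o_def case_prod_unfold)
qed (simp add: words_0)

text \<open>The scalars are generic, so that the complex operator and its real majorant share their
  lemmas. The coefficients \<open>c\<close> are arbitrary functions of the word, which covers frozen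
  values and differences of values besides f(prepend ks \<sigma>).\<close>

definition wterm :: "'a::{real_normed_field,banach} \<Rightarrow> (nat list \<Rightarrow> 'a) \<Rightarrow> (nat \<Rightarrow> nat) \<Rightarrow> nat list \<Rightarrow> 'a" where
  "wterm z c \<sigma> ks = z ^ sum_list ks * of_real (weight ks \<sigma>) * c ks"

definition wsum :: "'a::{real_normed_field,banach} \<Rightarrow> nat list set \<Rightarrow> (nat list \<Rightarrow> 'a) \<Rightarrow> (nat \<Rightarrow> nat) \<Rightarrow> 'a" where
  "wsum z J c \<sigma> = infsum (wterm z c \<sigma>) J"

lemma words_set: "J \<subseteq> words n \<Longrightarrow> ks \<in> J \<Longrightarrow> set ks \<subseteq> {1..}"
  by (auto simp: words_def)

lemma norm_wterm:
  assumes "set ks \<subseteq> {1..}" "\<sigma> \<in> Sigma_space"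
  shows "norm (wterm z c \<sigma> ks) = norm z ^ sum_list ks * weight ks \<sigma> * norm (c ks)"
  using weight_pos[OF assms] by (simp add: wterm_def norm_mult norm_power)

lemma norm_wterm_le:
  assumes ks: "set ks \<subseteq> {1..}" "\<sigma> \<in> Sigma_space" and z: "norm z \<le> 1" and a: "norm (c ks) \<le> a"
  shows "norm (wterm z c \<sigma> ks) \<le> a * prod_list (map b ks)"
proof -
  have "norm (wterm z c \<sigma> ks) \<le> 1 * prod_list (map b ks) * a"
    unfolding norm_wterm[OF ks] using weight_le[OF ks] weight_pos[OF ks] z a prod_b_nonneg[OF ks(1)]
    by (intro mult_mono power_le_one) auto
  then show ?thesis by (simp add: mult.commute)
qed

lemma wterm_abs_summable:
  assumes J: "J \<subseteq> words n" and \<sigma>: "\<sigma> \<in> Sigma_space" and z: "norm z \<le> 1"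
    and a: "\<And>ks. ks \<in> J \<Longrightarrow> norm (c ks) \<le> a"
  shows "(\<lambda>ks. norm (wterm z c \<sigma> ks)) summable_on J"
proof (rule Infinite_Sum.abs_summable_on_comparison_test')
  show "(\<lambda>ks. a * prod_list (map b ks)) summable_on J"
    by (rule summable_on_subset_banach[OF summable_on_cmult_right[OF prod_b_summable] J])
  show "norm (wterm z c \<sigma> ks) \<le> a * prod_list (map b ks)" if "ks \<in> J" for ks
    using words_set[OF J that] \<sigma> z a[OF that] by (rule norm_wterm_le)
qed

lemmas wterm_summable = abs_summable_summable[OF wterm_abs_summable]

lemma norm_wsum_le:
  assumes J: "J \<subseteq> words n" and \<sigma>: "\<sigma> \<in> Sigma_space" and z: "norm z \<le> 1"
    and a: "\<And>ks. ks \<in> J \<Longrightarrow> norm (c ks) \<le> a"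
  shows "norm (wsum z J c \<sigma>) \<le> wsum (norm z) J (\<lambda>ks. norm (c ks)) \<sigma>"
proof -
  have "norm (wsum z J c \<sigma>) \<le> (\<Sum>\<^sub>\<infinity>ks\<in>J. norm (wterm z c \<sigma> ks))"
    unfolding wsum_def by (rule norm_infsum_bound[OF wterm_abs_summable[OF assms]])
  also have "\<dots> = wsum (norm z) J (\<lambda>ks. norm (c ks)) \<sigma>"
  proof -
    have "norm (wterm z c \<sigma> ks) = wterm (norm z) (\<lambda>ks. norm (c ks)) \<sigma> ks" if "ks \<in> J" for ks
      unfolding norm_wterm[OF words_set[OF J that] \<sigma>] by (simp add: wterm_def)
    then show ?thesis
      unfolding wsum_def by (rule infsum_cong)
  qed
  finally show ?thesis .
qed

lemma wsum_mono:
  fixes r :: real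
  assumes J: "J \<subseteq> words n" and \<sigma>: "\<sigma> \<in> Sigma_space" and r: "0 \<le> r" "r \<le> 1"
    and c: "\<And>ks. ks \<in> J \<Longrightarrow> \<bar>c ks\<bar> \<le> a" and c': "\<And>ks. ks \<in> J \<Longrightarrow> \<bar>c' ks\<bar> \<le> a'"
    and le: "\<And>ks. ks \<in> J \<Longrightarrow> c ks \<le> c' ks"
  shows "wsum r J c \<sigma> \<le> wsum r J c' \<sigma>"
  unfolding wsum_def
proof (rule infsum_mono)
  show "wterm r c \<sigma> summable_on J" "wterm r c' \<sigma> summable_on J"
    using r c c' by (auto intro!: wterm_summable[OF J \<sigma>])
  show "wterm r c \<sigma> ks \<le> wterm r c' \<sigma> ks" if "ks \<in> J" for ks
    unfolding wterm_def using r weight_pos[OF words_set[OF J that] \<sigma>] le[OF that]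
    by (intro mult_left_mono) auto
qed

lemma wsum_cmult: "wsum z J (\<lambda>ks. a * c ks) \<sigma> = a * wsum z J c \<sigma>"
proof -
  have "wterm z (\<lambda>ks. a * c ks) \<sigma> = (\<lambda>ks. a * wterm z c \<sigma> ks)"
    by (simp add: wterm_def fun_eq_iff mult_ac)
  then show ?thesis
    unfolding wsum_def by (simp add: infsum_cmult_right')
qed

lemma wsum_diff:
  assumes J: "J \<subseteq> words n" and \<sigma>: "\<sigma> \<in> Sigma_space" and z: "norm z \<le> 1"
    and a: "\<And>ks. ks \<in> J \<Longrightarrow> norm (c ks) \<le> a" and a': "\<And>ks. ks \<in> J \<Longrightarrow> norm (c' ks) \<le> a'"
  shows "wsum z J (\<lambda>ks. c ks - c' ks) \<sigma> = wsum z J c \<sigma> - wsum z J c' \<sigma>"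
proof -
  have "wterm z (\<lambda>ks. c ks - c' ks) \<sigma> = (\<lambda>ks. wterm z c \<sigma> ks - wterm z c' \<sigma> ks)"
    by (simp add: wterm_def fun_eq_iff right_diff_distrib)
  then show ?thesis
    unfolding wsum_def
    by (simp add: infsum_minus wterm_summable[OF J \<sigma> z a] wterm_summable[OF J \<sigma> z a'])
qed

lemma wsum_const_le:
  fixes r :: real
  assumes J: "J \<subseteq> words n" and \<sigma>: "\<sigma> \<in> Sigma_space" and r: "0 \<le> r" "r \<le> 1"
    and a: "\<And>ks. ks \<in> J \<Longrightarrow> \<bar>c ks\<bar> \<le> a"
  shows "wsum r J c \<sigma> \<le> a * wsum r J (\<lambda>_. 1) \<sigma>"
proof -
  have "wsum r J c \<sigma> \<le> wsum r J (\<lambda>ks. a * 1) \<sigma>"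
    by (rule wsum_mono[OF J \<sigma> r a, where a' = "\<bar>a\<bar>"]) (use a in \<open>force simp: abs_le_iff\<close>)+
  then show ?thesis
    by (simp only: wsum_cmult)
qed

text \<open>Each term changes through its weight, controlled by \<open>weight_diff\<close>, and
  through its coefficient, controlled by \<open>l\<close>. Both contributions are proportional to
  the weight at \<sigma>', so they sum up to the total mass there.\<close>

lemma wsum_lipschitz:
  assumes J: "J \<subseteq> words n" and \<sigma>: "\<sigma> \<in> Sigma_space" "\<sigma>' \<in> Sigma_space" and z: "norm z \<le> 1"
    and a: "\<And>ks. ks \<in> J \<Longrightarrow> norm (c ks) \<le> a" "\<And>ks. ks \<in> J \<Longrightarrow> norm (c' ks) \<le> a"
    and l: "\<And>ks. ks \<in> J \<Longrightarrow> norm (c ks - c' ks) \<le> l * d_theta \<theta> \<sigma> \<sigma>'"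
    and l0: "0 \<le> a" "0 \<le> l"
  shows "norm (wsum z J c \<sigma> - wsum z J c' \<sigma>') \<le>
     (K * D * D * a + l) * d_theta \<theta> \<sigma> \<sigma>' * wsum (norm z) J (\<lambda>_. 1) \<sigma>'"
proof -
  define m where "m = (K * D * D * a + l) * d_theta \<theta> \<sigma> \<sigma>'"
  have summ: "(\<lambda>ks. m * wterm (norm z) (\<lambda>_. 1) \<sigma>' ks) summable_on J"
    by (intro summable_on_cmult_right wterm_summable[OF J \<sigma>(2), of _ _ 1]) (use z in auto)
  have "wsum z J c \<sigma> - wsum z J c' \<sigma>' = (\<Sum>\<^sub>\<infinity>ks\<in>J. wterm z c \<sigma> ks - wterm z c' \<sigma>' ks)"
    unfolding wsum_def
    by (rule infsum_minus[symmetric, OF wterm_summable[OF J \<sigma>(1) z a(1)] wterm_summable[OF J \<sigma>(2) z a(2)]])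
  also have "norm \<dots> \<le> (\<Sum>\<^sub>\<infinity>ks\<in>J. m * wterm (norm z) (\<lambda>_. 1) \<sigma>' ks)"
  proof (rule norm_infsum_le[OF has_sum_infsum has_sum_infsum[OF summ]])
    show "(\<lambda>ks. wterm z c \<sigma> ks - wterm z c' \<sigma>' ks) summable_on J"
      by (rule summable_on_minus[OF wterm_summable[OF J \<sigma>(1) z a(1)] wterm_summable[OF J \<sigma>(2) z a(2)]])
    fix ks assume ks: "ks \<in> J"
    note set = words_set[OF J ks]
    have "wterm z c \<sigma> ks - wterm z c' \<sigma>' ks =
        z ^ sum_list ks * (of_real (weight ks \<sigma> - weight ks \<sigma>') * c ks + of_real (weight ks \<sigma>') * (c ks - c' ks))"
      by (simp add: wterm_def algebra_simps)
    then have "norm (wterm z c \<sigma> ks - wterm z c' \<sigma>' ks) \<le> norm z ^ sum_list ks *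
        (\<bar>weight ks \<sigma> - weight ks \<sigma>'\<bar> * norm (c ks) + weight ks \<sigma>' * norm (c ks - c' ks))"
      using weight_pos[OF set \<sigma>(2)]
      by (simp add: norm_mult norm_power del: of_real_diff)
         (intro mult_left_mono order_trans[OF norm_triangle_ineq], simp_all add: norm_mult del: of_real_diff)
    also have "\<dots> \<le> norm z ^ sum_list ks *
        ((K * D * D * d_theta \<theta> \<sigma> \<sigma>' * weight ks \<sigma>') * a + weight ks \<sigma>' * (l * d_theta \<theta> \<sigma> \<sigma>'))"
      using weight_diff[OF set \<sigma>] a(1)[OF ks] l[OF ks] weight_pos[OF set \<sigma>(2)] K_pos D_ge_1
        d_theta_nonneg[OF \<theta>(1), of \<sigma> \<sigma>']
      by (intro mult_left_mono add_mono mult_mono) auto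
    also have "\<dots> = m * wterm (norm z) (\<lambda>_. 1) \<sigma>' ks"
      by (simp add: m_def wterm_def algebra_simps)
    finally show "norm (wterm z c \<sigma> ks - wterm z c' \<sigma>' ks) \<le> m * wterm (norm z) (\<lambda>_. 1) \<sigma>' ks" .
  qed
  also have "\<dots> = m * wsum (norm z) J (\<lambda>_. 1) \<sigma>'"
    unfolding wsum_def by (rule infsum_cmult_right')
  finally show ?thesis
    by (simp only: m_def)
qed

section \<open>The transfer operator and its iterates as sums over words\<close>

definition transfer :: "'a::{real_normed_field,banach} \<Rightarrow> ((nat \<Rightarrow> nat) \<Rightarrow> 'a) \<Rightarrow> (nat \<Rightarrow> nat) \<Rightarrow> 'a" where
  "transfer z f \<sigma> = (\<Sum>\<^sub>\<infinity>n\<in>{1..}. z ^ n * of_real (\<psi> (prepend [n] \<sigma>)) * f (prepend [n] \<sigma>))"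

lemma transfer_eq_wsum: "transfer z f \<sigma> = wsum z (words 1) (\<lambda>ks. f (prepend ks \<sigma>)) \<sigma>"
proof -
  have "words 1 = (\<lambda>k. [k]) ` {1..}"
    by (auto simp: words_def length_Suc_conv)
  moreover have "inj_on (\<lambda>k::nat. [k]) {1..}"
    by (simp add: inj_on_def)
  ultimately show ?thesis
    unfolding transfer_def wsum_def wterm_def by (simp add: infsum_reindex o_def weight_Cons)
qed

lemma transfer_bounded:
  assumes "norm z \<le> 1" "\<And>\<sigma>. \<sigma> \<in> Sigma_space \<Longrightarrow> norm (f \<sigma>) \<le> a"
  obtains a' where "\<And>\<sigma>. \<sigma> \<in> Sigma_space \<Longrightarrow> norm (transfer z f \<sigma>) \<le> a'"
proof -
  have a: "0 \<le> a" using assms(2)[OF ones_mem] norm_ge_zero order_trans by blast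
  have "norm (transfer z f \<sigma>) \<le> (\<Sum>\<^sub>\<infinity>ks\<in>words 1. a * prod_list (map b ks))" if \<sigma>: "\<sigma> \<in> Sigma_space" for \<sigma>
    unfolding transfer_eq_wsum wsum_def
  proof (rule norm_infsum_le[OF has_sum_infsum has_sum_infsum])
    show "wterm z (\<lambda>ks. f (prepend ks \<sigma>)) \<sigma> summable_on words 1"
      by (rule wterm_summable[OF order_refl \<sigma> assms(1), where a = a])
        (auto intro!: assms(2) prepend_mem \<sigma> simp: words_def)
    show "(\<lambda>ks. a * prod_list (map b ks)) summable_on words 1"
      by (rule summable_on_cmult_right[OF prod_b_summable])
    show "norm (wterm z (\<lambda>ks. f (prepend ks \<sigma>)) \<sigma> ks) \<le> a * prod_list (map b ks)" if "ks \<in> words 1" for ks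
      using that by (intro norm_wterm_le \<sigma> assms) (auto intro!: assms(2) prepend_mem \<sigma> simp: words_def)
  qed
  then show ?thesis by (rule that)
qed

text \<open>Fubini for absolutely summable families. The new letter goes to the front of the word
  because \<open>transfer z f\<close> is evaluated at points that already begin with
  \<open>ks\<close>.\<close>

lemma wsum_transfer:
  assumes z: "norm z \<le> 1" and f: "\<And>\<sigma>. \<sigma> \<in> Sigma_space \<Longrightarrow> norm (f \<sigma>) \<le> a" and \<sigma>: "\<sigma> \<in> Sigma_space"
  shows "wsum z (words n) (\<lambda>ks. transfer z f (prepend ks \<sigma>)) \<sigma> = wsum z (words (Suc n)) (\<lambda>ks. f (prepend ks \<sigma>)) \<sigma>"
proof -
  have bnd: "norm (f (prepend ks \<sigma>)) \<le> a" if "ks \<in> words m" for ks m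
    using that by (intro f prepend_mem \<sigma>) (auto simp: words_def)
  have "wterm z (\<lambda>ks. f (prepend ks \<sigma>)) \<sigma> summable_on words (Suc n)"
    by (rule wterm_summable[OF order_refl \<sigma> z bnd])
  then have summ: "(\<lambda>(ks, k). wterm z (\<lambda>ks. f (prepend ks \<sigma>)) \<sigma> (k # ks)) summable_on (words n \<times> {1..})"
    unfolding words_Suc by (subst (asm) summable_on_reindex[OF inj_Cons_swap]) (simp add: o_def case_prod_unfold)
  have "wsum z (words (Suc n)) (\<lambda>ks. f (prepend ks \<sigma>)) \<sigma> =
      infsum (\<lambda>(ks, k). wterm z (\<lambda>ks. f (prepend ks \<sigma>)) \<sigma> (k # ks)) (words n \<times> {1..})"
    unfolding words_Suc wsum_def by (subst infsum_reindex[OF inj_Cons_swap]) (simp add: o_def case_prod_unfold)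
  also have "\<dots> = (\<Sum>\<^sub>\<infinity>ks\<in>words n. \<Sum>\<^sub>\<infinity>k\<in>{1..}. wterm z (\<lambda>ks. f (prepend ks \<sigma>)) \<sigma> (k # ks))"
    using infsum_Sigma'_banach[OF summ] by simp
  also have "\<dots> = (\<Sum>\<^sub>\<infinity>ks\<in>words n. wterm z (\<lambda>ks. transfer z f (prepend ks \<sigma>)) \<sigma> ks)"
  proof (rule infsum_cong)
    fix ks
    have "wterm z (\<lambda>ks. f (prepend ks \<sigma>)) \<sigma> (k # ks) = z ^ sum_list ks * of_real (weight ks \<sigma>) *
        (z ^ k * of_real (\<psi> (prepend [k] (prepend ks \<sigma>))) * f (prepend [k] (prepend ks \<sigma>)))" for k
      by (simp add: wterm_def weight_Cons power_add prepend_Cons[of k ks] mult_ac)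
    then have "(\<Sum>\<^sub>\<infinity>k\<in>{1..}. wterm z (\<lambda>ks. f (prepend ks \<sigma>)) \<sigma> (k # ks)) =
        z ^ sum_list ks * of_real (weight ks \<sigma>) * transfer z f (prepend ks \<sigma>)"
      by (simp only: transfer_def infsum_cmult_right')
    then show "(\<Sum>\<^sub>\<infinity>k\<in>{1..}. wterm z (\<lambda>ks. f (prepend ks \<sigma>)) \<sigma> (k # ks)) =
        wterm z (\<lambda>ks. transfer z f (prepend ks \<sigma>)) \<sigma> ks"
      by (simp only: wterm_def[of z "\<lambda>ks. transfer z f (prepend ks \<sigma>)"])
  qed
  finally show ?thesis
    unfolding wsum_def by simp
qed

end

section \<open>The Perron eigenfunction\<close>

text \<open>A form of Fekete's lemma with error bounds. Evaluating x at a product of two indices in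
  two ways shows that each (x n - c)/n is at most each x m / m; a number separating the two
  families, here the supremum of the first, is the slope.\<close>

lemma almost_additive_slope:
  fixes x :: "nat \<Rightarrow> real"
  assumes sub: "\<And>m n. x (m + n) \<le> x m + x n" and super: "\<And>m n. x m + x n \<le> x (m + n) + c"
  shows "\<exists>\<alpha>. \<forall>n. x n - c \<le> real n * \<alpha> \<and> real n * \<alpha> \<le> x n"
proof -
  have upper: "x (Suc m * n) \<le> Suc m * x n" for m n
  proof (induction m)
    case (Suc m)
    then show ?case
      using sub[of n "Suc m * n"] by (simp add: algebra_simps)
  qed simp
  have lower: "Suc m * (x n - c) \<le> x (Suc m * n) - c" for m n
  proof (induction m)
    case (Suc m)
    then show ?case
      using super[of n "Suc m * n"] by (simp add: algebra_simps)
  qed simp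
  have le: "(x (Suc n) - c) / Suc n \<le> x (Suc m) / Suc m" for m n
  proof -
    have "Suc m * (x (Suc n) - c) \<le> x (Suc m * Suc n) - c"
      by (rule lower)
    moreover have "x (Suc n * Suc m) \<le> Suc n * x (Suc m)"
      by (rule upper)
    moreover have "0 \<le> c"
      using sub[of 0 0] super[of 0 0] by simp
    ultimately have "Suc m * (x (Suc n) - c) \<le> Suc n * x (Suc m)"
      by (simp only: mult.commute[of "Suc n"])
    then show ?thesis
      by (simp add: divide_simps mult.commute)
  qed
  define \<alpha> where "\<alpha> = (SUP n. (x (Suc n) - c) / Suc n)"
  have bdd: "bdd_above (range (\<lambda>n. (x (Suc n) - c) / Suc n))"
    using le[of _ 0] by (auto intro!: bdd_aboveI[of _ "x (Suc 0) / Suc 0"])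
  have "x n - c \<le> real n * \<alpha> \<and> real n * \<alpha> \<le> x n" for n
  proof (cases n)
    case 0
    then show ?thesis
      using sub[of 0 0] super[of 0 0] by simp
  next
    case (Suc k)
    have "(x (Suc k) - c) / Suc k \<le> \<alpha>"
      unfolding \<alpha>_def by (rule cSUP_upper[OF UNIV_I bdd])
    moreover have "\<alpha> \<le> x (Suc k) / Suc k"
      unfolding \<alpha>_def by (rule cSUP_least) (simp, rule le)
    ultimately show ?thesis
      unfolding Suc by (auto simp: field_simps)
  qed
  then show ?thesis by blast
qed

context induced_weight
begin

lemma words_prepend_mem: "ks \<in> words n \<Longrightarrow> \<sigma> \<in> Sigma_space \<Longrightarrow> prepend ks \<sigma> \<in> Sigma_space"
  by (rule prepend_mem) (auto simp: words_def)

lemma transfer_cong: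
  assumes "\<And>\<sigma>. \<sigma> \<in> Sigma_space \<Longrightarrow> f \<sigma> = g \<sigma>" "\<sigma> \<in> Sigma_space"
  shows "transfer z f \<sigma> = transfer z g \<sigma>"
  unfolding transfer_def using assms by (intro infsum_cong) (simp add: prepend_single_mem)

lemma transfer_iterate:
  assumes z: "norm z \<le> 1" and f: "\<And>\<sigma>. \<sigma> \<in> Sigma_space \<Longrightarrow> norm (f \<sigma>) \<le> a" and \<sigma>: "\<sigma> \<in> Sigma_space"
  shows "(transfer z ^^ n) f \<sigma> = wsum z (words n) (\<lambda>ks. f (prepend ks \<sigma>)) \<sigma>"
  using f
proof (induction n arbitrary: f a)
  case 0
  show ?case by (simp add: wsum_def wterm_def words_0)
next
  case (Suc n)
  obtain a' where "\<And>\<sigma>. \<sigma> \<in> Sigma_space \<Longrightarrow> norm (transfer z f \<sigma>) \<le> a'"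
    by (rule transfer_bounded[of z f a]) (use z Suc.prems in auto)
  from Suc.IH[OF this] have "(transfer z ^^ Suc n) f \<sigma> = wsum z (words n) (\<lambda>ks. transfer z f (prepend ks \<sigma>)) \<sigma>"
    by (simp only: funpow_Suc_right comp_apply)
  also have "\<dots> = wsum z (words (Suc n)) (\<lambda>ks. f (prepend ks \<sigma>)) \<sigma>"
    by (rule wsum_transfer[OF z Suc.prems \<sigma>])
  finally show ?case .
qed

lemma transfer_abs_summable:
  fixes z :: "'a::{real_normed_field,banach}"
  assumes z: "norm z \<le> 1" and f: "\<And>\<sigma>. \<sigma> \<in> Sigma_space \<Longrightarrow> norm (f \<sigma>) \<le> a" and \<sigma>: "\<sigma> \<in> Sigma_space"
  shows "(\<lambda>n. norm (z ^ n * of_real (\<psi> (prepend [n] \<sigma>)) * f (prepend [n] \<sigma>))) summable_on {1..}"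
proof -
  have bnd: "norm (f (prepend ks \<sigma>)) \<le> a" if "ks \<in> words m" for ks m
    by (rule f[OF words_prepend_mem[OF that \<sigma>]])
  have words1: "words 1 = (\<lambda>k. [k]) ` {1..}"
    by (auto simp: words_def length_Suc_conv)
  have "(\<lambda>ks. norm (wterm z (\<lambda>ks. f (prepend ks \<sigma>)) \<sigma> ks)) summable_on words 1"
    by (rule wterm_abs_summable[OF order_refl \<sigma> z bnd])
  then show ?thesis
    unfolding words1 by (subst (asm) summable_on_reindex) (auto simp: inj_on_def o_def wterm_def weight_Cons)
qed

lemma transfer_has_sum:
  assumes z: "norm z \<le> 1" and f: "\<And>\<sigma>. \<sigma> \<in> Sigma_space \<Longrightarrow> norm (f \<sigma>) \<le> a" and \<sigma>: "\<sigma> \<in> Sigma_space"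
  shows "((\<lambda>n. z ^ n * of_real (\<psi> (prepend [n] \<sigma>)) * f (prepend [n] \<sigma>)) has_sum transfer z f \<sigma>) {1..}"
  unfolding transfer_def by (rule has_sum_infsum[OF abs_summable_summable[OF transfer_abs_summable[OF assms]]])

lemma transfer_sums:
  assumes z: "norm z \<le> 1" and f: "\<And>\<sigma>. \<sigma> \<in> Sigma_space \<Longrightarrow> norm (f \<sigma>) \<le> a" and \<sigma>: "\<sigma> \<in> Sigma_space"
  shows "(\<lambda>k. z ^ Suc k * of_real (\<psi> (prepend [Suc k] \<sigma>)) * f (prepend [Suc k] \<sigma>)) sums transfer z f \<sigma>"
proof -
  note transfer_has_sum[OF assms]
  moreover have "{1..} = range Suc"
    by (auto simp: image_iff Suc_le_eq gr0_conv_Suc)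
  ultimately show ?thesis
    by (intro has_sum_imp_sums) (simp add: has_sum_reindex o_def)
qed

lemma b_Suc_summable: "summable (\<lambda>k. b (Suc k))"
proof -
  have "{1..} = range Suc"
    by (auto simp: image_iff Suc_le_eq gr0_conv_Suc)
  with b_summable have "(\<lambda>k. b (Suc k)) summable_on UNIV"
    by (simp add: summable_on_reindex o_def)
  then show ?thesis by (rule summable_on_imp_summable)
qed

text \<open>Dominated convergence for series, with majorant b (k+1) times a. Pointwise limits
  suffice, and the construction of the eigenfunction yields no others.\<close>

lemma transfer_tendsto:
  fixes F :: "nat \<Rightarrow> (nat \<Rightarrow> nat) \<Rightarrow> 'a::{real_normed_field,banach}"
  assumes z: "norm z \<le> 1" and F: "\<And>n \<sigma>. \<sigma> \<in> Sigma_space \<Longrightarrow> norm (F n \<sigma>) \<le> a"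
    and lim: "\<And>\<sigma>. \<sigma> \<in> Sigma_space \<Longrightarrow> (\<lambda>n. F n \<sigma>) \<longlonglongrightarrow> f \<sigma>" and \<sigma>: "\<sigma> \<in> Sigma_space"
  shows "(\<lambda>n. transfer z (F n) \<sigma>) \<longlonglongrightarrow> transfer z f \<sigma>"
proof -
  have f: "norm (f \<sigma>) \<le> a" if "\<sigma> \<in> Sigma_space" for \<sigma>
    using tendsto_norm[OF lim[OF that]] by (rule LIMSEQ_le_const2) (use F[OF that] in auto)
  have a: "0 \<le> a"
    using f[OF ones_mem] norm_ge_zero order_trans by blast
  have mem: "prepend [Suc k] \<sigma> \<in> Sigma_space" for k
    by (rule prepend_single_mem[OF _ \<sigma>]) simp
  have "norm (z ^ Suc k * of_real (\<psi> (prepend [Suc k] \<sigma>)) * F n (prepend [Suc k] \<sigma>)) \<le> b (Suc k) * a" for k n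
  proof -
    have "norm (z ^ Suc k * of_real (\<psi> (prepend [Suc k] \<sigma>)) * F n (prepend [Suc k] \<sigma>)) =
        norm z ^ Suc k * \<psi> (prepend [Suc k] \<sigma>) * norm (F n (prepend [Suc k] \<sigma>))"
      using \<psi>_pos[OF mem[of k]] by (simp add: norm_mult norm_power)
    also have "\<dots> \<le> 1 * b (Suc k) * a"
      using \<psi>_le[OF \<sigma>, of "Suc k"] \<psi>_pos[OF mem[of k]] F[OF mem[of k], of n] a z b_nonneg[of "Suc k"]
      by (intro mult_mono power_le_one) auto
    finally show ?thesis by simp
  qed
  then have "eventually (\<lambda>(k, n). norm (z ^ Suc k * of_real (\<psi> (prepend [Suc k] \<sigma>)) * F n (prepend [Suc k] \<sigma>)) \<le>
      b (Suc k) * a) (at_top \<times>\<^sub>F sequentially)"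
    by (intro always_eventually) auto
  moreover have "(\<lambda>n. z ^ Suc k * of_real (\<psi> (prepend [Suc k] \<sigma>)) * F n (prepend [Suc k] \<sigma>)) \<longlonglongrightarrow>
      z ^ Suc k * of_real (\<psi> (prepend [Suc k] \<sigma>)) * f (prepend [Suc k] \<sigma>)" for k
    by (intro tendsto_mult_left lim[OF mem])
  ultimately have "(\<lambda>n. \<Sum>k. z ^ Suc k * of_real (\<psi> (prepend [Suc k] \<sigma>)) * F n (prepend [Suc k] \<sigma>)) \<longlonglongrightarrow>
      (\<Sum>k. z ^ Suc k * of_real (\<psi> (prepend [Suc k] \<sigma>)) * f (prepend [Suc k] \<sigma>))"
    using tannerys_theorem[of "\<lambda>k n. z ^ Suc k * of_real (\<psi> (prepend [Suc k] \<sigma>)) * F n (prepend [Suc k] \<sigma>)"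
        "\<lambda>k. z ^ Suc k * of_real (\<psi> (prepend [Suc k] \<sigma>)) * f (prepend [Suc k] \<sigma>)" sequentially
        "\<lambda>k. b (Suc k) * a"] summable_mult2[OF b_Suc_summable] trivial_limit_sequentially
    by blast
  moreover have "(\<Sum>k. z ^ Suc k * of_real (\<psi> (prepend [Suc k] \<sigma>)) * F n (prepend [Suc k] \<sigma>)) = transfer z (F n) \<sigma>" for n
    by (rule sums_unique[OF transfer_sums[OF z F \<sigma>], symmetric])
  moreover have "(\<Sum>k. z ^ Suc k * of_real (\<psi> (prepend [Suc k] \<sigma>)) * f (prepend [Suc k] \<sigma>)) = transfer z f \<sigma>"
    by (rule sums_unique[OF transfer_sums[OF z f \<sigma>], symmetric])
  ultimately show ?thesis
    by (simp only:)
qed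

lemma transfer_cmult: "transfer z (\<lambda>\<sigma>. c * f \<sigma>) \<sigma> = c * transfer z f \<sigma>"
  unfolding transfer_eq_wsum by (rule wsum_cmult)

lemma wterm_le_wsum:
  fixes r :: real
  assumes J: "J \<subseteq> words n" and \<sigma>: "\<sigma> \<in> Sigma_space" and r: "0 \<le> r" "r \<le> 1"
    and c: "\<And>ks. ks \<in> J \<Longrightarrow> 0 \<le> c ks" "\<And>ks. ks \<in> J \<Longrightarrow> c ks \<le> a" and ks: "ks \<in> J"
  shows "wterm r c \<sigma> ks \<le> wsum r J c \<sigma>"
proof -
  have "sum (wterm r c \<sigma>) {ks} \<le> infsum (wterm r c \<sigma>) J"
  proof (rule finite_sum_le_infsum)
    show "wterm r c \<sigma> summable_on J"
      by (rule wterm_summable[OF J \<sigma>, of _ _ a]) (use r c in auto)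
    show "0 \<le> wterm r c \<sigma> x" if "x \<in> J - {ks}" for x
      using that weight_pos[OF words_set[OF J] \<sigma>, of x] r c unfolding wterm_def by auto
  qed (use ks in auto)
  then show ?thesis by (simp add: wsum_def)
qed

text \<open>Positive functions whose logarithm is Lipschitz with constant \<open>K\<close>. One
  application of the operator turns a constant K' into C \<theta> + \<theta> K', and
  \<open>K\<close> is the fixed point of this map. The cone is also stable under suprema and
  positive limits.\<close>

definition cone :: "((nat \<Rightarrow> nat) \<Rightarrow> real) \<Rightarrow> bool" where
  "cone f \<longleftrightarrow> (\<forall>\<sigma>\<in>Sigma_space. 0 < f \<sigma> \<and> (\<forall>\<sigma>'\<in>Sigma_space. f \<sigma> \<le> exp (K * d_theta \<theta> \<sigma> \<sigma>') * f \<sigma>'))"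

lemma cone_pos: "cone f \<Longrightarrow> \<sigma> \<in> Sigma_space \<Longrightarrow> 0 < f \<sigma>"
  and cone_le: "cone f \<Longrightarrow> \<sigma> \<in> Sigma_space \<Longrightarrow> \<sigma>' \<in> Sigma_space \<Longrightarrow> f \<sigma> \<le> exp (K * d_theta \<theta> \<sigma> \<sigma>') * f \<sigma>'"
  by (auto simp: cone_def)

lemma cone_le_D:
  assumes "cone f" "\<sigma> \<in> Sigma_space" "\<sigma>' \<in> Sigma_space"
  shows "f \<sigma> \<le> D * f \<sigma>'"
  using cone_le[OF assms] mult_right_mono[OF exp_K_le_D, of "f \<sigma>'" \<sigma> \<sigma>'] cone_pos[OF assms(1,3)]
  by linarith

lemma cone_bounded: "cone f \<Longrightarrow> \<sigma> \<in> Sigma_space \<Longrightarrow> norm (f \<sigma>) \<le> D * f (\<lambda>_. 1)"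
  using cone_le_D[OF _ _ ones_mem] cone_pos by force

lemma cone_const: "0 < c \<Longrightarrow> cone (\<lambda>_. c)"
  using K_pos d_theta_nonneg[OF \<theta>(1)] by (simp add: cone_def)

lemma cone_cmult: "0 < c \<Longrightarrow> cone f \<Longrightarrow> cone (\<lambda>\<sigma>. c * f \<sigma>)"
  unfolding cone_def by (auto simp: mult_ac)

lemma cone_cong: "cone f \<Longrightarrow> (\<And>\<sigma>. \<sigma> \<in> Sigma_space \<Longrightarrow> f \<sigma> = g \<sigma>) \<Longrightarrow> cone g"
  by (simp add: cone_def)

lemma cone_limit:
  assumes f: "\<And>n. cone (f n)" and lim: "\<And>\<sigma>. \<sigma> \<in> Sigma_space \<Longrightarrow> (\<lambda>n. f n \<sigma>) \<longlonglongrightarrow> g \<sigma>"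
    and pos: "\<And>\<sigma>. \<sigma> \<in> Sigma_space \<Longrightarrow> 0 < g \<sigma>"
  shows "cone g"
  unfolding cone_def
proof (intro ballI conjI)
  fix \<sigma> \<sigma>' assume \<sigma>: "\<sigma> \<in> Sigma_space" "\<sigma>' \<in> Sigma_space"
  show "g \<sigma> \<le> exp (K * d_theta \<theta> \<sigma> \<sigma>') * g \<sigma>'"
    by (rule LIMSEQ_le[OF lim[OF \<sigma>(1)] tendsto_mult_left[OF lim[OF \<sigma>(2)]]])
      (use cone_le[OF f \<sigma>] in auto)
qed (rule pos)

lemma cone_SUP:
  fixes f :: "nat \<Rightarrow> (nat \<Rightarrow> nat) \<Rightarrow> real"
  assumes f: "\<And>n. n \<in> I \<Longrightarrow> cone (f n)" and I: "I \<noteq> {}"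
    and bnd: "\<And>n \<sigma>. n \<in> I \<Longrightarrow> \<sigma> \<in> Sigma_space \<Longrightarrow> f n \<sigma> \<le> B"
  shows "cone (\<lambda>\<sigma>. SUP n\<in>I. f n \<sigma>)"
  unfolding cone_def
proof (intro ballI conjI)
  have bdd: "bdd_above ((\<lambda>n. f n \<sigma>) ` I)" if "\<sigma> \<in> Sigma_space" for \<sigma>
    using bnd[OF _ that] by (auto intro!: bdd_aboveI[of _ B])
  fix \<sigma> assume \<sigma>: "\<sigma> \<in> Sigma_space"
  obtain i where i: "i \<in> I" using I by blast
  have "f i \<sigma> \<le> (SUP n\<in>I. f n \<sigma>)"
    by (rule cSUP_upper[OF i bdd[OF \<sigma>]])
  with cone_pos[OF f[OF i] \<sigma>] show "0 < (SUP n\<in>I. f n \<sigma>)" by linarith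
  fix \<sigma>' assume \<sigma>': "\<sigma>' \<in> Sigma_space"
  show "(SUP n\<in>I. f n \<sigma>) \<le> exp (K * d_theta \<theta> \<sigma> \<sigma>') * (SUP n\<in>I. f n \<sigma>')"
  proof (rule cSUP_least[OF I])
    fix n assume n: "n \<in> I"
    have "f n \<sigma> \<le> exp (K * d_theta \<theta> \<sigma> \<sigma>') * f n \<sigma>'"
      by (rule cone_le[OF f[OF n] \<sigma> \<sigma>'])
    also have "\<dots> \<le> exp (K * d_theta \<theta> \<sigma> \<sigma>') * (SUP n\<in>I. f n \<sigma>')"
      by (intro mult_left_mono cSUP_upper[OF n bdd[OF \<sigma>']]) auto
    finally show "f n \<sigma> \<le> exp (K * d_theta \<theta> \<sigma> \<sigma>') * (SUP n\<in>I. f n \<sigma>')" .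
  qed
qed

end

section \<open>Growth rate and eigenfunction of the positive operator\<close>

locale positive_transfer = induced_weight +
  fixes r :: real
  assumes r: "0 < r" "r \<le> 1"
begin

lemma norm_r: "norm r \<le> 1" using r by simp

lemma transfer_mono:
  assumes "\<And>\<sigma>. \<sigma> \<in> Sigma_space \<Longrightarrow> \<bar>f \<sigma>\<bar> \<le> a" "\<And>\<sigma>. \<sigma> \<in> Sigma_space \<Longrightarrow> \<bar>g \<sigma>\<bar> \<le> a'"
    "\<And>\<sigma>. \<sigma> \<in> Sigma_space \<Longrightarrow> f \<sigma> \<le> g \<sigma>" and \<sigma>: "\<sigma> \<in> Sigma_space"
  shows "transfer r f \<sigma> \<le> transfer r g \<sigma>"
  unfolding transfer_eq_wsum
  by (rule wsum_mono[OF order_refl \<sigma>]) (use r in \<open>auto intro!: assms words_prepend_mem[OF _ \<sigma>]\<close>)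

text \<open>The weight of a letter contributes the exponent K (1 - \<theta>). The function
  contributes K \<theta>, as its arguments have moved closer by \<theta>. The sum is K. Positivity
  is visible from the single word \<open>[1]\<close>.\<close>

lemma cone_transfer:
  assumes f: "cone f"
  shows "cone (transfer r f)"
  unfolding cone_def
proof (intro ballI conjI)
  define a where "a = D * f (\<lambda>_. 1)"
  fix \<sigma> assume \<sigma>: "\<sigma> \<in> Sigma_space"
  have c: "0 \<le> f (prepend ks \<sigma>)" "f (prepend ks \<sigma>) \<le> a" if "ks \<in> words 1" "\<sigma> \<in> Sigma_space" for ks \<sigma>
    using cone_pos[OF f words_prepend_mem[OF that]] cone_bounded[OF f words_prepend_mem[OF that]]
    by (auto simp: a_def)
  have one: "[1] \<in> words 1" by (simp add: words_def)
  have "0 < wterm r (\<lambda>ks. f (prepend ks \<sigma>)) \<sigma> [1]"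
    unfolding wterm_def using r weight_pos[of "[1]" \<sigma>] cone_pos[OF f words_prepend_mem[OF one \<sigma>]] \<sigma> by simp
  also have "\<dots> \<le> transfer r f \<sigma>"
    unfolding transfer_eq_wsum
    by (rule wterm_le_wsum[OF order_refl \<sigma>, where a = a]) (use r c \<sigma> one in auto)
  finally show "0 < transfer r f \<sigma>" .
  fix \<sigma>' assume \<sigma>': "\<sigma>' \<in> Sigma_space"
  have summ: "wterm r (\<lambda>ks. f (prepend ks \<sigma>)) \<sigma> summable_on words 1" if "\<sigma> \<in> Sigma_space" for \<sigma>
    by (rule wterm_summable[OF order_refl that norm_r, where a = a]) (use c that in force)
  have "transfer r f \<sigma> \<le> (\<Sum>\<^sub>\<infinity>ks\<in>words 1. exp (K * d_theta \<theta> \<sigma> \<sigma>') * wterm r (\<lambda>ks. f (prepend ks \<sigma>')) \<sigma>' ks)"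
    unfolding transfer_eq_wsum wsum_def
  proof (rule infsum_mono[OF summ[OF \<sigma>] summable_on_cmult_right[OF summ[OF \<sigma>']]])
    fix ks assume ks: "ks \<in> words 1"
    then have set: "set ks \<subseteq> {1..}" and len: "length ks = 1" by (auto simp: words_def)
    have "wterm r (\<lambda>ks. f (prepend ks \<sigma>)) \<sigma> ks \<le> r ^ sum_list ks *
        (exp (K * (1 - \<theta>) * d_theta \<theta> \<sigma> \<sigma>') * weight ks \<sigma>') * (exp (K * (\<theta> * d_theta \<theta> \<sigma> \<sigma>')) * f (prepend ks \<sigma>'))"
      unfolding wterm_def
      using weight_distortion'[OF set \<sigma> \<sigma>'] weight_pos[OF set \<sigma>] weight_pos[OF set \<sigma>'] r c[OF ks]
        cone_le[OF f words_prepend_mem[OF ks \<sigma>] words_prepend_mem[OF ks \<sigma>']] len \<sigma> \<sigma>'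
      by (intro mult_mono) (auto simp: d_theta_prepend)
    also have "\<dots> = exp (K * (1 - \<theta>) * d_theta \<theta> \<sigma> \<sigma>' + K * (\<theta> * d_theta \<theta> \<sigma> \<sigma>')) * wterm r (\<lambda>ks. f (prepend ks \<sigma>')) \<sigma>' ks"
      by (simp add: wterm_def exp_add mult_ac)
    also have "K * (1 - \<theta>) * d_theta \<theta> \<sigma> \<sigma>' + K * (\<theta> * d_theta \<theta> \<sigma> \<sigma>') = K * d_theta \<theta> \<sigma> \<sigma>'"
      by (simp add: algebra_simps)
    finally show "wterm r (\<lambda>ks. f (prepend ks \<sigma>)) \<sigma> ks \<le> exp (K * d_theta \<theta> \<sigma> \<sigma>') * wterm r (\<lambda>ks. f (prepend ks \<sigma>')) \<sigma>' ks" .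
  qed
  also have "\<dots> = exp (K * d_theta \<theta> \<sigma> \<sigma>') * transfer r f \<sigma>'"
    unfolding transfer_eq_wsum wsum_def by (rule infsum_cmult_right')
  finally show "transfer r f \<sigma> \<le> exp (K * d_theta \<theta> \<sigma> \<sigma>') * transfer r f \<sigma>'" .
qed

definition iter :: "nat \<Rightarrow> (nat \<Rightarrow> nat) \<Rightarrow> real" where
  "iter n = (transfer r ^^ n) (\<lambda>_. 1)"

lemma iter_0: "iter 0 \<sigma> = 1" and iter_Suc: "iter (Suc n) = transfer r (iter n)"
  by (simp_all add: iter_def)

lemma cone_iter: "cone (iter n)"
proof (induction n)
  case 0
  show ?case by (rule cone_cong[OF cone_const[of 1]]) (simp_all add: iter_0)
qed (simp add: iter_Suc cone_transfer)

lemma iter_eq_wsum: "\<sigma> \<in> Sigma_space \<Longrightarrow> iter n \<sigma> = wsum r (words n) (\<lambda>_. 1) \<sigma>"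
  unfolding iter_def using transfer_iterate[OF norm_r, of "\<lambda>_. 1" 1 \<sigma> n] by simp

lemma iter_add:
  assumes \<sigma>: "\<sigma> \<in> Sigma_space"
  shows "iter (m + n) \<sigma> = wsum r (words m) (\<lambda>ks. iter n (prepend ks \<sigma>)) \<sigma>"
  using transfer_iterate[of r "iter n" "D * iter n (\<lambda>_. 1)" \<sigma> m, OF norm_r cone_bounded[OF cone_iter] \<sigma>]
  by (simp only: iter_def funpow_add comp_apply)

text \<open>For the induced potential this is \<open>Lambda_n V n r\<close>, the quantity whose
  exponential growth is the pressure.\<close>

definition Lam :: "nat \<Rightarrow> real" where
  "Lam n = (SUP \<sigma>\<in>Sigma_space. iter n \<sigma>)"

lemma iter_le_Lam: "\<sigma> \<in> Sigma_space \<Longrightarrow> iter n \<sigma> \<le> Lam n"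
  unfolding Lam_def
proof (rule cSUP_upper)
  show "bdd_above (iter n ` Sigma_space)"
    by (rule bdd_aboveI2[where M = "D * iter n (\<lambda>_. 1)"]) (rule cone_le_D[OF cone_iter _ ones_mem])
qed

lemma Lam_le: "\<sigma> \<in> Sigma_space \<Longrightarrow> Lam n \<le> D * iter n \<sigma>"
  unfolding Lam_def by (rule cSUP_least[OF Sigma_space_nonempty]) (rule cone_le_D[OF cone_iter])

lemma Lam_pos: "0 < Lam n"
  using iter_le_Lam[OF ones_mem, of n] cone_pos[OF cone_iter ones_mem, of n] by linarith

lemma Lam_submult: "Lam (m + n) \<le> Lam m * Lam n"
  unfolding Lam_def[of "m + n"]
proof (rule cSUP_least[OF Sigma_space_nonempty])
  fix \<sigma> assume \<sigma>: "\<sigma> \<in> Sigma_space"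
  have "\<bar>iter n (prepend ks \<sigma>)\<bar> \<le> Lam n" if "ks \<in> words m" for ks
    using iter_le_Lam[OF words_prepend_mem[OF that \<sigma>], of n]
      cone_pos[OF cone_iter words_prepend_mem[OF that \<sigma>], of n] by simp
  then have "iter (m + n) \<sigma> \<le> Lam n * wsum r (words m) (\<lambda>_. 1) \<sigma>"
    unfolding iter_add[OF \<sigma>] by (intro wsum_const_le[OF order_refl \<sigma>]) (use r in auto)
  also have "\<dots> \<le> Lam n * Lam m"
    unfolding iter_eq_wsum[OF \<sigma>, symmetric]
    using iter_le_Lam[OF \<sigma>] Lam_pos[of n] by (intro mult_left_mono) auto
  finally show "iter (m + n) \<sigma> \<le> Lam m * Lam n" by (simp add: mult.commute)
qed

text \<open>Bounded distortion makes the n-step sum at every prolonged point at least Lam n / D,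
  whatever word of length m has been prepended.\<close>

lemma Lam_supermult: "Lam m * Lam n \<le> D * Lam (m + n)"
proof -
  have "iter m \<sigma> \<le> D * Lam (m + n) / Lam n" if \<sigma>: "\<sigma> \<in> Sigma_space" for \<sigma>
  proof -
    have "Lam n * iter m \<sigma> = wsum r (words m) (\<lambda>_. Lam n * 1) \<sigma>"
      unfolding wsum_cmult iter_eq_wsum[OF \<sigma>] ..
    also have "\<dots> \<le> wsum r (words m) (\<lambda>ks. D * iter n (prepend ks \<sigma>)) \<sigma>"
    proof (rule wsum_mono[OF order_refl \<sigma>])
      fix ks assume ks: "ks \<in> words m"
      show "Lam n * 1 \<le> D * iter n (prepend ks \<sigma>)"
        using Lam_le[OF words_prepend_mem[OF ks \<sigma>]] by simp
      show "\<bar>Lam n * 1\<bar> \<le> Lam n" using Lam_pos[of n] by simp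
      show "\<bar>D * iter n (prepend ks \<sigma>)\<bar> \<le> D * Lam n"
        using iter_le_Lam[OF words_prepend_mem[OF ks \<sigma>], of n]
          cone_pos[OF cone_iter words_prepend_mem[OF ks \<sigma>], of n] D_ge_1
        by (simp add: abs_mult)
    qed (use r in auto)
    also have "\<dots> = D * iter (m + n) \<sigma>"
      unfolding wsum_cmult iter_add[OF \<sigma>] ..
    also have "\<dots> \<le> D * Lam (m + n)"
      using iter_le_Lam[OF \<sigma>] D_ge_1 by (intro mult_left_mono) auto
    finally show ?thesis
      using Lam_pos[of n] by (simp add: field_simps)
  qed
  then have "Lam m \<le> D * Lam (m + n) / Lam n"
    unfolding Lam_def[of m] by (rule cSUP_least[OF Sigma_space_nonempty])
  then show ?thesis
    using Lam_pos[of n] by (simp add: field_simps)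
qed

lemma growth_rate:
  obtains \<rho> where "0 < \<rho>" "\<And>n. \<rho> ^ n \<le> Lam n" "\<And>n. Lam n \<le> D * \<rho> ^ n"
proof -
  have "\<exists>\<alpha>. \<forall>n. ln (Lam n) - K \<le> real n * \<alpha> \<and> real n * \<alpha> \<le> ln (Lam n)"
  proof (rule almost_additive_slope)
    show "ln (Lam (m + n)) \<le> ln (Lam m) + ln (Lam n)" for m n
      using Lam_submult[of m n] Lam_pos by (simp flip: ln_mult_pos)
    show "ln (Lam m) + ln (Lam n) \<le> ln (Lam (m + n)) + K" for m n
    proof -
      have "ln (Lam m * Lam n) \<le> ln (D * Lam (m + n))"
        using Lam_supermult[of m n] Lam_pos D_ge_1 by (subst ln_le_cancel_iff) (auto simp: zero_less_mult_iff)
      then show ?thesis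
        using Lam_pos D_ge_1 by (simp add: ln_mult_pos D_def)
    qed
  qed
  then obtain \<alpha> where \<alpha>: "\<And>n. ln (Lam n) - K \<le> real n * \<alpha>" "\<And>n. real n * \<alpha> \<le> ln (Lam n)"
    by blast
  have pow: "exp \<alpha> ^ n = exp (real n * \<alpha>)" for n
    by (simp add: exp_of_nat_mult)
  show ?thesis
  proof (rule that)
    show "exp \<alpha> ^ n \<le> Lam n" for n
      unfolding pow using \<alpha>(2)[of n] Lam_pos[of n] by (metis exp_le_cancel_iff exp_ln)
    show "Lam n \<le> D * exp \<alpha> ^ n" for n
    proof -
      have "exp (ln (Lam n)) \<le> exp (K + real n * \<alpha>)"
        using \<alpha>(1)[of n] by simp
      then show ?thesis
        unfolding pow D_def using Lam_pos[of n] by (simp add: exp_add)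
    qed
  qed simp
qed

theorem eigenfunction_exists:
  obtains \<rho> h where "0 < \<rho>" "cone h" "\<And>\<sigma>. \<sigma> \<in> Sigma_space \<Longrightarrow> transfer r h \<sigma> = \<rho> * h \<sigma>"
proof -
  obtain \<rho> where \<rho>: "0 < \<rho>" and low: "\<And>n. \<rho> ^ n \<le> Lam n" and up: "\<And>n. Lam n \<le> D * \<rho> ^ n"
    by (rule growth_rate) blast
  have D0: "0 < D" using D_ge_1 by linarith
  \<comment> \<open>Distortion and the two-sided growth of \<open>Lam\<close> keep every
    \<open>u n\<close> between 1/D and D, so that the limits below stay positive and finite.\<close>
  define u where "u n \<sigma> = iter n \<sigma> / \<rho> ^ n" for n \<sigma>
  have u_cone: "cone (u n)" for n
    using cone_cmult[OF _ cone_iter, of "1 / \<rho> ^ n" n] \<rho> by (simp add: u_def[abs_def])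
  have u_up: "u n \<sigma> \<le> D" if "\<sigma> \<in> Sigma_space" for n \<sigma>
    using iter_le_Lam[OF that, of n] up[of n] \<rho> by (simp add: u_def field_simps)
  have u_low: "1 / D \<le> u n \<sigma>" if "\<sigma> \<in> Sigma_space" for n \<sigma>
  proof -
    have "\<rho> ^ n \<le> D * iter n \<sigma>" using low[of n] Lam_le[OF that, of n] by linarith
    then show ?thesis using \<rho> D0 by (simp add: u_def field_simps)
  qed
  have u_Suc: "transfer r (u n) \<sigma> = \<rho> * u (Suc n) \<sigma>" for n \<sigma>
    using transfer_cmult[of r "1 / \<rho> ^ n" "iter n" \<sigma>] \<rho> by (simp add: u_def[abs_def] iter_Suc)
  define v where "v k \<sigma> = (SUP n\<in>{k..}. u n \<sigma>)" for k \<sigma>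
  have bdd: "bdd_above ((\<lambda>n. u n \<sigma>) ` {k..})" if "\<sigma> \<in> Sigma_space" for \<sigma> k
    using u_up[OF that] by (auto intro!: bdd_aboveI[of _ D])
  have v_cone: "cone (v k)" for k
    unfolding v_def[abs_def] by (rule cone_SUP[OF u_cone _ u_up]) auto
  have v_up: "v k \<sigma> \<le> D" if "\<sigma> \<in> Sigma_space" for k \<sigma>
    unfolding v_def by (rule cSUP_least) (use u_up[OF that] in auto)
  have v_low: "1 / D \<le> v k \<sigma>" if "\<sigma> \<in> Sigma_space" for k \<sigma>
    unfolding v_def by (rule order_trans[OF u_low[OF that, of k] cSUP_upper[OF _ bdd[OF that]]]) simp
  have v_dec: "v (Suc k) \<sigma> \<le> v k \<sigma>" if "\<sigma> \<in> Sigma_space" for k \<sigma>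
    unfolding v_def by (rule cSUP_subset_mono[OF _ bdd[OF that]]) auto
  have v_abs: "\<bar>v k \<sigma>\<bar> \<le> D" if "\<sigma> \<in> Sigma_space" for k \<sigma>
    using v_up[OF that, of k] cone_pos[OF v_cone that, of k] by simp
  \<comment> \<open>Positivity yields an inequality only: the operator applied to a supremum
    dominates the supremum of the images. The index moves by one because the image of
    \<open>u m\<close> is a multiple of \<open>u (Suc m)\<close>.\<close>
  have v_step: "\<rho> * v (Suc k) \<sigma> \<le> transfer r (v k) \<sigma>" if \<sigma>: "\<sigma> \<in> Sigma_space" for k \<sigma>
  proof -
    have "u n \<sigma> \<le> transfer r (v k) \<sigma> / \<rho>" if n: "Suc k \<le> n" for n
    proof -
      obtain m where m: "n = Suc m" "k \<le> m" using n by (cases n) auto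
      have "transfer r (u m) \<sigma> \<le> transfer r (v k) \<sigma>"
      proof (rule transfer_mono[OF _ v_abs _ \<sigma>])
        show "\<bar>u m \<sigma>\<bar> \<le> D" if "\<sigma> \<in> Sigma_space" for \<sigma>
          using u_up[OF that, of m] cone_pos[OF u_cone that, of m] by simp
        show "u m \<sigma> \<le> v k \<sigma>" if "\<sigma> \<in> Sigma_space" for \<sigma>
          unfolding v_def by (rule cSUP_upper[OF _ bdd[OF that]]) (use m in auto)
      qed
      then show ?thesis
        using \<rho> m by (simp add: u_Suc field_simps)
    qed
    then have "v (Suc k) \<sigma> \<le> transfer r (v k) \<sigma> / \<rho>"
      unfolding v_def[of "Suc k"] by (rule cSUP_least[rotated]) auto
    then show ?thesis using \<rho> by (simp add: field_simps)
  qed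
  define w where "w \<sigma> = lim (\<lambda>k. v k \<sigma>)" for \<sigma>
  have w_lim: "(\<lambda>k. v k \<sigma>) \<longlonglongrightarrow> w \<sigma>" if "\<sigma> \<in> Sigma_space" for \<sigma>
  proof -
    have "decseq (\<lambda>k. v k \<sigma>)" by (rule decseq_SucI) (rule v_dec[OF that])
    moreover have "\<forall>k. 1 / D \<le> v k \<sigma>"
      using v_low[OF that] by blast
    ultimately obtain L where "(\<lambda>k. v k \<sigma>) \<longlonglongrightarrow> L"
      by (rule decseq_convergent)
    then show ?thesis unfolding w_def by (simp add: limI)
  qed
  have w_low: "1 / D \<le> w \<sigma>" if "\<sigma> \<in> Sigma_space" for \<sigma>
    by (rule LIMSEQ_le_const[OF w_lim[OF that]]) (use v_low[OF that] in auto)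
  have w_up: "w \<sigma> \<le> D" if "\<sigma> \<in> Sigma_space" for \<sigma>
    by (rule LIMSEQ_le_const2[OF w_lim[OF that]]) (use v_up[OF that] in auto)
  have w_cone: "cone w"
    by (rule cone_limit[OF v_cone w_lim]) (use w_low D0 in \<open>auto intro: less_le_trans[of 0 "1 / D"]\<close>)
  have w_step: "\<rho> * w \<sigma> \<le> transfer r w \<sigma>" if \<sigma>: "\<sigma> \<in> Sigma_space" for \<sigma>
  proof (rule LIMSEQ_le)
    show "(\<lambda>k. \<rho> * v (Suc k) \<sigma>) \<longlonglongrightarrow> \<rho> * w \<sigma>"
      by (intro tendsto_mult_left LIMSEQ_Suc w_lim \<sigma>)
    show "(\<lambda>k. transfer r (v k) \<sigma>) \<longlonglongrightarrow> transfer r w \<sigma>"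
      by (rule transfer_tendsto[OF norm_r _ w_lim \<sigma>, where a = D]) (use v_abs in simp_all)
    show "\<exists>N. \<forall>n\<ge>N. \<rho> * v (Suc n) \<sigma> \<le> transfer r (v n) \<sigma>"
      using v_step[OF \<sigma>] by blast
  qed
  define y where "y n \<sigma> = (transfer r ^^ n) w \<sigma> / \<rho> ^ n" for n \<sigma>
  have y_Suc: "transfer r (y n) \<sigma> = \<rho> * y (Suc n) \<sigma>" for n \<sigma>
    using transfer_cmult[of r "1 / \<rho> ^ n" "(transfer r ^^ n) w" \<sigma>] \<rho> by (simp add: y_def[abs_def])
  have y_cone: "cone (y n)" for n
  proof (induction n)
    case (Suc n)
    have "cone (\<lambda>\<sigma>. 1 / \<rho> * transfer r (y n) \<sigma>)"
      using \<rho> by (intro cone_cmult cone_transfer Suc) auto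
    then show ?case using \<rho> by (simp add: y_Suc)
  qed (use w_cone in \<open>simp add: y_def[abs_def]\<close>)
  have y_up: "y n \<sigma> \<le> D * D" if "\<sigma> \<in> Sigma_space" for n \<sigma>
  proof -
    \<comment> \<open>Since w \<le> D and \<open>u 0\<close> is the constant 1, positivity carries
      the comparison to all iterates and bounds the increasing sequence.\<close>
    have "y n \<sigma> \<le> D * u n \<sigma>" if "\<sigma> \<in> Sigma_space" for n \<sigma>
      using that
    proof (induction n arbitrary: \<sigma>)
      case 0
      then show ?case using w_up by (simp add: y_def u_def iter_0)
    next
      case (Suc n)
      have "transfer r (y n) \<sigma> \<le> transfer r (\<lambda>\<sigma>. D * u n \<sigma>) \<sigma>"
      proof (rule transfer_mono[OF _ _ Suc.IH Suc.prems])
        show "\<bar>y n \<sigma>\<bar> \<le> D * y n (\<lambda>_. 1)" if "\<sigma> \<in> Sigma_space" for \<sigma>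
          using cone_bounded[OF y_cone that] by simp
        show "\<bar>D * u n \<sigma>\<bar> \<le> D * D" if "\<sigma> \<in> Sigma_space" for \<sigma>
          using u_up[OF that, of n] cone_pos[OF u_cone that, of n] D0 by (simp add: abs_mult)
      qed
      then show ?case
        using \<rho> by (simp add: y_Suc transfer_cmult u_Suc)
    qed
    from this[OF that, of n] mult_left_mono[OF u_up[OF that, of n], of D] D0 show ?thesis by linarith
  qed
  have y_abs: "\<bar>y n \<sigma>\<bar> \<le> D * D" if "\<sigma> \<in> Sigma_space" for n \<sigma>
    using y_up[OF that, of n] cone_pos[OF y_cone that, of n] by simp
  have y_inc: "y n \<sigma> \<le> y (Suc n) \<sigma>" if "\<sigma> \<in> Sigma_space" for n \<sigma>
    using that
  proof (induction n arbitrary: \<sigma>)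
    case 0
    then show ?case using w_step[of \<sigma>] \<rho> by (simp add: y_def field_simps)
  next
    case (Suc n)
    have "transfer r (y n) \<sigma> \<le> transfer r (y (Suc n)) \<sigma>"
      by (rule transfer_mono[OF y_abs y_abs Suc.IH Suc.prems])
    then show ?case using \<rho> by (simp add: y_Suc)
  qed
  define h where "h \<sigma> = lim (\<lambda>n. y n \<sigma>)" for \<sigma>
  have h_lim: "(\<lambda>n. y n \<sigma>) \<longlonglongrightarrow> h \<sigma>" if "\<sigma> \<in> Sigma_space" for \<sigma>
  proof -
    have "incseq (\<lambda>n. y n \<sigma>)" by (rule incseq_SucI) (rule y_inc[OF that])
    moreover have "\<forall>n. y n \<sigma> \<le> D * D"
      using y_up[OF that] by blast
    ultimately obtain L where "(\<lambda>n. y n \<sigma>) \<longlonglongrightarrow> L"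
      by (rule incseq_convergent)
    then show ?thesis unfolding h_def by (simp add: limI)
  qed
  have h_pos: "0 < h \<sigma>" if "\<sigma> \<in> Sigma_space" for \<sigma>
  proof -
    have "incseq (\<lambda>n. y n \<sigma>)" by (rule incseq_SucI) (rule y_inc[OF that])
    then have "y 0 \<sigma> \<le> h \<sigma>" by (rule incseq_le) (rule h_lim[OF that])
    with cone_pos[OF y_cone that, of 0] show ?thesis by linarith
  qed
  show ?thesis
  proof (rule that[OF \<rho>])
    show "cone h" by (rule cone_limit[OF y_cone h_lim h_pos])
    fix \<sigma> assume \<sigma>: "\<sigma> \<in> Sigma_space"
    have "(\<lambda>n. transfer r (y n) \<sigma>) \<longlonglongrightarrow> transfer r h \<sigma>"
      by (rule transfer_tendsto[OF norm_r _ h_lim \<sigma>, where a = "D * D"]) (use y_abs in simp_all)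
    moreover have "(\<lambda>n. transfer r (y n) \<sigma>) \<longlonglongrightarrow> \<rho> * h \<sigma>"
      unfolding y_Suc by (intro tendsto_mult_left LIMSEQ_Suc h_lim \<sigma>)
    ultimately show "transfer r h \<sigma> = \<rho> * h \<sigma>"
      by (rule LIMSEQ_unique)
  qed
qed

end

section \<open>Quasi-compactness of the twisted transfer operator\<close>

text \<open>The equality case of the triangle inequality. After rotating the total to a nonnegative
  real, Re (v t k) \<le> norm (t k) holds termwise while the sums agree; so every term is an
  equality.\<close>

lemma infsum_norm_equality:
  fixes t :: "'b \<Rightarrow> complex"
  assumes summ: "(\<lambda>k. norm (t k)) summable_on A" and eq: "norm (infsum t A) = (\<Sum>\<^sub>\<infinity>k\<in>A. norm (t k))" and k: "k \<in> A"
  shows "t k = of_real (norm (t k)) * sgn (infsum t A)"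
proof (cases "infsum t A = 0")
  case True
  with eq have 0: "(\<Sum>\<^sub>\<infinity>k\<in>A. norm (t k)) = 0" by simp
  have "norm (t k) = 0"
    by (rule nonneg_infsum_le_0D[of "\<lambda>k. norm (t k)" A]) (use 0 summ k in auto)
  then show ?thesis by simp
next
  case False
  define S where "S = infsum t A"
  define v where "v = cnj (sgn S)"
  have S: "S \<noteq> 0" using False by (simp add: S_def)
  have nv: "norm v = 1" using S by (simp add: v_def norm_sgn)
  have vS: "v * S = of_real (norm S)"
    using S by (simp add: v_def sgn_eq complex_norm_square[symmetric] power2_eq_square field_simps flip: complex_cnj_mult)
  have summ_t: "t summable_on A" by (rule abs_summable_summable[OF summ])
  have summ_v: "(\<lambda>k. v * t k) summable_on A" by (rule summable_on_cmult_right[OF summ_t])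
  have summ_Re: "(\<lambda>k. Re (v * t k)) summable_on A" by (rule summable_on_Re[OF summ_v])
  have "(\<Sum>\<^sub>\<infinity>k\<in>A. Re (v * t k)) = Re (\<Sum>\<^sub>\<infinity>k\<in>A. v * t k)"
    by (rule infsum_Re[OF summ_v])
  also have "\<dots> = norm S"
    by (simp add: infsum_cmult_right' S_def[symmetric] vS)
  finally have Re_sum: "(\<Sum>\<^sub>\<infinity>k\<in>A. Re (v * t k)) = (\<Sum>\<^sub>\<infinity>k\<in>A. norm (t k))"
    using eq by (simp add: S_def)
  have le: "Re (v * t k) \<le> norm (t k)" for k
    using complex_Re_le_cmod[of "v * t k"] nv by (simp add: norm_mult)
  have "norm (t k) - Re (v * t k) = 0"
  proof (rule nonneg_infsum_le_0D[of "\<lambda>k. norm (t k) - Re (v * t k)" A])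
    show "(\<Sum>\<^sub>\<infinity>k\<in>A. norm (t k) - Re (v * t k)) \<le> 0"
      unfolding infsum_minus[OF summ summ_Re] Re_sum by simp
    show "(\<lambda>k. norm (t k) - Re (v * t k)) summable_on A"
      by (rule summable_on_minus[OF summ summ_Re])
  qed (use le k in auto)
  then have Re: "Re (v * t k) = norm (v * t k)"
    using nv by (simp add: norm_mult)
  then have "Im (v * t k) = 0"
    using cmod_power2[of "v * t k"] by simp
  with Re have "v * t k = of_real (norm (t k))"
    using nv by (simp add: complex_eq_iff norm_mult)
  then have "cnj v * v * t k = cnj v * of_real (norm (t k))"
    by simp
  moreover have "cnj v * v = 1"
    using nv complex_norm_square[of v] by (simp add: mult.commute)
  ultimately have "1 * t k = cnj v * of_real (norm (t k))"
    by (simp only:)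
  then show ?thesis
    by (simp add: v_def S_def mult.commute)
qed

lemma half_between: "a < (a + b) / 2 \<and> (a + b) / 2 < b" if "a < b" for a b :: real
  using that by simp

text \<open>\<rho> and \<open>h\<close> are those supplied by \<open>eigenfunction_exists\<close> at
  r = norm z; the complex operator is estimated through the positive one, word by word.\<close>

locale twisted_transfer = positive_transfer +
  fixes z :: complex and \<rho> :: real and h :: "(nat \<Rightarrow> nat) \<Rightarrow> real"
  assumes z: "norm z = r" and \<rho>: "0 < \<rho>" and h: "cone h"
    and h_eigen: "\<And>\<sigma>. \<sigma> \<in> Sigma_space \<Longrightarrow> transfer r h \<sigma> = \<rho> * h \<sigma>"
begin

lemma norm_z: "norm z \<le> 1" using z r by simp

definition M :: "((nat \<Rightarrow> nat) \<Rightarrow> complex) \<Rightarrow> (nat \<Rightarrow> nat) \<Rightarrow> complex" where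
  "M f = (\<lambda>\<sigma>. if \<sigma> \<in> Sigma_space then transfer z f \<sigma> else 0)"

abbreviation X :: "((nat \<Rightarrow> nat) \<Rightarrow> complex) set" where "X \<equiv> F_theta \<theta>"
abbreviation N :: "((nat \<Rightarrow> nat) \<Rightarrow> complex) \<Rightarrow> real" where "N \<equiv> norm_theta \<theta>"

sublocale function_banach_space X N
  by (rule function_banach_space_F_theta[OF \<theta>])

definition h1 :: real where "h1 = h (\<lambda>_. 1)"

lemma h1_pos: "0 < h1"
  unfolding h1_def by (rule cone_pos[OF h ones_mem])

lemma h_le: "\<sigma> \<in> Sigma_space \<Longrightarrow> h \<sigma> \<le> D * h1"
  unfolding h1_def by (rule cone_le_D[OF h _ ones_mem])

lemma h_ge: "\<sigma> \<in> Sigma_space \<Longrightarrow> h1 \<le> D * h \<sigma>"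
  unfolding h1_def by (rule cone_le_D[OF h ones_mem])

lemma h_abs: "\<sigma> \<in> Sigma_space \<Longrightarrow> \<bar>h \<sigma>\<bar> \<le> D * h1"
  using h_le cone_pos[OF h] by force

lemma wsum_h: "\<sigma> \<in> Sigma_space \<Longrightarrow> wsum r (words n) (\<lambda>ks. h (prepend ks \<sigma>)) \<sigma> = \<rho> ^ n * h \<sigma>"
proof -
  have "(transfer r ^^ n) h \<sigma> = \<rho> ^ n * h \<sigma>" if "\<sigma> \<in> Sigma_space" for \<sigma>
    using that
  proof (induction n arbitrary: \<sigma>)
    case (Suc n)
    have "(transfer r ^^ Suc n) h \<sigma> = transfer r (\<lambda>\<sigma>. \<rho> ^ n * h \<sigma>) \<sigma>"
      unfolding funpow.simps comp_apply by (rule transfer_cong[OF Suc.IH Suc.prems])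
    then show ?case
      unfolding transfer_cmult h_eigen[OF Suc.prems] by (simp add: mult_ac)
  qed simp
  then show "\<sigma> \<in> Sigma_space \<Longrightarrow> wsum r (words n) (\<lambda>ks. h (prepend ks \<sigma>)) \<sigma> = \<rho> ^ n * h \<sigma>"
    using transfer_iterate[of r h "D * h1" \<sigma> n] norm_r h_abs by simp
qed

text \<open>\<open>h\<close> lies between h1 / D and D h1, so the iterates of 1 grow like those of
  \<open>h\<close>, which are exactly \<rho>^n h.\<close>

lemma iter_le: assumes \<sigma>: "\<sigma> \<in> Sigma_space" shows "iter n \<sigma> \<le> D * D * \<rho> ^ n"
proof -
  have "h1 * iter n \<sigma> = wsum r (words n) (\<lambda>_. h1 * 1) \<sigma>"
    unfolding wsum_cmult iter_eq_wsum[OF \<sigma>] ..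
  also have "\<dots> \<le> wsum r (words n) (\<lambda>ks. D * h (prepend ks \<sigma>)) \<sigma>"
  proof (rule wsum_mono[OF order_refl \<sigma>])
    fix ks assume ks: "ks \<in> words n"
    show "h1 * 1 \<le> D * h (prepend ks \<sigma>)" using h_ge[OF words_prepend_mem[OF ks \<sigma>]] by simp
    show "\<bar>h1 * 1\<bar> \<le> h1" using h1_pos by simp
    show "\<bar>D * h (prepend ks \<sigma>)\<bar> \<le> D * (D * h1)"
      unfolding abs_mult using h_abs[OF words_prepend_mem[OF ks \<sigma>]] D_ge_1 by (intro mult_mono) auto
  qed (use r in auto)
  also have "\<dots> = D * (\<rho> ^ n * h \<sigma>)"
    unfolding wsum_cmult wsum_h[OF \<sigma>] ..
  also have "\<dots> \<le> D * (\<rho> ^ n * (D * h1))"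
    using h_le[OF \<sigma>] D_ge_1 \<rho> by (intro mult_left_mono) auto
  finally have "h1 * iter n \<sigma> \<le> h1 * (D * D * \<rho> ^ n)" by (simp add: mult_ac)
  then show ?thesis using h1_pos by simp
qed

lemma iter_ge: assumes \<sigma>: "\<sigma> \<in> Sigma_space" shows "\<rho> ^ n \<le> D * D * iter n \<sigma>"
proof -
  have "\<rho> ^ n * h \<sigma> \<le> D * h1 * iter n \<sigma>"
    unfolding wsum_h[OF \<sigma>, symmetric] iter_eq_wsum[OF \<sigma>]
    by (rule wsum_const_le[OF order_refl \<sigma>]) (use r h_abs[OF words_prepend_mem[OF _ \<sigma>]] in auto)
  moreover have "\<rho> ^ n * h1 \<le> \<rho> ^ n * (D * h \<sigma>)"
    using h_ge[OF \<sigma>] \<rho> by (intro mult_left_mono) auto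
  moreover have "\<rho> ^ n * (D * h \<sigma>) = D * (\<rho> ^ n * h \<sigma>)" by simp
  ultimately have "\<rho> ^ n * h1 \<le> D * (D * h1 * iter n \<sigma>)"
    using mult_left_mono[of "\<rho> ^ n * h \<sigma>" "D * h1 * iter n \<sigma>" D] D_ge_1 by linarith
  then have "h1 * \<rho> ^ n \<le> h1 * (D * D * iter n \<sigma>)" by (simp add: mult_ac)
  then show ?thesis using h1_pos by simp
qed

lemma F_theta_bounded: "f \<in> X \<Longrightarrow> \<sigma> \<in> Sigma_space \<Longrightarrow> norm (f \<sigma>) \<le> sup_norm f"
  by (rule F_theta_sup[OF \<theta>])

text \<open>The common estimate behind the whole power, its tail over the discarded words and its
  frozen remainder: \<open>s\<close> bounds the mass of the words, \<open>a\<close> and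
  \<open>l\<close> the size and the Lipschitz constant of the coefficients.\<close>

lemma wsum_mem:
  assumes J: "J \<subseteq> words n" and a: "\<And>\<sigma> ks. \<sigma> \<in> Sigma_space \<Longrightarrow> ks \<in> J \<Longrightarrow> norm (c \<sigma> ks) \<le> a"
    and l: "\<And>\<sigma> \<sigma>' ks. \<sigma> \<in> Sigma_space \<Longrightarrow> \<sigma>' \<in> Sigma_space \<Longrightarrow> ks \<in> J \<Longrightarrow>
       norm (c \<sigma> ks - c \<sigma>' ks) \<le> l * d_theta \<theta> \<sigma> \<sigma>'"
    and nonneg: "0 \<le> a" "0 \<le> l"
    and s: "\<And>\<sigma>. \<sigma> \<in> Sigma_space \<Longrightarrow> wsum r J (\<lambda>_. 1) \<sigma> \<le> s"
    and G: "\<And>\<sigma>. G \<sigma> = (if \<sigma> \<in> Sigma_space then wsum z J (c \<sigma>) \<sigma> else 0)"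
  shows "G \<in> X" "N G \<le> s * ((1 + K * D * D) * a + l)"
proof -
  have w0: "0 \<le> wsum r J (\<lambda>_. 1) \<sigma>" if "\<sigma> \<in> Sigma_space" for \<sigma>
    unfolding wsum_def wterm_def
    by (rule infsum_nonneg) (use r weight_pos[OF words_set[OF J] that] in \<open>auto intro: less_imp_le\<close>)
  have s0: "0 \<le> s" using s[OF ones_mem] w0[OF ones_mem] by linarith
  have kd: "0 \<le> K * D * D * a + l"
    using K_pos D_ge_1 nonneg by simp
  have 1: "norm (G \<sigma>) \<le> s * a" if \<sigma>: "\<sigma> \<in> Sigma_space" for \<sigma>
  proof -
    have "norm (G \<sigma>) \<le> wsum r J (\<lambda>ks. norm (c \<sigma> ks)) \<sigma>"
      using norm_wsum_le[OF J \<sigma> norm_z a[OF \<sigma>]] \<sigma> by (simp add: G z)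
    also have "\<dots> \<le> a * wsum r J (\<lambda>_. 1) \<sigma>"
      by (rule wsum_const_le[OF J \<sigma>]) (use r a[OF \<sigma>] in auto)
    also have "\<dots> \<le> a * s"
      using s[OF \<sigma>] nonneg by (intro mult_left_mono)
    finally show ?thesis by (simp add: mult.commute)
  qed
  have 2: "norm (G \<sigma> - G \<sigma>') \<le> (K * D * D * a + l) * s * d_theta \<theta> \<sigma> \<sigma>'"
    if \<sigma>: "\<sigma> \<in> Sigma_space" "\<sigma>' \<in> Sigma_space" for \<sigma> \<sigma>'
  proof -
    have "norm (G \<sigma> - G \<sigma>') \<le> (K * D * D * a + l) * d_theta \<theta> \<sigma> \<sigma>' * wsum r J (\<lambda>_. 1) \<sigma>'"
      using wsum_lipschitz[OF J \<sigma> norm_z a[OF \<sigma>(1)] a[OF \<sigma>(2)] l[OF \<sigma>] nonneg] \<sigma> by (simp add: G z)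
    also have "\<dots> \<le> (K * D * D * a + l) * d_theta \<theta> \<sigma> \<sigma>' * s"
      using s[OF \<sigma>(2)] kd d_theta_nonneg[OF \<theta>(1)] by (intro mult_left_mono) auto
    finally show ?thesis by (simp add: mult_ac)
  qed
  have 3: "0 \<le> (K * D * D * a + l) * s" using kd s0 by simp
  have 4: "G \<sigma> = 0" if "\<sigma> \<notin> Sigma_space" for \<sigma>
    using that by (simp add: G)
  show "G \<in> X" by (rule F_thetaI(1)[OF \<theta> 4 1 2 3])
  have "N G \<le> s * a + (K * D * D * a + l) * s"
    by (rule F_thetaI(2)[OF \<theta> 4 1 2 3])
  then show "N G \<le> s * ((1 + K * D * D) * a + l)"
    by (simp add: algebra_simps)
qed

lemma M_pow_transfer: "\<sigma> \<in> Sigma_space \<Longrightarrow> (M ^^ n) f \<sigma> = (transfer z ^^ n) f \<sigma>"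
proof (induction n arbitrary: \<sigma>)
  case (Suc n)
  have "(M ^^ Suc n) f \<sigma> = transfer z ((M ^^ n) f) \<sigma>"
    using Suc.prems by (simp add: M_def[of "(M ^^ n) f"])
  also have "\<dots> = transfer z ((transfer z ^^ n) f) \<sigma>"
    by (rule transfer_cong[OF Suc.IH Suc.prems])
  finally show ?case by simp
qed simp

lemma M_pow_eq:
  assumes f: "f \<in> X" and \<sigma>: "\<sigma> \<in> Sigma_space"
  shows "(M ^^ n) f \<sigma> = wsum z (words n) (\<lambda>ks. f (prepend ks \<sigma>)) \<sigma>"
  unfolding M_pow_transfer[OF \<sigma>] by (rule transfer_iterate[OF norm_z F_theta_bounded[OF f] \<sigma>])

lemma f_words:
  assumes f: "f \<in> X" and ks: "ks \<in> words n"
  shows "\<sigma> \<in> Sigma_space \<Longrightarrow> norm (f (prepend ks \<sigma>)) \<le> sup_norm f"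
    and "\<sigma> \<in> Sigma_space \<Longrightarrow> \<sigma>' \<in> Sigma_space \<Longrightarrow>
      norm (f (prepend ks \<sigma>) - f (prepend ks \<sigma>')) \<le> \<theta> ^ n * lip_seminorm \<theta> f * d_theta \<theta> \<sigma> \<sigma>'"
    and "\<sigma> \<in> Sigma_space \<Longrightarrow> \<sigma>' \<in> Sigma_space \<Longrightarrow>
      norm (f (prepend ks \<sigma>) - f (prepend ks \<sigma>')) \<le> \<theta> ^ n * lip_seminorm \<theta> f"
proof -
  show "norm (f (prepend ks \<sigma>)) \<le> sup_norm f" if "\<sigma> \<in> Sigma_space"
    by (rule F_theta_bounded[OF f words_prepend_mem[OF ks that]])
  have len: "length ks = n" using ks by (simp add: words_def)
  show 1: "norm (f (prepend ks \<sigma>) - f (prepend ks \<sigma>')) \<le> \<theta> ^ n * lip_seminorm \<theta> f * d_theta \<theta> \<sigma> \<sigma>'"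
    if "\<sigma> \<in> Sigma_space" "\<sigma>' \<in> Sigma_space"
    using F_theta_lip[OF \<theta> f words_prepend_mem[OF ks that(1)] words_prepend_mem[OF ks that(2)]]
    by (simp add: d_theta_prepend len mult_ac)
  show "norm (f (prepend ks \<sigma>) - f (prepend ks \<sigma>')) \<le> \<theta> ^ n * lip_seminorm \<theta> f"
    if "\<sigma> \<in> Sigma_space" "\<sigma>' \<in> Sigma_space"
  proof -
    have "\<theta> ^ n * lip_seminorm \<theta> f * d_theta \<theta> \<sigma> \<sigma>' \<le> \<theta> ^ n * lip_seminorm \<theta> f * 1"
      using d_theta_le_1[OF \<theta>] lip_seminorm_nonneg[OF \<theta> f] \<theta> by (intro mult_left_mono) auto
    with 1[OF that] show ?thesis by simp
  qed
qed

lemma nonneg_parts: "f \<in> X \<Longrightarrow> 0 \<le> sup_norm f" "f \<in> X \<Longrightarrow> 0 \<le> lip_seminorm \<theta> f"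
    "N f = sup_norm f + lip_seminorm \<theta> f"
  using sup_norm_nonneg[OF \<theta>] lip_seminorm_nonneg[OF \<theta>] norm_theta_eq[OF \<theta>] by auto

text \<open>Coefficients with size and Lipschitz constant both l yield (1 + K D D) l + l = L l in
  \<open>wsum_mem\<close>. For unfrozen sums it dominates 1 + K D D and \<theta>^n.\<close>

definition L :: real where "L = 2 + K * D * D"

lemma L_pos: "0 < L"
  using K_pos D_ge_1 by (simp add: L_def add_pos_nonneg)

lemma part_mem:
  assumes J: "J \<subseteq> words n" and s: "\<And>\<sigma>. \<sigma> \<in> Sigma_space \<Longrightarrow> wsum r J (\<lambda>_. 1) \<sigma> \<le> s" and f: "f \<in> X"
    and G: "\<And>\<sigma>. G \<sigma> = (if \<sigma> \<in> Sigma_space then wsum z J (\<lambda>ks. f (prepend ks \<sigma>)) \<sigma> else 0)"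
  shows "G \<in> X" "N G \<le> s * L * N f"
proof -
  have w0: "0 \<le> wsum r J (\<lambda>_. 1) (\<lambda>_. 1)"
    unfolding wsum_def wterm_def
    by (rule infsum_nonneg) (use r weight_pos[OF words_set[OF J] ones_mem] in \<open>auto intro: less_imp_le\<close>)
  have s0: "0 \<le> s" using s[OF ones_mem] w0 by linarith
  have *: "G \<in> X \<and> N G \<le> s * ((1 + K * D * D) * sup_norm f + \<theta> ^ n * lip_seminorm \<theta> f)"
  proof -
    have a: "norm (f (prepend ks \<sigma>)) \<le> sup_norm f" if "\<sigma> \<in> Sigma_space" "ks \<in> J" for \<sigma> ks
      by (rule f_words(1)[OF f subsetD[OF J that(2)] that(1)])
    have l: "norm (f (prepend ks \<sigma>) - f (prepend ks \<sigma>')) \<le> \<theta> ^ n * lip_seminorm \<theta> f * d_theta \<theta> \<sigma> \<sigma>'"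
      if "\<sigma> \<in> Sigma_space" "\<sigma>' \<in> Sigma_space" "ks \<in> J" for \<sigma> \<sigma>' ks
      by (rule f_words(2)[OF f subsetD[OF J that(3)] that(1,2)])
    have nonneg: "0 \<le> sup_norm f" "0 \<le> \<theta> ^ n * lip_seminorm \<theta> f"
      using nonneg_parts(1,2)[OF f] \<theta> by auto
    show ?thesis
      using wsum_mem[OF J a l nonneg s G] by blast
  qed
  then show "G \<in> X" by blast
  have "(1 + K * D * D) * sup_norm f + \<theta> ^ n * lip_seminorm \<theta> f \<le> L * sup_norm f + L * lip_seminorm \<theta> f"
    using nonneg_parts(1,2)[OF f] \<theta> K_pos D_ge_1 power_le_one[of \<theta> n]
    by (intro add_mono mult_right_mono) (auto simp: L_def intro: order_trans[of _ 1] add_increasing2)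
  then have "s * ((1 + K * D * D) * sup_norm f + \<theta> ^ n * lip_seminorm \<theta> f) \<le> s * (L * N f)"
    using s0 unfolding nonneg_parts(3) by (intro mult_left_mono) (auto simp: distrib_left)
  with * show "N G \<le> s * L * N f" by (simp add: mult_ac)
qed

lemma wsum_words_le: "\<sigma> \<in> Sigma_space \<Longrightarrow> wsum r (words n) (\<lambda>_. 1) \<sigma> \<le> D * D * \<rho> ^ n"
  using iter_le iter_eq_wsum by simp

lemma M_pow_mem:
  assumes f: "f \<in> X"
  shows "(M ^^ n) f \<in> X \<and> N ((M ^^ n) f) \<le> D * D * L * \<rho> ^ n * N f"
proof -
  have outside: "(M ^^ n) f \<sigma> = 0" if "\<sigma> \<notin> Sigma_space" for \<sigma>
    using that F_theta_outside[OF \<theta> f that] by (cases n) (auto simp: M_def)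
  have G: "(M ^^ n) f \<sigma> = (if \<sigma> \<in> Sigma_space then wsum z (words n) (\<lambda>ks. f (prepend ks \<sigma>)) \<sigma> else 0)" for \<sigma>
    using outside M_pow_eq[OF f] by simp
  have "N ((M ^^ n) f) \<le> D * D * \<rho> ^ n * L * N f"
    by (rule part_mem(2)[OF order_refl wsum_words_le f G])
  then show ?thesis
    using part_mem(1)[OF order_refl wsum_words_le f G] by (simp add: mult_ac)
qed

lemma bounded_op_M: "bounded_op X N M"
proof (rule bounded_opI[where B = "D * D * L * \<rho>"])
  show "M f \<in> X" "N (M f) \<le> D * D * L * \<rho> * N f" if "f \<in> X" for f
    using M_pow_mem[OF that, of 1] by auto
  have sums: "wterm z (\<lambda>ks. f (prepend ks \<sigma>)) \<sigma> summable_on words 1" if "f \<in> X" "\<sigma> \<in> Sigma_space" for f \<sigma>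
    by (rule wterm_summable[OF order_refl that(2) norm_z, where a = "sup_norm f"]) (rule f_words(1)[OF that(1) _ that(2)])
  show "M (f + g) = M f + M g" if "f \<in> X" "g \<in> X" for f g
  proof
    fix \<sigma>
    show "M (f + g) \<sigma> = (M f + M g) \<sigma>"
    proof (cases "\<sigma> \<in> Sigma_space")
      case True
      have "wterm z (\<lambda>ks. (f + g) (prepend ks \<sigma>)) \<sigma> =
          (\<lambda>ks. wterm z (\<lambda>ks. f (prepend ks \<sigma>)) \<sigma> ks + wterm z (\<lambda>ks. g (prepend ks \<sigma>)) \<sigma> ks)"
        by (simp add: fun_eq_iff wterm_def distrib_left)
      then have "transfer z (f + g) \<sigma> = transfer z f \<sigma> + transfer z g \<sigma>"
        unfolding transfer_eq_wsum wsum_def using infsum_add[OF sums[OF that(1) True] sums[OF that(2) True]]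
        by (simp only:)
      then show ?thesis using True by (simp only: M_def plus_fun_apply if_True)
    qed (simp add: M_def)
  qed
  show "M (cscale c f) = cscale c (M f)" for c f
  proof
    fix \<sigma>
    have "transfer z (cscale c f) \<sigma> = c * transfer z f \<sigma>"
      unfolding cscale_def by (rule transfer_cmult)
    then show "M (cscale c f) \<sigma> = cscale c (M f) \<sigma>"
      by (simp add: M_def)
  qed
qed

text \<open>One finite set serves all \<sigma>, because it is chosen for the majorant \<beta>, which
  does not depend on \<sigma>.\<close>

lemma finite_words_tail:
  assumes e: "0 < e"
  obtains J where "finite J" "J \<subseteq> words n" "\<And>\<sigma>. \<sigma> \<in> Sigma_space \<Longrightarrow> wsum r (words n - J) (\<lambda>_. 1) \<sigma> \<le> e"
proof -
  define \<beta> where "\<beta> ks = prod_list (map b ks)" for ks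
  have summ: "\<beta> summable_on words n"
    unfolding \<beta>_def[abs_def] by (rule prod_b_summable)
  obtain J where J: "finite J" "J \<subseteq> words n" "dist (sum \<beta> J) (infsum \<beta> (words n)) \<le> e"
    using infsum_finite_approximation[OF summ e] by blast
  have summ': "\<beta> summable_on (words n - J)"
    by (rule summable_on_subset_banach[OF summ]) auto
  have "infsum \<beta> (J \<union> (words n - J)) = infsum \<beta> J + infsum \<beta> (words n - J)"
    using J summ' by (intro infsum_Un_disjoint) auto
  moreover have "J \<union> (words n - J) = words n"
    using J by blast
  ultimately have tail: "infsum \<beta> (words n - J) \<le> e"
    using J by (simp add: dist_real_def)
  show ?thesis
  proof (rule that[OF J(1,2)])
    fix \<sigma> assume \<sigma>: "\<sigma> \<in> Sigma_space"
    have sub: "words n - J \<subseteq> words n" by blast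
    have "wsum r (words n - J) (\<lambda>_. 1) \<sigma> \<le> infsum \<beta> (words n - J)"
      unfolding wsum_def
    proof (rule infsum_mono[OF wterm_summable[OF sub \<sigma> norm_r, where a = 1] summ'])
      fix ks assume ks: "ks \<in> words n - J"
      have "norm (wterm r (\<lambda>_. 1) \<sigma> ks) \<le> 1 * prod_list (map b ks)"
        by (rule norm_wterm_le[OF words_set[OF sub ks] \<sigma> norm_r]) simp
      then show "wterm r (\<lambda>_. 1) \<sigma> ks \<le> \<beta> ks" by (simp add: \<beta>_def)
    qed simp
    with tail show "wsum r (words n - J) (\<lambda>_. 1) \<sigma> \<le> e" by linarith
  qed
qed

definition unit_term :: "nat list \<Rightarrow> (nat \<Rightarrow> nat) \<Rightarrow> complex" where
  "unit_term ks = (\<lambda>\<sigma>. if \<sigma> \<in> Sigma_space then wterm z (\<lambda>_. 1) \<sigma> ks else 0)"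

lemma wsum_subset_le:
  assumes J: "J \<subseteq> words n" and \<sigma>: "\<sigma> \<in> Sigma_space"
  shows "wsum r J (\<lambda>_. 1) \<sigma> \<le> wsum r (words n) (\<lambda>_. 1) \<sigma>"
  unfolding wsum_def
proof (rule infsum_mono2[OF wterm_summable[OF J \<sigma> norm_r, where a = 1] wterm_summable[OF order_refl \<sigma> norm_r, where a = 1]])
  show "0 \<le> wterm r (\<lambda>_. 1) \<sigma> ks" if "ks \<in> words n - J" for ks
    using that weight_pos[OF words_set[OF order_refl] \<sigma>, of ks n] r by (auto simp: wterm_def)
qed (use J in auto)

lemma unit_term_mem: "ks \<in> words n \<Longrightarrow> unit_term ks \<in> X"
proof -
  assume ks: "ks \<in> words n"
  then have J: "{ks} \<subseteq> words n" by simp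
  have s: "wsum r {ks} (\<lambda>_. 1) \<sigma> \<le> D * D * \<rho> ^ n" if "\<sigma> \<in> Sigma_space" for \<sigma>
    using wsum_subset_le[OF J that] wsum_words_le[OF that, of n] by linarith
  show ?thesis
    by (rule wsum_mem(1)[OF J, of "\<lambda>_ _. 1" 1 0, OF _ _ _ _ s]) (auto simp: unit_term_def wsum_def)
qed

lemma quasi_compact_splitting:
  assumes q: "\<theta> * \<rho> < q"
  obtains n J E where "0 < n" "finite J" "J \<subseteq> words n" "bounded_op X N E"
    "\<And>f. f \<in> X \<Longrightarrow> N (E f) \<le> q ^ n * N f"
    "\<And>f. f \<in> X \<Longrightarrow> (M ^^ n) f = E f + (\<Sum>ks\<in>J. cscale (f (prepend ks (\<lambda>_. 1))) (unit_term ks))"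
proof -
  have q0: "0 < q" using q \<theta> \<rho> by (meson mult_pos_pos order_less_trans)
  have "(\<lambda>n. D * D * L * (\<theta> * \<rho> / q) ^ n) \<longlonglongrightarrow> D * D * L * 0"
    using q \<theta> \<rho> q0 by (intro tendsto_mult_left LIMSEQ_power_zero) (simp add: abs_mult)
  then have "\<forall>\<^sub>F n in sequentially. D * D * L * (\<theta> * \<rho> / q) ^ n < 1 / 2"
    by (rule order_tendstoD(2)) simp
  then obtain n0 where n0: "\<And>n. n0 \<le> n \<Longrightarrow> D * D * L * (\<theta> * \<rho> / q) ^ n < 1 / 2"
    by (auto simp: eventually_sequentially)
  \<comment> \<open>Beyond n0 the power of \<theta> \<rho> / q beats the constant D D L; the
    successor makes the exponent positive.\<close>
  define n where "n = Suc n0"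
  have n: "0 < n" by (simp add: n_def)
  have small: "D * D * \<rho> ^ n * (L * \<theta> ^ n) \<le> q ^ n / 2"
    using n0[of n] q0 by (simp add: n_def power_divide power_mult_distrib field_simps)
  \<comment> \<open>The tolerance contains 1/L to absorb the factor \<open>L\<close> that
    \<open>part_mem\<close> introduces.\<close>
  obtain J where J: "finite J" "J \<subseteq> words n"
    "\<And>\<sigma>. \<sigma> \<in> Sigma_space \<Longrightarrow> wsum r (words n - J) (\<lambda>_. 1) \<sigma> \<le> q ^ n / (2 * L)"
    using finite_words_tail[of "q ^ n / (2 * L)" n] q0 L_pos by auto
  define P where "P ks = prepend ks (\<lambda>_. 1 :: nat)" for ks
  define E1 where "E1 f = (\<lambda>\<sigma>. if \<sigma> \<in> Sigma_space then wsum z J (\<lambda>ks. f (prepend ks \<sigma>) - f (P ks)) \<sigma> else 0)" for f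
  define E2 where "E2 f = (\<lambda>\<sigma>. if \<sigma> \<in> Sigma_space then wsum z (words n - J) (\<lambda>ks. f (prepend ks \<sigma>)) \<sigma> else 0)" for f
  define F where "F f = (\<Sum>ks\<in>J. cscale (f (P ks)) (unit_term ks))" for f
  define E where "E f = (M ^^ n) f - F f" for f
  have E1: "E1 f \<in> X" "N (E1 f) \<le> D * D * \<rho> ^ n * (L * \<theta> ^ n) * N f" if f: "f \<in> X" for f
  proof -
    define l where "l = \<theta> ^ n * lip_seminorm \<theta> f"
    have l: "0 \<le> l" using \<theta> nonneg_parts(2)[OF f] by (simp add: l_def)
    have s: "wsum r J (\<lambda>_. 1) \<sigma> \<le> D * D * \<rho> ^ n" if "\<sigma> \<in> Sigma_space" for \<sigma>
      using wsum_subset_le[OF J(2) that] wsum_words_le[OF that, of n] by linarith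
    have *: "E1 f \<in> X \<and> N (E1 f) \<le> D * D * \<rho> ^ n * ((1 + K * D * D) * l + l)"
    proof -
      \<comment> \<open>The two points share a word of length n, so freezing brings the factor
        \<theta>^n into the size of the coefficient as well; the Lipschitz constant has it in any
        case.\<close>
      have a: "norm (f (prepend ks \<sigma>) - f (P ks)) \<le> l" if "\<sigma> \<in> Sigma_space" "ks \<in> J" for \<sigma> ks
        unfolding P_def l_def by (rule f_words(3)[OF f subsetD[OF J(2) that(2)] that(1) ones_mem])
      have b: "norm ((f (prepend ks \<sigma>) - f (P ks)) - (f (prepend ks \<sigma>') - f (P ks))) \<le> l * d_theta \<theta> \<sigma> \<sigma>'"
        if "\<sigma> \<in> Sigma_space" "\<sigma>' \<in> Sigma_space" "ks \<in> J" for \<sigma> \<sigma>' ks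
        using f_words(2)[OF f subsetD[OF J(2) that(3)] that(1,2)] by (simp add: l_def)
      have G: "E1 f \<sigma> = (if \<sigma> \<in> Sigma_space then wsum z J (\<lambda>ks. f (prepend ks \<sigma>) - f (P ks)) \<sigma> else 0)" for \<sigma>
        by (simp add: E1_def)
      show ?thesis
        using wsum_mem[OF J(2) a b l l s G] by blast
    qed
    then show "E1 f \<in> X" by blast
    have "(1 + K * D * D) * l + l = L * \<theta> ^ n * lip_seminorm \<theta> f"
      by (simp add: L_def l_def algebra_simps)
    also have "\<dots> \<le> L * \<theta> ^ n * N f"
      using nonneg_parts(1)[OF f] L_pos \<theta> unfolding nonneg_parts(3) by (intro mult_left_mono) auto
    finally have "D * D * \<rho> ^ n * ((1 + K * D * D) * l + l) \<le> D * D * \<rho> ^ n * (L * \<theta> ^ n * N f)"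
      using D_ge_1 \<rho> by (intro mult_left_mono) auto
    with * show "N (E1 f) \<le> D * D * \<rho> ^ n * (L * \<theta> ^ n) * N f" by (simp add: mult_ac)
  qed
  have E2: "E2 f \<in> X" "N (E2 f) \<le> q ^ n / (2 * L) * L * N f" if f: "f \<in> X" for f
  proof -
    have sub: "words n - J \<subseteq> words n" by blast
    have G: "E2 f \<sigma> = (if \<sigma> \<in> Sigma_space then wsum z (words n - J) (\<lambda>ks. f (prepend ks \<sigma>)) \<sigma> else 0)" for \<sigma>
      by (simp add: E2_def)
    show "E2 f \<in> X" "N (E2 f) \<le> q ^ n / (2 * L) * L * N f"
      by (rule part_mem[OF sub J(3) f G]; assumption)+
  qed
  have E_eq: "E f = E1 f + E2 f" if f: "f \<in> X" for f
  proof
    fix \<sigma>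
    show "E f \<sigma> = (E1 f + E2 f) \<sigma>"
    proof (cases "\<sigma> \<in> Sigma_space")
      case False
      then have "(M ^^ n) f \<sigma> = 0"
        using n by (cases n) (auto simp: M_def)
      with False show ?thesis
        by (simp add: E_def F_def E1_def E2_def sum_fun_apply unit_term_def)
    next
      case True
      have bnd: "norm (f (prepend ks \<sigma>)) \<le> sup_norm f" if "ks \<in> words n" for ks
        by (rule f_words(1)[OF f that True])
      have bnd1: "norm (f (P ks)) \<le> sup_norm f" if "ks \<in> words n" for ks
        unfolding P_def by (rule f_words(1)[OF f that ones_mem])
      have "wsum z (J \<union> (words n - J)) (\<lambda>ks. f (prepend ks \<sigma>)) \<sigma> =
          wsum z J (\<lambda>ks. f (prepend ks \<sigma>)) \<sigma> + wsum z (words n - J) (\<lambda>ks. f (prepend ks \<sigma>)) \<sigma>"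
        unfolding wsum_def
        by (rule infsum_Un_disjoint)
          (use J True bnd in \<open>auto intro!: wterm_summable[where n = n and a = "sup_norm f"] norm_z\<close>)
      moreover have "J \<union> (words n - J) = words n" using J by blast
      moreover have "wsum z J (\<lambda>ks. f (prepend ks \<sigma>) - f (P ks)) \<sigma> =
          wsum z J (\<lambda>ks. f (prepend ks \<sigma>)) \<sigma> - wsum z J (\<lambda>ks. f (P ks)) \<sigma>"
        by (rule wsum_diff[OF J(2) True norm_z bnd bnd1]) (use J in auto)
      moreover have "wsum z J (\<lambda>ks. f (P ks)) \<sigma> = F f \<sigma>"
        using J(1) True unfolding wsum_def F_def sum_fun_apply
        by (simp add: unit_term_def wterm_def mult_ac)
      ultimately show ?thesis
        using True by (simp add: E_def E1_def E2_def M_pow_eq[OF f True])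
    qed
  qed
  have bF: "bounded_op X N F"
    unfolding F_def[abs_def]
    by (rule bounded_op_sum_ops) (rule bounded_op_eval[OF bounded_op_id unit_term_mem[OF subsetD[OF J(2)]]])
  have bE: "bounded_op X N E"
  proof -
    have "bounded_op X N (\<lambda>f. (M ^^ n) f + cscale (-1) (F f))"
      by (rule bounded_op_plus[OF bounded_op_funpow[OF bounded_op_M] bounded_op_cscale[OF bF]])
    moreover have "(\<lambda>f. (M ^^ n) f + cscale (-1) (F f)) = E"
      by (auto simp: E_def fun_eq_iff)
    ultimately show ?thesis by simp
  qed
  show ?thesis
  proof (rule that[OF n J(1,2) bE])
    fix f assume f: "f \<in> X"
    have "N (E f) \<le> N (E1 f) + N (E2 f)"
      unfolding E_eq[OF f] by (rule N_add[OF E1(1)[OF f] E2(1)[OF f]])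
    also have "\<dots> \<le> D * D * \<rho> ^ n * (L * \<theta> ^ n) * N f + q ^ n / (2 * L) * L * N f"
      by (rule add_mono[OF E1(2)[OF f] E2(2)[OF f]])
    also have "\<dots> \<le> q ^ n / 2 * N f + q ^ n / 2 * N f"
    proof -
      have "q ^ n / (2 * L) * L = q ^ n / 2" using L_pos by simp
      then show ?thesis
        using mult_right_mono[OF small N_nonneg[OF f]] by (simp only: add_mono order_refl)
    qed
    finally show "N (E f) \<le> q ^ n * N f" by (simp add: mult.commute)
    show "(M ^^ n) f = E f + (\<Sum>ks\<in>J. cscale (f (prepend ks (\<lambda>_. 1))) (unit_term ks))"
      unfolding E_def F_def P_def by simp
  qed
qed

lemma power_inverse_family_M:
  assumes q: "\<theta> * \<rho> < q"
  shows "\<exists>E n J d H H0 B. power_inverse_family X N M E n q J (\<lambda>ks. prepend ks (\<lambda>_. 1)) unit_term d H H0 B"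
proof -
  obtain n J E where *: "0 < n" "finite J" "J \<subseteq> words n" "bounded_op X N E"
    "\<And>f. f \<in> X \<Longrightarrow> N (E f) \<le> q ^ n * N f"
    "\<And>f. f \<in> X \<Longrightarrow> (M ^^ n) f = E f + (\<Sum>ks\<in>J. cscale (f (prepend ks (\<lambda>_. 1))) (unit_term ks))"
    by (rule quasi_compact_splitting[OF q]) blast
  have q0: "0 < q" using q \<theta> \<rho> by (meson mult_pos_pos order_less_trans)
  have u: "unit_term ks \<in> X" if "ks \<in> J" for ks
    by (rule unit_term_mem) (use that *(3) in blast)
  have qn: "0 < q ^ n" using q0 by simp
  obtain d H where fam: "inverse_family (q ^ n) (\<lambda>f. E f + (\<Sum>ks\<in>J. cscale (f (prepend ks (\<lambda>_. 1))) (unit_term ks))) d H"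
    and d: "\<And>w. q ^ n + (\<Sum>j\<in>J. N (unit_term j)) < norm w \<Longrightarrow> d w \<noteq> 0"
    using finite_rank_inverse_family[where E = E and e = "q ^ n" and J = J and u = unit_term
        and p = "\<lambda>ks. prepend ks (\<lambda>_. 1)", OF *(4) qn *(5) *(2) u] by blast
  obtain H0 where fam0: "inverse_family (q ^ n) E (\<lambda>_. 1) H0"
    using neumann_inverse_family[OF *(4) qn *(5)] by blast
  have "power_inverse_family X N M E n q J (\<lambda>ks. prepend ks (\<lambda>_. 1)) unit_term d H H0 (q ^ n + (\<Sum>j\<in>J. N (unit_term j)))"
    by unfold_locales (use bounded_op_M * q0 u fam fam0 d in auto)
  then show ?thesis by blast
qed

lemma M_pow_le: "f \<in> X \<Longrightarrow> N ((M ^^ k) f) \<le> D * D * L * \<rho> ^ k * N f"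
  using M_pow_mem by blast

lemma eigenvalue_le: "eigenvalue_on X M \<mu> \<Longrightarrow> norm \<mu> \<le> \<rho>"
  by (rule eigenvalue_le_power_bound[OF bounded_op_M \<rho> M_pow_le])

lemma spectrum_outside:
  assumes "\<mu> \<in> spectrum_on X N M" "\<theta> * \<rho> < norm \<mu>"
  shows "eigenvalue_on X M \<mu>" "\<exists>m. isolated_eigenvalue_mult X N M \<mu> m"
proof -
  define q where "q = (\<theta> * \<rho> + norm \<mu>) / 2"
  have gap: "\<theta> * \<rho> < q" "q < norm \<mu>" using half_between[OF assms(2)] unfolding q_def by blast+
  obtain E n J d H H0 B where "power_inverse_family X N M E n q J (\<lambda>ks. prepend ks (\<lambda>_. 1)) unit_term d H H0 B"
    using power_inverse_family_M[OF gap(1)] by blast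
  then interpret power_inverse_family X N M E n q J "\<lambda>ks. prepend ks (\<lambda>_. 1)" unit_term d H H0 B .
  show "eigenvalue_on X M \<mu>" by (rule spectrum_imp_eigenvalue[OF assms(1) gap(2)])
  show "\<exists>m. isolated_eigenvalue_mult X N M \<mu> m" by (rule spectrum_imp_isolated_eigenvalue[OF assms(1) gap(2)])
qed

lemma finite_spectrum:
  assumes "\<theta> * \<rho> < q'"
  shows "finite {\<mu> \<in> spectrum_on X N M. q' \<le> norm \<mu>}"
proof -
  define q where "q = (\<theta> * \<rho> + q') / 2"
  have gap: "\<theta> * \<rho> < q" "q < q'" using half_between[OF assms] unfolding q_def by blast+
  obtain E n J d H H0 B where "power_inverse_family X N M E n q J (\<lambda>ks. prepend ks (\<lambda>_. 1)) unit_term d H H0 B"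
    using power_inverse_family_M[OF gap(1)] by blast
  then interpret power_inverse_family X N M E n q J "\<lambda>ks. prepend ks (\<lambda>_. 1)" unit_term d H H0 B .
  show ?thesis by (rule finite_spectrum_outside[OF gap(2)])
qed

lemma spectrum_le: "\<mu> \<in> spectrum_on X N M \<Longrightarrow> norm \<mu> \<le> \<rho>"
proof (cases "\<theta> * \<rho> < norm \<mu>")
  case False
  have "\<theta> * \<rho> \<le> \<rho>" using \<theta> \<rho> by simp
  with False show ?thesis by linarith
qed (rule eigenvalue_le[OF spectrum_outside(1)])

lemma ess_spectrum_le: "\<mu> \<in> ess_spectrum_on X N M \<Longrightarrow> norm \<mu> \<le> \<theta> * \<rho>"
  using spectrum_outside(2)[of \<mu>] unfolding ess_spectrum_on_def by (auto simp: not_less[symmetric])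

text \<open>Above a radius q between \<theta> \<rho> and \<rho> there are only finitely many
  spectral points, all of them eigenvalues; among those of modulus below \<rho> there is a largest
  modulus.\<close>

lemma spectral_gap: "\<exists>r'<\<rho>. spectrum_on X N M - {\<mu>. eigenvalue_on X M \<mu> \<and> norm \<mu> = \<rho>} \<subseteq> cball 0 r'"
proof -
  define q where "q = (\<theta> * \<rho> + \<rho>) / 2"
  have "\<theta> * \<rho> < \<rho>" using \<theta> \<rho> by simp
  from half_between[OF this] have q: "\<theta> * \<rho> < q" "q < \<rho>" unfolding q_def by blast+
  define S where "S = norm ` ({\<mu> \<in> spectrum_on X N M. q \<le> norm \<mu>} - {\<mu>. norm \<mu> = \<rho>})"
  have fin: "finite S" unfolding S_def using finite_spectrum[OF q(1)] by simp
  \<comment> \<open>Inserting q keeps the maximum defined when \<open>S\<close> is empty and covers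
    the spectrum below q.\<close>
  define r' where "r' = Max (insert q S)"
  have "s < \<rho>" if "s \<in> insert q S" for s
    using that q spectrum_le by (force simp: S_def)
  then have "r' < \<rho>" unfolding r'_def using fin by (subst Max_less_iff) auto
  moreover have "norm \<mu> \<le> r'" if \<mu>: "\<mu> \<in> spectrum_on X N M" "\<not> (eigenvalue_on X M \<mu> \<and> norm \<mu> = \<rho>)" for \<mu>
  proof (cases "q \<le> norm \<mu>")
    case True
    have "eigenvalue_on X M \<mu>" by (rule spectrum_outside(1)[OF \<mu>(1)]) (use True q in linarith)
    with True \<mu> have "norm \<mu> \<in> S" unfolding S_def by auto
    then show ?thesis unfolding r'_def using fin by (intro Max_ge) auto
  next
    case False
    have "q \<le> r'" unfolding r'_def using fin by (intro Max_ge) auto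
    with False show ?thesis by linarith
  qed
  ultimately have "r' < \<rho> \<and> spectrum_on X N M - {\<mu>. eigenvalue_on X M \<mu> \<and> norm \<mu> = \<rho>} \<subseteq> cball 0 r'"
    by (simp add: subset_iff)
  then show ?thesis by blast
qed

end

section \<open>The peripheral spectrum\<close>

context twisted_transfer
begin

definition hc :: "(nat \<Rightarrow> nat) \<Rightarrow> complex" where
  "hc \<sigma> = (if \<sigma> \<in> Sigma_space then of_real (h \<sigma>) else 0)"

lemma h_diff:
  assumes \<sigma>: "\<sigma> \<in> Sigma_space" "\<sigma>' \<in> Sigma_space"
  shows "\<bar>h \<sigma> - h \<sigma>'\<bar> \<le> K * D * (D * h1) * d_theta \<theta> \<sigma> \<sigma>'"
proof -
  have *: "h \<sigma> - h \<sigma>' \<le> K * D * (D * h1) * d_theta \<theta> \<sigma> \<sigma>'"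
    if \<sigma>: "\<sigma> \<in> Sigma_space" "\<sigma>' \<in> Sigma_space" for \<sigma> \<sigma>'
  proof -
    define x where "x = d_theta \<theta> \<sigma> \<sigma>'"
    have x: "0 \<le> x" "x \<le> 1" using d_theta_nonneg[OF \<theta>(1)] d_theta_le_1[OF \<theta>] by (auto simp: x_def)
    have "h \<sigma> - h \<sigma>' \<le> (exp (K * x) - 1) * h \<sigma>'"
      using cone_le[OF h \<sigma>] by (simp add: x_def algebra_simps)
    also have "\<dots> \<le> (K * D * x) * (D * h1)"
      using exp_minus_one_le[OF x, of K] h_le[OF \<sigma>(2)] cone_pos[OF h \<sigma>(2)] K_pos D_ge_1 x
      by (intro mult_mono) (auto simp: D_def)
    finally show ?thesis by (simp add: x_def mult_ac)
  qed
  show ?thesis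
    using *[OF \<sigma>] *[OF \<sigma>(2,1)] by (simp add: abs_le_iff d_theta_commute)
qed

lemma hc_mem: "hc \<in> X"
proof (rule F_thetaI(1)[OF \<theta>, of _ "D * h1" "K * D * (D * h1)"])
  show "norm (hc \<sigma> - hc \<sigma>') \<le> K * D * (D * h1) * d_theta \<theta> \<sigma> \<sigma>'"
    if "\<sigma> \<in> Sigma_space" "\<sigma>' \<in> Sigma_space" for \<sigma> \<sigma>'
    using h_diff[OF that] that by (simp add: hc_def flip: of_real_diff)
qed (use h_abs K_pos D_ge_1 h1_pos in \<open>auto simp: hc_def\<close>)

lemma hc_nonzero: "hc \<noteq> 0"
proof
  assume "hc = 0"
  then have "hc (\<lambda>_. 1) = 0" by simp
  then show False using h1_pos ones_mem by (simp add: hc_def h1_def)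
qed

lemma M_hc: "z = of_real r \<Longrightarrow> M hc = cscale (of_real \<rho>) hc"
proof
  fix \<sigma> assume zr: "z = of_real r"
  show "M hc \<sigma> = cscale (of_real \<rho>) hc \<sigma>"
  proof (cases "\<sigma> \<in> Sigma_space")
    case True
    have "transfer z hc \<sigma> = (\<Sum>\<^sub>\<infinity>n\<in>{1..}. of_real (r ^ n * \<psi> (prepend [n] \<sigma>) * h (prepend [n] \<sigma>)))"
      unfolding transfer_def zr using True
      by (intro infsum_cong) (simp add: hc_def prepend_single_mem)
    also have "\<dots> = of_real (transfer r h \<sigma>)"
      using infsumI[OF has_sum_of_real[OF transfer_has_sum[of r h "D * h1", OF norm_r _ True]]] h_abs
      by simp
    finally show ?thesis
      using True by (simp add: M_def h_eigen hc_def)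
  qed (simp add: M_def hc_def)
qed

text \<open>A strong maximum principle. Let s be least with |f| \<le> s h. If equality failed at one
  point, s h - |f| would be positive on a cylinder around it. Some word leads into this cylinder
  from every \<sigma>, and the n-th power of the positive operator maps the nonnegative defect below
  \<rho>^n times itself; so the defect would be bounded below everywhere, and s could be
  lowered.\<close>

lemma peripheral_modulus:
  assumes f: "f \<in> X" "f \<noteq> 0" and \<mu>: "norm \<mu> = \<rho>" and ev: "M f = cscale \<mu> f"
  obtains s where "0 < s" "\<And>\<sigma>. \<sigma> \<in> Sigma_space \<Longrightarrow> norm (f \<sigma>) = s * h \<sigma>"
proof -
  define s where "s = (SUP \<sigma>\<in>Sigma_space. norm (f \<sigma>) / h \<sigma>)"
  have le: "norm (f \<sigma>) / h \<sigma> \<le> sup_norm f * D / h1" if "\<sigma> \<in> Sigma_space" for \<sigma>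
  proof -
    have "norm (f \<sigma>) * h1 \<le> sup_norm f * (D * h \<sigma>)"
      using F_theta_bounded[OF f(1) that] h_ge[OF that] h1_pos nonneg_parts(1)[OF f(1)] by (intro mult_mono) auto
    then show ?thesis
      using cone_pos[OF h that] h1_pos by (simp add: divide_simps mult_ac)
  qed
  have bdd: "bdd_above ((\<lambda>\<sigma>. norm (f \<sigma>) / h \<sigma>) ` Sigma_space)"
    by (rule bdd_aboveI2[OF le])
  have f_le: "norm (f \<sigma>) \<le> s * h \<sigma>" if "\<sigma> \<in> Sigma_space" for \<sigma>
    using cSUP_upper[OF that bdd] cone_pos[OF h that] by (simp add: s_def divide_le_eq)
  obtain \<sigma>0 where "f \<sigma>0 \<noteq> 0" using f(2) by (auto simp: fun_eq_iff)
  then have \<sigma>0: "\<sigma>0 \<in> Sigma_space" using F_theta_outside[OF \<theta> f(1)] by blast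
  have s: "0 < s"
    using f_le[OF \<sigma>0] cone_pos[OF h \<sigma>0] \<open>f \<sigma>0 \<noteq> 0\<close>
    by (metis less_le_trans zero_less_mult_pos2 zero_less_norm_iff)
  have "norm (f \<sigma>1) = s * h \<sigma>1" if \<sigma>1: "\<sigma>1 \<in> Sigma_space" for \<sigma>1
  proof (rule ccontr)
    assume "norm (f \<sigma>1) \<noteq> s * h \<sigma>1"
    define g where "g \<sigma> = s * h \<sigma> - norm (f \<sigma>)" for \<sigma>
    define \<delta> where "\<delta> = g \<sigma>1"
    have g0: "0 \<le> g \<sigma>" if "\<sigma> \<in> Sigma_space" for \<sigma> using f_le[OF that] by (simp add: g_def)
    have \<delta>: "0 < \<delta>" using f_le[OF \<sigma>1] \<open>norm (f \<sigma>1) \<noteq> s * h \<sigma>1\<close> by (simp add: \<delta>_def g_def)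
    define c where "c = s * (K * D * (D * h1)) + lip_seminorm \<theta> f"
    have g_lip: "g \<sigma>1 - g \<sigma> \<le> c * d_theta \<theta> \<sigma>1 \<sigma>" if \<sigma>: "\<sigma> \<in> Sigma_space" for \<sigma>
    proof -
      have "s * (h \<sigma>1 - h \<sigma>) \<le> s * (K * D * (D * h1) * d_theta \<theta> \<sigma>1 \<sigma>)"
        using h_diff[OF \<sigma>1 \<sigma>] s by (intro mult_left_mono) auto
      moreover have "norm (f \<sigma>) - norm (f \<sigma>1) \<le> lip_seminorm \<theta> f * d_theta \<theta> \<sigma>1 \<sigma>"
        using F_theta_lip[OF \<theta> f(1) \<sigma>1 \<sigma>] norm_triangle_ineq2[of "f \<sigma>" "f \<sigma>1"] by (simp add: norm_minus_commute)
      ultimately show ?thesis by (simp add: g_def c_def algebra_simps)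
    qed
    have c0: "0 \<le> c"
      using s K_pos D_ge_1 h1_pos nonneg_parts(2)[OF f(1)] by (simp add: c_def)
    have "(\<lambda>n. c * \<theta> ^ n) \<longlonglongrightarrow> c * 0"
      using \<theta> by (intro tendsto_mult_left LIMSEQ_power_zero) auto
    then have "\<forall>\<^sub>F n in sequentially. c * \<theta> ^ n < \<delta> / 2"
      using \<delta> by (intro order_tendstoD(2)) auto
    then obtain n where n: "c * \<theta> ^ n < \<delta> / 2" by (auto simp: eventually_sequentially)
    \<comment> \<open>The first n letters of \<sigma>1: whatever follows them, the point stays
      within \<theta>^n of \<sigma>1.\<close>
    define w where "w = map \<sigma>1 [0..<n]"
    have w: "w \<in> words n" using \<sigma>1 by (auto simp: w_def words_def Sigma_space_def)
    have g_w: "\<delta> / 2 \<le> g (prepend w \<sigma>)" if \<sigma>: "\<sigma> \<in> Sigma_space" for \<sigma>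
    proof -
      have "d_theta \<theta> \<sigma>1 (prepend w \<sigma>) \<le> \<theta> ^ n"
        by (rule d_theta_le_power[OF \<theta>]) (simp add: w_def prepend_def)
      then have "c * d_theta \<theta> \<sigma>1 (prepend w \<sigma>) \<le> c * \<theta> ^ n"
        using c0 by (rule mult_left_mono)
      with g_lip[OF words_prepend_mem[OF w \<sigma>]] n show ?thesis unfolding \<delta>_def by linarith
    qed
    \<comment> \<open>The contribution of the word \<open>w\<close> alone, with division by
      \<open>D\<close> making the weight bound uniform in \<sigma>.\<close>
    define \<eta> where "\<eta> = r ^ sum_list w * (weight w (\<lambda>_. 1) / D) * (\<delta> / 2)"
    have setw: "set w \<subseteq> {1..}" using w by (simp add: words_def)
    have \<eta>: "0 < \<eta>"
      using r \<delta> D_ge_1 weight_pos[OF setw ones_mem] by (simp add: \<eta>_def)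
    have key: "\<eta> / \<rho> ^ n \<le> g \<sigma>" if \<sigma>: "\<sigma> \<in> Sigma_space" for \<sigma>
    proof -
      have bnd: "\<bar>g (prepend ks \<sigma>)\<bar> \<le> s * (D * h1)" if "ks \<in> words n" for ks
      proof -
        have "g (prepend ks \<sigma>) \<le> s * h (prepend ks \<sigma>)" by (simp add: g_def)
        also have "\<dots> \<le> s * (D * h1)"
          using h_le[OF words_prepend_mem[OF that \<sigma>]] s by (intro mult_left_mono) auto
        finally show ?thesis using g0[OF words_prepend_mem[OF that \<sigma>]] by simp
      qed
      have "\<eta> \<le> r ^ sum_list w * weight w \<sigma> * g (prepend w \<sigma>)"
        unfolding \<eta>_def
        using g_w[OF \<sigma>] weight_le_D[OF setw ones_mem \<sigma>] D_ge_1 r \<delta> weight_pos[OF setw \<sigma>] weight_pos[OF setw ones_mem]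
        by (intro mult_mono) (auto simp: divide_le_eq mult.commute)
      also have "\<dots> = wterm r (\<lambda>ks. g (prepend ks \<sigma>)) \<sigma> w"
        by (simp add: wterm_def)
      also have "\<dots> \<le> wsum r (words n) (\<lambda>ks. g (prepend ks \<sigma>)) \<sigma>"
        by (rule wterm_le_wsum[OF order_refl \<sigma>, where a = "s * (D * h1)"])
          (use r w g0[OF words_prepend_mem[OF _ \<sigma>]] bnd in \<open>auto simp: abs_le_iff\<close>)
      also have "\<dots> = wsum r (words n) (\<lambda>ks. s * h (prepend ks \<sigma>)) \<sigma> - wsum r (words n) (\<lambda>ks. norm (f (prepend ks \<sigma>))) \<sigma>"
        unfolding g_def
      proof (rule wsum_diff[OF order_refl \<sigma> norm_r])
        fix ks assume ks: "ks \<in> words n"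
        show "norm (s * h (prepend ks \<sigma>)) \<le> s * (D * h1)"
          using h_abs[OF words_prepend_mem[OF ks \<sigma>]] s by (simp add: abs_mult)
        show "norm (norm (f (prepend ks \<sigma>))) \<le> sup_norm f"
          using f_words(1)[OF f(1) ks \<sigma>] by simp
      qed
      also have "wsum r (words n) (\<lambda>ks. s * h (prepend ks \<sigma>)) \<sigma> = s * (\<rho> ^ n * h \<sigma>)"
        unfolding wsum_cmult wsum_h[OF \<sigma>] ..
      finally have 1: "\<eta> \<le> s * (\<rho> ^ n * h \<sigma>) - wsum r (words n) (\<lambda>ks. norm (f (prepend ks \<sigma>))) \<sigma>" .
      have "(M ^^ n) f = cscale (\<mu> ^ n) f"
      proof (induction n)
        case (Suc n)
        have "(M ^^ Suc n) f = M (cscale (\<mu> ^ n) f)" by (simp only: Suc funpow.simps comp_apply)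
        also have "\<dots> = cscale (\<mu> ^ n) (cscale \<mu> f)"
          unfolding bounded_op_scale[OF bounded_op_M f(1)] ev ..
        also have "\<dots> = cscale (\<mu> ^ Suc n) f" by (simp add: fun_eq_iff)
        finally show ?case .
      qed (simp add: fun_eq_iff)
      then have "wsum z (words n) (\<lambda>ks. f (prepend ks \<sigma>)) \<sigma> = \<mu> ^ n * f \<sigma>"
        unfolding M_pow_eq[OF f(1) \<sigma>, symmetric] by simp
      then have "norm (wsum z (words n) (\<lambda>ks. f (prepend ks \<sigma>)) \<sigma>) = \<rho> ^ n * norm (f \<sigma>)"
        by (simp only: norm_mult norm_power \<mu>)
      moreover have "norm (wsum z (words n) (\<lambda>ks. f (prepend ks \<sigma>)) \<sigma>) \<le> wsum r (words n) (\<lambda>ks. norm (f (prepend ks \<sigma>))) \<sigma>"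
        using norm_wsum_le[OF order_refl \<sigma> norm_z f_words(1)[OF f(1) _ \<sigma>]] by (simp add: z)
      ultimately have "\<eta> \<le> \<rho> ^ n * g \<sigma>"
        using 1 by (simp add: g_def algebra_simps)
      then show ?thesis using \<rho> by (simp add: field_simps)
    qed
    \<comment> \<open>Since h \<le> D h1, the lower bound on the defect is at least t h; this is the
      amount by which s can be lowered.\<close>
    define t where "t = \<eta> / \<rho> ^ n / (D * h1)"
    have t: "0 < t" using \<eta> \<rho> D_ge_1 h1_pos by (simp add: t_def)
    have "norm (f \<sigma>) / h \<sigma> \<le> s - t" if \<sigma>: "\<sigma> \<in> Sigma_space" for \<sigma>
    proof -
      have "t * h \<sigma> \<le> t * (D * h1)" using h_le[OF \<sigma>] t by (intro mult_left_mono) auto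
      also have "\<dots> = \<eta> / \<rho> ^ n" using D_ge_1 h1_pos by (simp add: t_def)
      finally have "norm (f \<sigma>) \<le> (s - t) * h \<sigma>" using key[OF \<sigma>] by (simp add: g_def algebra_simps)
      then show ?thesis using cone_pos[OF h \<sigma>] by (simp add: divide_le_eq)
    qed
    then have "s \<le> s - t"
      unfolding s_def[symmetric] by (subst (1) s_def) (rule cSUP_least[OF Sigma_space_nonempty])
    with t show False by simp
  qed
  with s that show ?thesis by blast
qed

text \<open>By \<open>peripheral_modulus\<close> the norms of the terms of M f sum to the norm of M
  f, so \<open>infsum_norm_equality\<close> fixes the phase of every term; comparing it with that of
  f \<sigma> relates f at \<open>prepend [k] \<sigma>\<close> and at \<sigma>.\<close>

lemma peripheral_eigenvector:
  assumes f: "f \<in> X" "f \<noteq> 0" and \<mu>: "norm \<mu> = \<rho>" and ev: "M f = cscale \<mu> f"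
  shows "z = of_real r" "\<mu> = of_real \<rho>" "\<exists>c. f = cscale c hc"
proof -
  obtain s where s: "0 < s" and mod: "\<And>\<sigma>. \<sigma> \<in> Sigma_space \<Longrightarrow> norm (f \<sigma>) = s * h \<sigma>"
    by (rule peripheral_modulus[OF assms]) blast
  have step: "z ^ k * f (prepend [k] \<sigma>) * of_real (\<rho> * h \<sigma>) = of_real (r ^ k * h (prepend [k] \<sigma>)) * (\<mu> * f \<sigma>)"
    if \<sigma>: "\<sigma> \<in> Sigma_space" and k: "1 \<le> k" for \<sigma> k
  proof -
    define t where "t j = z ^ j * of_real (\<psi> (prepend [j] \<sigma>)) * f (prepend [j] \<sigma>)" for j
    have nt: "norm (t j) = s * (r ^ j * \<psi> (prepend [j] \<sigma>) * h (prepend [j] \<sigma>))" if "j \<in> {1..}" for j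
      using that \<psi>_pos[OF prepend_single_mem[OF _ \<sigma>, of j]] mod[OF prepend_single_mem[OF _ \<sigma>, of j]]
      by (simp add: t_def norm_mult norm_power z)
    have sum_t: "infsum t {1..} = \<mu> * f \<sigma>"
      using fun_cong[OF ev, of \<sigma>] \<sigma> by (simp add: M_def transfer_def t_def[abs_def])
    have summ: "(\<lambda>j. norm (t j)) summable_on {1..}"
      unfolding t_def by (rule transfer_abs_summable[OF norm_z F_theta_bounded[OF f(1)] \<sigma>])
    have "(\<Sum>\<^sub>\<infinity>j\<in>{1..}. norm (t j)) = (\<Sum>\<^sub>\<infinity>j\<in>{1..}. s * (r ^ j * \<psi> (prepend [j] \<sigma>) * h (prepend [j] \<sigma>)))"
      by (rule infsum_cong) (rule nt)
    also have "\<dots> = s * transfer r h \<sigma>"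
      unfolding transfer_def by (simp add: infsum_cmult_right')
    also have "\<dots> = norm (infsum t {1..})"
      unfolding sum_t using \<sigma> by (simp add: h_eigen norm_mult \<mu> mod)
    finally have eq: "norm (infsum t {1..}) = (\<Sum>\<^sub>\<infinity>j\<in>{1..}. norm (t j))" by simp
    have "t k = of_real (norm (t k)) * sgn (infsum t {1..})"
      by (rule infsum_norm_equality[OF summ eq]) (use k in simp)
    also have "sgn (infsum t {1..}) = \<mu> * f \<sigma> / of_real (s * \<rho> * h \<sigma>)"
      unfolding sum_t using \<sigma> by (simp add: sgn_eq norm_mult \<mu> mod mult_ac)
    finally have tk: "t k = of_real (norm (t k)) * (\<mu> * f \<sigma> / of_real (s * \<rho> * h \<sigma>))" .
    have "t k * of_real (s * \<rho> * h \<sigma>) =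
        of_real (norm (t k)) * (\<mu> * f \<sigma> / of_real (s * \<rho> * h \<sigma>)) * of_real (s * \<rho> * h \<sigma>)"
      by (rule arg_cong[OF tk])
    also have "\<dots> = of_real (norm (t k)) * (\<mu> * f \<sigma>)"
      using s \<rho> cone_pos[OF h \<sigma>] by simp
    finally have "t k * of_real (s * \<rho> * h \<sigma>) = of_real (norm (t k)) * (\<mu> * f \<sigma>)" .
    then have "of_real (s * \<psi> (prepend [k] \<sigma>)) * (z ^ k * f (prepend [k] \<sigma>) * of_real (\<rho> * h \<sigma>)) =
        of_real (s * \<psi> (prepend [k] \<sigma>)) * (of_real (r ^ k * h (prepend [k] \<sigma>)) * (\<mu> * f \<sigma>))"
      using nt[of k] k by (simp add: t_def mult_ac)
    moreover have "of_real (s * \<psi> (prepend [k] \<sigma>)) \<noteq> (0 :: complex)"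
      using s \<psi>_pos[OF prepend_single_mem[OF k \<sigma>]] by simp
    ultimately show ?thesis by (simp only: mult_cancel_left) blast
  qed
  define e where "e \<sigma> = f \<sigma> / of_real (h \<sigma>)" for \<sigma>
  have z0: "z \<noteq> 0" using z r by auto
  \<comment> \<open>The phase picked up by e = f/h when the letter k is prepended; it does not
    depend on \<sigma>.\<close>
  define \<kappa> where "\<kappa> k = (\<mu> / of_real \<rho>) / (z / of_real r) ^ k" for k :: nat
  have e_step: "e (prepend [k] \<sigma>) = \<kappa> k * e \<sigma>" if \<sigma>: "\<sigma> \<in> Sigma_space" and k: "1 \<le> k" for \<sigma> k
    using step[OF that] cone_pos[OF h \<sigma>] cone_pos[OF h prepend_single_mem[OF k \<sigma>]] \<rho> r z0
    by (simp add: e_def \<kappa>_def power_divide field_simps)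
  have e_nz: "e \<sigma> \<noteq> 0" if "\<sigma> \<in> Sigma_space" for \<sigma>
    using mod[OF that] s cone_pos[OF h that] by (auto simp: e_def)
  have e_const: "e \<sigma> = e (\<lambda>_. 1)" if \<sigma>: "\<sigma> \<in> Sigma_space" for \<sigma>
  proof -
    \<comment> \<open>Prepending ones drives every point to the fixed point 1, 1, 1, ... That point
      forces \<kappa> 1 = 1, so \<open>e\<close> keeps its value along the way, and continuity
      identifies it with the value at the limit.\<close>
    define w where "w n = prepend (replicate n (1::nat)) \<sigma>" for n
    have w_mem: "w n \<in> Sigma_space" for n
      unfolding w_def by (rule prepend_mem[OF _ \<sigma>]) auto
    have d: "d_theta \<theta> (w n) (\<lambda>_. 1) \<le> \<theta> ^ n" for n
      by (rule d_theta_le_power[OF \<theta>]) (simp add: w_def prepend_def)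
    have \<theta>0: "(\<lambda>n. C * \<theta> ^ n) \<longlonglongrightarrow> 0" for C
      using tendsto_mult_left[OF LIMSEQ_power_zero[of \<theta>], of C] \<theta> by simp
    have lim_f: "(\<lambda>n. f (w n)) \<longlonglongrightarrow> f (\<lambda>_. 1)"
    proof (rule Lim_null[THEN iffD2], rule Lim_null_comparison[OF always_eventually \<theta>0])
      show "\<forall>n. norm (f (w n) - f (\<lambda>_. 1)) \<le> lip_seminorm \<theta> f * \<theta> ^ n"
        using F_theta_lip[OF \<theta> f(1) w_mem ones_mem] mult_left_mono[OF d nonneg_parts(2)[OF f(1)]] order_trans by blast
    qed
    have lim_h: "(\<lambda>n. h (w n)) \<longlonglongrightarrow> h (\<lambda>_. 1)"
    proof (rule Lim_null[THEN iffD2], rule Lim_null_comparison[OF always_eventually \<theta>0])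
      have "0 \<le> K * D * (D * h1)" using K_pos D_ge_1 h1_pos by simp
      then show "\<forall>n. norm (h (w n) - h (\<lambda>_. 1)) \<le> K * D * (D * h1) * \<theta> ^ n"
        using h_diff[OF w_mem ones_mem] mult_left_mono[OF d] unfolding real_norm_def by (meson order_trans)
    qed
    have lim_e: "(\<lambda>n. e (w n)) \<longlonglongrightarrow> e (\<lambda>_. 1)"
      unfolding e_def using cone_pos[OF h ones_mem] by (intro tendsto_divide lim_f tendsto_of_real lim_h) simp
    have "prepend [1] (\<lambda>_. 1) = (\<lambda>_. 1::nat)" by (auto simp: prepend_def fun_eq_iff)
    then have "\<kappa> 1 * e (\<lambda>_. 1) = 1 * e (\<lambda>_. 1)" using e_step[OF ones_mem, of 1] by simp
    then have \<kappa>_1: "\<kappa> 1 = 1" using e_nz[OF ones_mem] by (simp only: mult_cancel_right) simp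
    have e_w: "e (w n) = e \<sigma>" for n
    proof (induction n)
      case (Suc n)
      have "w (Suc n) = prepend [1] (w n)"
        by (simp only: w_def replicate_Suc prepend_Cons[of 1 "replicate n 1"])
      then show ?case using e_step[OF w_mem[of n], of 1] Suc \<kappa>_1 by simp
    qed (simp add: w_def)
    from lim_e show ?thesis
      unfolding e_w using LIMSEQ_unique[OF tendsto_const] by blast
  qed
  have \<kappa>1: "\<kappa> k = 1" if "1 \<le> k" for k
    using e_step[OF ones_mem that] e_const[OF prepend_single_mem[OF that ones_mem]] e_nz[OF ones_mem] by simp
  have zr: "z / of_real r \<noteq> 0" using z0 r by simp
  have pow: "\<mu> / of_real \<rho> = (z / of_real r) ^ k" if "1 \<le> k" for k
    using \<kappa>1[OF that] by (simp only: \<kappa>_def divide_eq_1_iff)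
  define v where "v = z / of_real r"
  have \<mu>v: "\<mu> / of_real \<rho> = v"
    using pow[of 1] by (simp add: v_def)
  \<comment> \<open>The letters 1 and 2 give the same \<mu>/\<rho> as v and as v^2. As v is nonzero,
    v = 1, which settles z and \<mu> together.\<close>
  then have "v = v * v"
    using pow[of 2] unfolding v_def[symmetric] by (simp add: power2_eq_square)
  then have "v = 1" using zr by (simp add: v_def[symmetric])
  then have zr1: "z / of_real r = 1" by (simp add: v_def)
  then show "z = of_real r" using r by simp
  show "\<mu> = of_real \<rho>"
    using \<mu>v \<open>v = 1\<close> \<rho> by simp
  show "\<exists>c. f = cscale c hc"
  proof (intro exI ext)
    fix \<sigma>
    show "f \<sigma> = cscale (e (\<lambda>_. 1)) hc \<sigma>"
    proof (cases "\<sigma> \<in> Sigma_space")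
      case True
      then show ?thesis
        using e_const[OF True] cone_pos[OF h True] by (simp add: e_def hc_def field_simps)
    next
      case False
      then show ?thesis using F_theta_outside[OF \<theta> f(1) False] by (simp add: hc_def)
    qed
  qed
qed

lemma peripheral_eigenvalue:
  assumes "eigenvalue_on X M \<mu>" "norm \<mu> = \<rho>"
  shows "z = of_real r" "\<mu> = of_real \<rho>"
  using assms peripheral_eigenvector(1,2) unfolding eigenvalue_on_def by blast+

lemma eigenvalue_rho: "z = of_real r \<Longrightarrow> eigenvalue_on X M (of_real \<rho>)"
  unfolding eigenvalue_on_def using hc_mem hc_nonzero M_hc by blast

lemma isolated_simple_rho:
  assumes zr: "z = of_real r"
  shows "isolated_eigenvalue_mult X N M (of_real \<rho>) 1"
proof -
  define q where "q = (\<theta> * \<rho> + \<rho>) / 2"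
  have "\<theta> * \<rho> < \<rho>" using \<theta> \<rho> by simp
  from half_between[OF this] have gap: "\<theta> * \<rho> < q" "q < \<rho>" unfolding q_def by blast+
  obtain E n J d H H0 B where "power_inverse_family X N M E n q J (\<lambda>ks. prepend ks (\<lambda>_. 1)) unit_term d H H0 B"
    using power_inverse_family_M[OF gap(1)] by blast
  then interpret power_inverse_family X N M E n q J "\<lambda>ks. prepend ks (\<lambda>_. 1)" unit_term d H H0 B .
  have "\<exists>c. f = cscale c hc" if f: "f \<in> X" and eq: "M f = cscale (of_real \<rho>) f" for f
  proof (cases "f = 0")
    case True
    then show ?thesis by (intro exI[of _ 0]) (simp add: fun_eq_iff)
  next
    case False
    show ?thesis by (rule peripheral_eigenvector(3)[OF f False _ eq]) (use \<rho> in simp)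
  qed
  from simple_isolated_eigenvalue[OF gap(2) M_pow_le hc_mem hc_nonzero M_hc[OF zr] this]
  show ?thesis .
qed

end

section \<open>Coding by passage times\<close>

lemma funpow_shift: "(shift ^^ k) \<omega> i = \<omega> (i + k)"
  by (induction k arbitrary: i) (simp_all add: shift_def)

lemma Inf_enat_image:
  assumes "S \<noteq> {}"
  shows "Inf (enat ` S) = enat (LEAST i. i \<in> S)"
proof (rule antisym)
  have "(LEAST i. i \<in> S) \<in> S"
    using assms by (meson LeastI ex_in_conv)
  then show "Inf (enat ` S) \<le> enat (LEAST i. i \<in> S)"
    by (intro Inf_lower imageI)
  show "enat (LEAST i. i \<in> S) \<le> Inf (enat ` S)"
    by (rule Inf_greatest) (auto intro: Least_le)
qed

definition first_one :: "(nat \<Rightarrow> bool) \<Rightarrow> nat" where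
  "first_one \<omega> = (LEAST i. \<omega> i)"

lemma Omega_star_ex: "\<omega> \<in> Omega_star \<Longrightarrow> \<exists>i. \<omega> i"
  unfolding Omega_star_def using not_finite_existsD by blast

lemma tau_eq: "\<exists>i. \<omega> i \<Longrightarrow> tau \<omega> = enat (Suc (first_one \<omega>))"
proof -
  assume "\<exists>i. \<omega> i"
  then have "{i. \<omega> i} \<noteq> {}" by blast
  from Inf_enat_image[OF this] show ?thesis
    by (simp add: tau_def first_one_def one_enat_def)
qed

lemma T_tau_eq: "\<omega> \<in> Omega_star \<Longrightarrow> T_tau \<omega> i = \<omega> (i + Suc (first_one \<omega>))"
  by (simp only: T_tau_def tau_eq[OF Omega_star_ex] the_enat.simps funpow_shift)

lemma T_tau_Omega_star: "\<omega> \<in> Omega_star \<Longrightarrow> T_tau \<omega> \<in> Omega_star"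
proof -
  assume \<omega>: "\<omega> \<in> Omega_star"
  define m where "m = Suc (first_one \<omega>)"
  have "\<exists>n\<ge>k. T_tau \<omega> n" for k
  proof -
    have "\<exists>n\<ge>k + m. n \<in> {i. \<omega> i}"
      using \<omega> unfolding Omega_star_def mem_Collect_eq[of _ "\<lambda>\<omega>. infinite {i. \<omega> i}"]
      using infinite_nat_iff_unbounded_le[of "{i. \<omega> i}"] by blast
    then obtain n where n: "k + m \<le> n" "\<omega> n" by auto
    then have "T_tau \<omega> (n - m)" by (simp add: T_tau_eq[OF \<omega>] flip: m_def)
    with n show ?thesis by (intro exI[of _ "n - m"]) auto
  qed
  then show ?thesis
    unfolding Omega_star_def by (simp add: infinite_nat_iff_unbounded_le)
qed

lemma passage_0: "\<omega> \<in> Omega_star \<Longrightarrow> passage \<omega> 0 = Suc (first_one \<omega>)"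
  by (simp add: passage_def tau_eq[OF Omega_star_ex])

lemma passage_Suc: "passage \<omega> (Suc k) = passage (T_tau \<omega>) k"
  by (simp add: passage_def funpow_swap1)

lemma shift_passage: "shift (passage \<omega>) = passage (T_tau \<omega>)"
  by (simp add: shift_def passage_Suc fun_eq_iff)

text \<open>The inverse of \<open>passage\<close>, given explicitly: position i carries a one
  exactly when i + 1 is a partial sum of the passage times, which count from 1 as \<open>tau\<close>
  does.\<close>

definition decode :: "(nat \<Rightarrow> nat) \<Rightarrow> nat \<Rightarrow> bool" where
  "decode \<sigma> i \<longleftrightarrow> (\<exists>n. Suc i = (\<Sum>j\<le>n. \<sigma> j))"

lemma shift_mem: "\<sigma> \<in> Sigma_space \<Longrightarrow> shift \<sigma> \<in> Sigma_space"
  by (simp add: Sigma_space_def shift_def)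

lemma sum_atMost_ge: "\<sigma> \<in> Sigma_space \<Longrightarrow> n < (\<Sum>j\<le>n. \<sigma> j)"
proof (induction n)
  case (Suc n)
  moreover have "1 \<le> \<sigma> (Suc n)" using Suc.prems by (simp add: Sigma_space_def)
  ultimately show ?case by simp
qed (simp add: Sigma_space_def Suc_le_eq)

lemma first_le_sum: "\<sigma> 0 \<le> (\<Sum>j\<le>n. \<sigma> j)" for \<sigma> :: "nat \<Rightarrow> nat"
  by (induction n) auto

lemma decode_shift:
  assumes "\<sigma> \<in> Sigma_space"
  shows "decode \<sigma> (i + \<sigma> 0) \<longleftrightarrow> decode (shift \<sigma>) i"
proof
  assume "decode \<sigma> (i + \<sigma> 0)"
  then obtain n where n: "Suc (i + \<sigma> 0) = (\<Sum>j\<le>n. \<sigma> j)" by (auto simp: decode_def)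
  then obtain m where "n = Suc m" by (cases n) auto
  with n have "Suc i = (\<Sum>j\<le>m. shift \<sigma> j)"
    by (simp only: sum.atMost_Suc_shift) (simp add: shift_def)
  then show "decode (shift \<sigma>) i"
    unfolding decode_def by blast
next
  assume "decode (shift \<sigma>) i"
  then obtain m where "Suc i = (\<Sum>j\<le>m. shift \<sigma> j)" by (auto simp: decode_def)
  then have "Suc (i + \<sigma> 0) = (\<Sum>j\<le>Suc m. \<sigma> j)"
    unfolding sum.atMost_Suc_shift by (simp add: shift_def)
  then show "decode \<sigma> (i + \<sigma> 0)" unfolding decode_def by blast
qed

lemma decode_below: "decode \<sigma> i \<Longrightarrow> \<sigma> 0 \<le> Suc i"
  unfolding decode_def using first_le_sum by auto

lemma first_one_decode:
  assumes "\<sigma> \<in> Sigma_space"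
  shows "Suc (first_one (decode \<sigma>)) = \<sigma> 0"
proof -
  have s0: "1 \<le> \<sigma> 0" using assms by (simp add: Sigma_space_def)
  have "first_one (decode \<sigma>) = \<sigma> 0 - 1"
    unfolding first_one_def
  proof (rule Least_equality)
    show "decode \<sigma> (\<sigma> 0 - 1)" unfolding decode_def using s0 by (intro exI[of _ 0]) simp
    show "\<sigma> 0 - 1 \<le> i" if "decode \<sigma> i" for i using decode_below[OF that] by simp
  qed
  with s0 show ?thesis by simp
qed

lemma decode_Omega_star:
  assumes "\<sigma> \<in> Sigma_space"
  shows "decode \<sigma> \<in> Omega_star"
proof -
  have "\<exists>n\<ge>m. decode \<sigma> n" for m
  proof (intro exI conjI)
    show "m \<le> (\<Sum>j\<le>m. \<sigma> j) - 1" using sum_atMost_ge[OF assms, of m] by simp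
    show "decode \<sigma> ((\<Sum>j\<le>m. \<sigma> j) - 1)"
      unfolding decode_def using sum_atMost_ge[OF assms, of m] by (intro exI[of _ m]) simp
  qed
  then show ?thesis
    unfolding Omega_star_def by (simp add: infinite_nat_iff_unbounded_le)
qed

lemma T_tau_decode:
  assumes "\<sigma> \<in> Sigma_space"
  shows "T_tau (decode \<sigma>) = decode (shift \<sigma>)"
  using decode_shift[OF assms] first_one_decode[OF assms]
  by (simp add: fun_eq_iff T_tau_eq[OF decode_Omega_star[OF assms]])

lemma passage_decode: "\<sigma> \<in> Sigma_space \<Longrightarrow> passage (decode \<sigma>) k = \<sigma> k"
proof (induction k arbitrary: \<sigma>)
  case 0
  then show ?case by (simp add: passage_0[OF decode_Omega_star] first_one_decode)
next
  case (Suc k)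
  then show ?case by (simp add: passage_Suc T_tau_decode shift_mem) (simp add: shift_def)
qed

lemma funpow_T_tau_Omega_star: "\<omega> \<in> Omega_star \<Longrightarrow> (T_tau ^^ k) \<omega> \<in> Omega_star"
  by (induction k) (simp_all add: T_tau_Omega_star)

lemma passage_mem: "\<omega> \<in> Omega_star \<Longrightarrow> passage \<omega> \<in> Sigma_space"
  unfolding Sigma_space_def passage_def using funpow_T_tau_Omega_star
  by (simp add: tau_eq[OF Omega_star_ex])

text \<open>Strong induction on the position. Up to the first one both sides are read off; beyond
  it, cutting off the first block leaves the claim for \<open>T_tau \<omega>\<close> at a smaller
  position.\<close>

lemma decode_passage: "\<omega> \<in> Omega_star \<Longrightarrow> decode (passage \<omega>) i \<longleftrightarrow> \<omega> i"
proof (induction i arbitrary: \<omega> rule: less_induct)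
  case (less i)
  define k where "k = first_one \<omega>"
  have p0: "passage \<omega> 0 = Suc k" by (simp add: k_def passage_0[OF less.prems])
  have mem: "passage \<omega> \<in> Sigma_space" by (rule passage_mem[OF less.prems])
  have wk: "\<omega> k" unfolding k_def first_one_def using Omega_star_ex[OF less.prems] by (rule LeastI_ex)
  consider "i < k" | "i = k" | "k < i" by linarith
  then show ?case
  proof cases
    case 1
    then have "\<not> \<omega> i" unfolding k_def first_one_def by (rule not_less_Least)
    moreover have "\<not> decode (passage \<omega>) i" using decode_below[of "passage \<omega>" i] 1 p0 by auto
    ultimately show ?thesis by blast
  next
    case 2
    have "decode (passage \<omega>) k" unfolding decode_def using p0 by (intro exI[of _ 0]) simp
    with wk 2 show ?thesis by simp
  next
    case 3
    define j where "j = i - Suc k"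
    have i: "i = j + Suc k" "j < i" using 3 by (auto simp: j_def)
    have "decode (passage \<omega>) i \<longleftrightarrow> decode (passage (T_tau \<omega>)) j"
      using decode_shift[OF mem, of j] i p0 by (simp add: shift_passage)
    also have "\<dots> \<longleftrightarrow> T_tau \<omega> j" by (rule less.IH[OF i(2) T_tau_Omega_star[OF less.prems]])
    also have "\<dots> \<longleftrightarrow> \<omega> i" using i by (simp add: T_tau_eq[OF less.prems] k_def)
    finally show ?thesis .
  qed
qed

lemma inv_passage:
  assumes "\<sigma> \<in> Sigma_space"
  shows "inv_into Omega_star passage \<sigma> = decode \<sigma>"
proof -
  have "inj_on passage Omega_star"
    by (rule inj_on_inverseI[of _ decode]) (simp add: fun_eq_iff decode_passage)
  moreover have "passage (decode \<sigma>) = \<sigma>"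
    using passage_decode[OF assms] by (simp add: fun_eq_iff)
  ultimately show ?thesis
    using decode_Omega_star[OF assms] by (intro inv_into_f_eq)
qed

lemma W_decode: "\<sigma> \<in> Sigma_space \<Longrightarrow> W V (decode \<sigma>) = (\<Sum>k<\<sigma> 0. V ((shift ^^ k) (decode \<sigma>)))"
  by (simp add: W_def tau_eq[OF Omega_star_ex[OF decode_Omega_star]] first_one_decode)

lemma psi_decode: "\<sigma> \<in> Sigma_space \<Longrightarrow> psi V \<sigma> = exp (W V (decode \<sigma>))"
  by (simp add: psi_def inv_passage)

lemma decode_prepend_shift:
  assumes "set ks \<subseteq> {1..}" "\<sigma> \<in> Sigma_space"
  shows "(shift ^^ sum_list ks) (decode (prepend ks \<sigma>)) = decode \<sigma>"
  using assms(1)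
proof (induction ks)
  case (Cons k ks)
  then have mem: "prepend (k # ks) \<sigma> \<in> Sigma_space" using assms(2) by (intro prepend_mem)
  have "shift (prepend (k # ks) \<sigma>) = prepend ks \<sigma>"
    by (simp add: prepend_Cons[of k ks] shift_def fun_eq_iff)
  moreover have "prepend (k # ks) \<sigma> 0 = k" by (simp add: prepend_def)
  ultimately have "decode (prepend (k # ks) \<sigma>) (i + k) = decode (prepend ks \<sigma>) i" for i
    using decode_shift[OF mem, of i] by simp
  then have "(shift ^^ k) (decode (prepend (k # ks) \<sigma>)) = decode (prepend ks \<sigma>)"
    by (simp add: fun_eq_iff funpow_shift)
  with Cons show ?case
    by (simp add: funpow_add add.commute[of k])
qed simp

lemma sum_lessThan_add: "(\<Sum>j<m + n. f j) = (\<Sum>j<m. f j) + (\<Sum>j<n. f (m + j))"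
  for f :: "nat \<Rightarrow> real"
  by (induction n) simp_all

text \<open>Each factor is the exponential of a sum of \<open>V\<close> over one block, and the
  blocks follow one another along the orbit. So an induced product is the exponential of a Birkhoff
  sum of length \<open>sum_list ks\<close> for the original shift, which links the induced system to
  the pressure condition.\<close>

lemma psi_product:
  assumes "set ks \<subseteq> {1..}" "\<sigma> \<in> Sigma_space"
  shows "(\<Prod>i<length ks. psi V (prepend (drop i ks) \<sigma>)) =
    exp (\<Sum>j<sum_list ks. V ((shift ^^ j) (decode (prepend ks \<sigma>))))"
  using assms(1)
proof (induction ks)
  case (Cons k ks)
  then have mem: "prepend (k # ks) \<sigma> \<in> Sigma_space" using assms(2) by (intro prepend_mem)
  have first: "prepend (k # ks) \<sigma> 0 = k" by (simp add: prepend_def)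
  have "(shift ^^ k) (decode (prepend [k] (prepend ks \<sigma>))) = decode (prepend ks \<sigma>)"
    using decode_prepend_shift[of "[k]" "prepend ks \<sigma>"] Cons.prems prepend_mem[of ks \<sigma>] assms(2) by simp
  then have "(shift ^^ (k + j)) (decode (prepend (k # ks) \<sigma>)) = (shift ^^ j) (decode (prepend ks \<sigma>))" for j
    by (simp add: add.commute[of k] funpow_add prepend_Cons[of k ks])
  then have "(\<Sum>j<sum_list (k # ks). V ((shift ^^ j) (decode (prepend (k # ks) \<sigma>)))) =
      (\<Sum>j<k. V ((shift ^^ j) (decode (prepend (k # ks) \<sigma>)))) + (\<Sum>j<sum_list ks. V ((shift ^^ j) (decode (prepend ks \<sigma>))))"
    by (simp add: sum_lessThan_add)
  moreover have "psi V (prepend (k # ks) \<sigma>) = exp (\<Sum>j<k. V ((shift ^^ j) (decode (prepend (k # ks) \<sigma>))))"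
    by (simp add: psi_decode[OF mem] W_decode[OF mem] first)
  moreover have "(\<Prod>i<length (k # ks). psi V (prepend (drop i (k # ks)) \<sigma>)) =
      psi V (prepend (k # ks) \<sigma>) * (\<Prod>i<length ks. psi V (prepend (drop i ks) \<sigma>))"
    unfolding length_Cons prod.lessThan_Suc_shift by simp
  moreover have "set ks \<subseteq> {1..}" using Cons.prems by simp
  ultimately show ?case
    using Cons.IH by (simp only: exp_add)
qed simp

text \<open>The same product as \<open>weight\<close>, available before \<open>psi V\<close> is
  known to satisfy the assumptions of \<open>induced_weight\<close>.\<close>

definition word_weight :: "((nat \<Rightarrow> bool) \<Rightarrow> real) \<Rightarrow> nat list \<Rightarrow> (nat \<Rightarrow> nat) \<Rightarrow> real" where
  "word_weight V ks \<sigma> = (\<Prod>i<length ks. psi V (prepend (drop i ks) \<sigma>))"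

section \<open>Estimates for the induced potential and comparison with partition sums\<close>

context
  fixes V :: "(nat \<Rightarrow> bool) \<Rightarrow> real"
  assumes V_nonpos: "\<And>\<omega>. V \<omega> \<le> 0"
begin

lemma W_nonpos: "W V \<omega> \<le> 0"
  unfolding W_def by (intro sum_nonpos V_nonpos)

lemma psi_le_SUP:
  assumes "\<sigma> \<in> Sigma_space" "1 \<le> k"
  shows "psi V (prepend [k] \<sigma>) \<le> exp (SUP \<omega>\<in>A_set k. W V \<omega>)"
proof -
  have mem: "prepend [k] \<sigma> \<in> Sigma_space" by (rule prepend_single_mem[OF assms(2,1)])
  have "decode (prepend [k] \<sigma>) \<in> A_set k"
    using first_one_decode[OF mem]
    by (simp add: A_set_def tau_eq[OF Omega_star_ex[OF decode_Omega_star[OF mem]]])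
  moreover have "bdd_above (W V ` A_set k)"
    using W_nonpos by (auto intro: bdd_aboveI[of _ 0])
  ultimately show ?thesis
    unfolding psi_decode[OF mem] by (simp add: cSUP_upper)
qed

text \<open>Prepending \<open>k\<close> moves the first disagreement to an index n \<ge> 1, where
  the variation bound applies; \<theta>^n is then \<theta> times the distance of \<sigma> and
  \<sigma>'.\<close>

lemma psi_distortion:
  assumes var: "\<And>n. n \<ge> 1 \<Longrightarrow> Var_W V n \<le> ereal (C * \<theta> ^ n)" and C: "0 < C"
    and \<sigma>: "\<sigma> \<in> Sigma_space" "\<sigma>' \<in> Sigma_space" and k: "1 \<le> k"
  shows "psi V (prepend [k] \<sigma>) \<le> exp (C * \<theta> * d_theta \<theta> \<sigma> \<sigma>') * psi V (prepend [k] \<sigma>')"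
proof (cases "\<sigma> = \<sigma>'")
  case False
  define \<alpha> where "\<alpha> = prepend [k] \<sigma>"
  define \<beta> where "\<beta> = prepend [k] \<sigma>'"
  have mem: "\<alpha> \<in> Sigma_space" "\<beta> \<in> Sigma_space"
    using prepend_single_mem[OF k] \<sigma> by (auto simp: \<alpha>_def \<beta>_def)
  have ne: "\<alpha> \<noteq> \<beta>"
  proof
    assume "\<alpha> = \<beta>"
    then have "\<alpha> (Suc j) = \<beta> (Suc j)" for j by simp
    with False show False by (simp add: \<alpha>_def \<beta>_def fun_eq_iff)
  qed
  define n where "n = (LEAST j. \<alpha> j \<noteq> \<beta> j)"
  have "\<exists>j. \<alpha> j \<noteq> \<beta> j" using ne by (auto simp: fun_eq_iff)
  then have "\<alpha> n \<noteq> \<beta> n" unfolding n_def by (rule LeastI_ex)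
  then have n1: "1 \<le> n" by (cases n) (auto simp: \<alpha>_def \<beta>_def)
  have "{j. \<alpha> j \<noteq> \<beta> j} \<noteq> {}" using ne by (auto simp: fun_eq_iff)
  from Inf_enat_image[OF this] have Inf: "Inf (enat ` {j. passage (decode \<alpha>) j \<noteq> passage (decode \<beta>) j}) = enat n"
    by (simp add: passage_decode mem n_def)
  have "ereal \<bar>W V (decode \<alpha>) - W V (decode \<beta>)\<bar> \<le> Var_W V n"
    unfolding Var_W_def by (rule Sup_upper) (use Inf decode_Omega_star[OF mem(1)] decode_Omega_star[OF mem(2)] in blast)
  also have "\<dots> \<le> ereal (C * \<theta> ^ n)" by (rule var[OF n1])
  finally have "\<bar>W V (decode \<alpha>) - W V (decode \<beta>)\<bar> \<le> C * \<theta> ^ n" by simp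
  moreover have "\<theta> ^ n = \<theta> * d_theta \<theta> \<sigma> \<sigma>'"
    using d_theta_prepend_single[of \<theta> k \<sigma> \<sigma>'] ne by (simp add: d_theta_def n_def flip: \<alpha>_def \<beta>_def)
  ultimately have "W V (decode \<alpha>) \<le> C * \<theta> * d_theta \<theta> \<sigma> \<sigma>' + W V (decode \<beta>)"
    by (simp add: mult.assoc)
  then show ?thesis
    unfolding \<alpha>_def[symmetric] \<beta>_def[symmetric] psi_decode[OF mem(1)] psi_decode[OF mem(2)] by (simp flip: exp_add)
qed simp

lemma induced_weight_psi:
  assumes "0 < \<theta>" "\<theta> < 1" "0 < C" "\<And>n. n \<ge> 1 \<Longrightarrow> Var_W V n \<le> ereal (C * \<theta> ^ n)"
    and "(\<lambda>n. exp (SUP \<omega>\<in>A_set n. W V \<omega>)) summable_on {1..}"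
  shows "induced_weight \<theta> C (psi V) (\<lambda>n. exp (SUP \<omega>\<in>A_set n. W V \<omega>))"
  by unfold_locales (use assms psi_le_SUP psi_distortion in \<open>auto simp: psi_def\<close>)

text \<open>Words with total m code distinct 0-1 words of length m, and each weight is the
  exponential of one of the sums over which the corresponding term of the partition sum takes its
  supremum.\<close>

lemma word_weight_le_partition_sum:
  assumes \<sigma>: "\<sigma> \<in> Sigma_space" and F: "finite F" "F \<subseteq> {ks \<in> words n. sum_list ks = m}"
  shows "(\<Sum>ks\<in>F. word_weight V ks \<sigma>) \<le> partition_sum V m"
proof -
  \<comment> \<open>The block coded by \<open>ks\<close>: by \<open>recover\<close>, prepending it
    to the code of \<sigma> gives the code of \<open>prepend ks \<sigma>\<close>, so the word can be
    read back from it.\<close>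
  define w where "w ks = map (decode (prepend ks \<sigma>)) [0..<m]" for ks
  have ks: "set ks \<subseteq> {1..}" "length ks = n" "sum_list ks = m" "prepend ks \<sigma> \<in> Sigma_space" if "ks \<in> F" for ks
    using F that prepend_mem[OF _ \<sigma>] by (auto simp: words_def)
  have recover: "prepend (w ks) (decode \<sigma>) = decode (prepend ks \<sigma>)" if "ks \<in> F" for ks
  proof
    fix i
    have "decode \<sigma> (i - m) = decode (prepend ks \<sigma>) i" if "m \<le> i"
      using fun_cong[OF decode_prepend_shift[OF ks(1)[OF \<open>ks \<in> F\<close>] \<sigma>], of "i - m"] ks(3)[OF \<open>ks \<in> F\<close>] that
      by (simp add: funpow_shift)
    then show "prepend (w ks) (decode \<sigma>) i = decode (prepend ks \<sigma>) i"
      by (auto simp: prepend_def w_def)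
  qed
  have inj: "inj_on w F"
  proof (rule inj_onI)
    fix ks ks' assume F': "ks \<in> F" "ks' \<in> F" "w ks = w ks'"
    then have eq: "decode (prepend ks \<sigma>) = decode (prepend ks' \<sigma>)"
      using recover by metis
    have "prepend ks \<sigma> j = prepend ks' \<sigma> j" for j
      using passage_decode[OF ks(4)[OF F'(1)], of j] passage_decode[OF ks(4)[OF F'(2)], of j] eq by simp
    then have "ks ! j = ks' ! j" if "j < n" for j
      using that ks(2)[OF F'(1)] ks(2)[OF F'(2)] by (metis prepend_def)
    then show "ks = ks'"
      using ks(2)[OF F'(1)] ks(2)[OF F'(2)] by (intro nth_equalityI) auto
  qed
  define P where "P v = exp (SUP \<omega>'. \<Sum>i<m. V (prepend (drop i v) \<omega>'))" for v
  have bdd: "bdd_above (range (\<lambda>\<omega>'. \<Sum>i<m. V (prepend (drop i v) \<omega>')))" for v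
    by (auto intro!: bdd_aboveI[of _ 0] sum_nonpos V_nonpos)
  have "word_weight V ks \<sigma> \<le> P (w ks)" if "ks \<in> F" for ks
  proof -
    have "(shift ^^ i) (decode (prepend ks \<sigma>)) = prepend (drop i (w ks)) (decode \<sigma>)" if "i < m" for i
      unfolding recover[OF \<open>ks \<in> F\<close>, symmetric] using that
      by (auto simp: fun_eq_iff funpow_shift prepend_def w_def add.commute)
    then have "word_weight V ks \<sigma> = exp (\<Sum>i<m. V (prepend (drop i (w ks)) (decode \<sigma>)))"
      unfolding word_weight_def psi_product[OF ks(1)[OF that] \<sigma>] ks(3)[OF that] by simp
    also have "\<dots> \<le> P (w ks)"
      unfolding P_def exp_le_cancel_iff by (rule cSUP_upper[OF UNIV_I bdd])
    finally show ?thesis .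
  qed
  then have "(\<Sum>ks\<in>F. word_weight V ks \<sigma>) \<le> (\<Sum>ks\<in>F. P (w ks))"
    by (rule sum_mono)
  also have "\<dots> = sum P (w ` F)"
    by (simp add: sum.reindex[OF inj])
  also have "\<dots> \<le> sum P {v. length v = m}"
  proof (rule sum_mono2)
    show "finite {v :: bool list. length v = m}"
      using finite_lists_length_eq[of "UNIV :: bool set" m] by simp
  qed (auto simp: w_def P_def)
  finally show ?thesis
    by (simp add: partition_sum_def P_def)
qed

lemma partition_sum_pos: "0 < partition_sum V m"
proof -
  have "finite {v :: bool list. length v = m}"
    using finite_lists_length_eq[of "UNIV :: bool set" m] by simp
  moreover have "replicate m True \<in> {v. length v = m}" by simp
  ultimately show ?thesis
    unfolding partition_sum_def by (intro sum_pos) (auto intro!: exI[of _ "replicate m True"])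
qed

text \<open>The logarithm of the m-th partition sum is eventually below \<epsilon> m with \<epsilon>
  = - ln s / 2, half of the decay rate of s^m; a geometric series remains.\<close>

lemma partition_series_summable:
  assumes lim: "(\<lambda>n. ln (partition_sum V n) / real n) \<longlonglongrightarrow> 0" and s: "0 \<le> s" "s < 1"
  shows "summable (\<lambda>m. s ^ m * partition_sum V m)"
proof (cases "s = 0")
  case True
  then show ?thesis by (intro summable_finite[of "{0}"]) auto
next
  case False
  with s have s0: "0 < s" by simp
  define \<epsilon> where "\<epsilon> = - ln s / 2"
  have \<epsilon>: "0 < \<epsilon>" using s0 s by (simp add: \<epsilon>_def)
  have "\<forall>\<^sub>F n in sequentially. ln (partition_sum V n) / real n < \<epsilon>"
    using lim \<epsilon> by (rule order_tendstoD)
  moreover have "\<forall>\<^sub>F n in sequentially. 0 < n" by (rule eventually_gt_at_top)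
  ultimately have ev: "\<forall>\<^sub>F n in sequentially. norm (s ^ n * partition_sum V n) \<le> exp (- \<epsilon>) ^ n"
  proof eventually_elim
    case (elim n)
    then have "ln (partition_sum V n) < \<epsilon> * n" by (simp add: divide_less_eq)
    then have "exp (ln (partition_sum V n)) \<le> exp (\<epsilon> * n)" by simp
    then have ps: "partition_sum V n \<le> exp (\<epsilon> * n)" using partition_sum_pos[of n] by simp
    have "s ^ n = exp (n * ln s)" using s0 by (simp add: exp_of_nat_mult)
    also have "n * ln s = - 2 * \<epsilon> * n" by (simp add: \<epsilon>_def)
    finally have "s ^ n * partition_sum V n \<le> exp (- 2 * \<epsilon> * n) * exp (\<epsilon> * n)"
      using ps by (simp add: mult_left_mono)
    also have "\<dots> = exp (n * (- \<epsilon>))" by (simp flip: exp_add)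
    also have "\<dots> = exp (- \<epsilon>) ^ n" by (rule exp_of_nat_mult)
    finally show ?case using s0 partition_sum_pos[of n] by simp
  qed
  have "summable (\<lambda>n. exp (- \<epsilon>) ^ n)"
    using \<epsilon> by (intro summable_geometric) simp
  with ev show ?thesis by (rule summable_comparison_test_ev)
qed

end

section \<open>The growth rate at the critical parameter\<close>

locale passage_potential =
  fixes V :: "(nat \<Rightarrow> bool) \<Rightarrow> real" and \<theta> C :: real
  assumes V_nonpos: "\<And>\<omega>. V \<omega> \<le> 0"
    and theta: "0 < \<theta>" "\<theta> < 1" and C_pos: "0 < C"
    and var: "\<And>n. n \<ge> 1 \<Longrightarrow> Var_W V n \<le> ereal (C * \<theta> ^ n)"
    and summable: "(\<lambda>n. exp (SUP \<omega>\<in>A_set n. W V \<omega>)) summable_on {1..}"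
    and pressure_zero: "(\<lambda>n. ln (partition_sum V n) / real n) \<longlonglongrightarrow> 0"
begin

definition \<beta> :: "nat \<Rightarrow> real" where "\<beta> n = exp (SUP \<omega>\<in>A_set n. W V \<omega>)"

sublocale induced_weight \<theta> C "psi V" \<beta>
  unfolding \<beta>_def[abs_def]
  by (rule induced_weight_psi[OF V_nonpos theta C_pos var summable])

text \<open>Group the words by their total m. A word of length n has total at least n, so only the
  terms with m \<ge> n of the partition series occur.\<close>

lemma wsum_le_tail:
  assumes s: "0 \<le> s" "s < 1" and \<sigma>: "\<sigma> \<in> Sigma_space"
  shows "wsum s (words n) (\<lambda>_. 1) \<sigma> \<le> (\<Sum>m. s ^ m * partition_sum V m) - (\<Sum>m<n. s ^ m * partition_sum V m)"
  unfolding wsum_def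
proof (rule infsum_le_finite_sums)
  define a where "a m = s ^ m * partition_sum V m" for m
  have a0: "0 \<le> a m" for m
    using s partition_sum_pos[of V m, OF V_nonpos] by (simp add: a_def)
  have summ: "summable a"
    unfolding a_def[abs_def] by (rule partition_series_summable[OF V_nonpos pressure_zero s])
  show "wterm s (\<lambda>_. 1) \<sigma> summable_on words n"
    by (rule wterm_summable[OF order_refl \<sigma>, where a = 1]) (use s in auto)
  fix F assume F: "finite F" "F \<subseteq> words n"
  have "sum (wterm s (\<lambda>_. 1) \<sigma>) F =
      (\<Sum>m\<in>sum_list ` F. \<Sum>ks\<in>{ks \<in> F. sum_list ks = m}. wterm s (\<lambda>_. 1) \<sigma> ks)"
    by (rule sum.image_gen[OF F(1)])
  also have "\<dots> \<le> (\<Sum>m\<in>sum_list ` F. a m)"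
  proof (rule sum_mono)
    fix m
    have "(\<Sum>ks\<in>{ks \<in> F. sum_list ks = m}. wterm s (\<lambda>_. 1) \<sigma> ks) =
        s ^ m * (\<Sum>ks\<in>{ks \<in> F. sum_list ks = m}. word_weight V ks \<sigma>)"
      unfolding sum_distrib_left by (rule sum.cong) (auto simp: wterm_def weight_def word_weight_def)
    also have "\<dots> \<le> s ^ m * partition_sum V m"
      using F s by (intro mult_left_mono word_weight_le_partition_sum[OF V_nonpos \<sigma>, of _ n]) auto
    finally show "(\<Sum>ks\<in>{ks \<in> F. sum_list ks = m}. wterm s (\<lambda>_. 1) \<sigma> ks) \<le> a m"
      by (simp add: a_def)
  qed
  also have "\<dots> = sum a (sum_list ` F \<union> {..<n}) - sum a {..<n}"
  proof -
    have "sum_list ` F \<inter> {..<n} = {}"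
      using F words_sum_list_ge by fastforce
    then show ?thesis using F(1) by (simp add: sum.union_disjoint)
  qed
  also have "\<dots> \<le> suminf a - sum a {..<n}"
    using F(1) a0 summ by (intro diff_right_mono sum_le_suminf) auto
  finally show "sum (wterm s (\<lambda>_. 1) \<sigma>) F \<le> (\<Sum>m. s ^ m * partition_sum V m) - (\<Sum>m<n. s ^ m * partition_sum V m)"
    by (simp add: a_def[abs_def])
qed

lemma tail_tendsto_0:
  assumes s: "0 \<le> s" "s < 1"
  shows "(\<lambda>n. (\<Sum>m. s ^ m * partition_sum V m) - (\<Sum>m<n. s ^ m * partition_sum V m)) \<longlonglongrightarrow> 0"
  using tendsto_diff[OF tendsto_const[of "\<Sum>m. s ^ m * partition_sum V m"]
      summable_LIMSEQ[OF partition_series_summable[OF V_nonpos pressure_zero s]]]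
  by simp

text \<open>If \<rho> > 1, then for some s < 1 close to 1 the inequality M_s h \<ge> h still holds.
  Iterating it keeps h below M_s^n h, which tends to 0 by the tails.\<close>

lemma growth_rate_le_1:
  assumes h: "cone h" and h_eigen: "\<And>\<sigma>. \<sigma> \<in> Sigma_space \<Longrightarrow> transfer 1 h \<sigma> = \<rho> * h \<sigma>"
  shows "\<rho> \<le> 1"
proof (rule ccontr)
  assume "\<not> \<rho> \<le> 1"
  then have \<rho>: "1 < \<rho>" by simp
  define A where "A = D * h (\<lambda>_. 1)"
  have h1: "0 < h (\<lambda>_. 1)" by (rule cone_pos[OF h ones_mem])
  have D0: "0 < D" using D_ge_1 by linarith
  have A: "0 < A" using D0 h1 by (simp add: A_def)
  have hA: "norm (h \<sigma>) \<le> A" if "\<sigma> \<in> Sigma_space" for \<sigma>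
    unfolding A_def by (rule cone_bounded[OF h that])
  define s where "s m = 1 - 1 / real (m + 2)" for m
  have s: "0 < s m" "s m < 1" for m by (auto simp: s_def field_simps)
  have s_lim: "s \<longlonglongrightarrow> 1" unfolding s_def by real_asymp
  \<comment> \<open>Bounds, up to the sup of \<open>h\<close>, the loss in passing from parameter 1
    to \<open>s m\<close>. It tends to 0 by dominated convergence with majorant \<beta>.\<close>
  define \<delta> where "\<delta> m = (\<Sum>k. (1 - s m ^ Suc k) * \<beta> (Suc k))" for m
  have norm_le: "norm ((1 - s m ^ Suc k) * \<beta> (Suc k)) \<le> \<beta> (Suc k)" for m k
    using s[of m] b_nonneg[of "Suc k"] power_le_one[of "s m" "Suc k"]
    by (simp add: abs_mult mult_left_le_one_le del: power_Suc)
  have "\<delta> \<longlonglongrightarrow> (\<Sum>k. (0::real))"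
  proof -
    have "(\<lambda>m. (1 - s m ^ Suc k) * \<beta> (Suc k)) \<longlonglongrightarrow> (1 - 1 ^ Suc k) * \<beta> (Suc k)" for k
      by (intro tendsto_intros s_lim)
    then have lim: "(\<lambda>m. (1 - s m ^ Suc k) * \<beta> (Suc k)) \<longlonglongrightarrow> 0" for k
      by simp
    have "eventually (\<lambda>(k, m). norm ((1 - s m ^ Suc k) * \<beta> (Suc k)) \<le> \<beta> (Suc k)) (at_top \<times>\<^sub>F sequentially)"
      using norm_le by (intro always_eventually) auto
    from tannerys_theorem[OF lim this b_Suc_summable trivial_limit_sequentially] show ?thesis
      unfolding \<delta>_def by blast
  qed
  then have "\<forall>\<^sub>F m in sequentially. \<delta> m < (\<rho> - 1) / (D * D)"
    by (rule order_tendstoD) (use \<rho> D0 in simp)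
  \<comment> \<open>One factor \<open>D\<close> bounds \<open>h\<close> from above in the loss, the
    other bounds it from below in the available gain (\<rho> - 1) h.\<close>
  then obtain m where m: "\<delta> m < (\<rho> - 1) / (D * D)"
    by (auto simp: eventually_sequentially)
  interpret pt: positive_transfer \<theta> C "psi V" \<beta> "s m"
    by unfold_locales (use s[of m] in auto)
  have step: "h \<sigma> \<le> transfer (s m) h \<sigma>" if \<sigma>: "\<sigma> \<in> Sigma_space" for \<sigma>
  proof -
    have mem: "prepend [Suc k] \<sigma> \<in> Sigma_space" for k
      by (rule prepend_single_mem[OF _ \<sigma>]) simp
    have sums1: "(\<lambda>k. 1 ^ Suc k * of_real (psi V (prepend [Suc k] \<sigma>)) * h (prepend [Suc k] \<sigma>)) sums transfer 1 h \<sigma>"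
      by (rule transfer_sums[of 1 h A, OF _ hA \<sigma>]) simp
    have sums2: "(\<lambda>k. s m ^ Suc k * of_real (psi V (prepend [Suc k] \<sigma>)) * h (prepend [Suc k] \<sigma>)) sums transfer (s m) h \<sigma>"
      by (rule transfer_sums[of "s m" h A, OF pt.norm_r hA \<sigma>])
    have summ: "summable (\<lambda>k. (1 - s m ^ Suc k) * \<beta> (Suc k))"
      by (rule summable_comparison_test'[OF b_Suc_summable norm_le])
    have "transfer 1 h \<sigma> - transfer (s m) h \<sigma> \<le> A * \<delta> m"
    proof (rule sums_le[OF _ sums_diff[OF sums1 sums2] sums_mult[OF summable_sums[OF summ], folded \<delta>_def]])
      fix k
      have "(1 - s m ^ Suc k) * (psi V (prepend [Suc k] \<sigma>) * h (prepend [Suc k] \<sigma>)) \<le> (1 - s m ^ Suc k) * (\<beta> (Suc k) * A)"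
        using s[of m] power_le_one[of "s m" "Suc k"] \<psi>_le[OF \<sigma>, of "Suc k"] \<psi>_pos[OF mem[of k]] hA[OF mem[of k]]
          cone_pos[OF h mem[of k]] b_nonneg[of "Suc k"]
        by (intro mult_left_mono mult_mono) (auto simp del: power_Suc)
      then show "1 ^ Suc k * of_real (psi V (prepend [Suc k] \<sigma>)) * h (prepend [Suc k] \<sigma>) -
          s m ^ Suc k * of_real (psi V (prepend [Suc k] \<sigma>)) * h (prepend [Suc k] \<sigma>) \<le> A * ((1 - s m ^ Suc k) * \<beta> (Suc k))"
        by (simp add: algebra_simps del: power_Suc)
    qed
    also have "A * \<delta> m \<le> A * ((\<rho> - 1) / (D * D))"
      using m A by (intro mult_left_mono) auto
    also have "\<dots> = (\<rho> - 1) * h (\<lambda>_. 1) / D"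
      using D0 by (simp add: A_def)
    also have "\<dots> \<le> (\<rho> - 1) * h \<sigma>"
    proof -
      have "h (\<lambda>_. 1) \<le> D * h \<sigma>" by (rule cone_le_D[OF h ones_mem \<sigma>])
      then have "(\<rho> - 1) * h (\<lambda>_. 1) \<le> (\<rho> - 1) * (D * h \<sigma>)"
        using \<rho> by (intro mult_left_mono) auto
      then show ?thesis using D0 by (simp add: divide_le_eq mult_ac)
    qed
    finally show ?thesis unfolding h_eigen[OF \<sigma>] by (simp add: algebra_simps)
  qed
  have cone_n: "cone ((transfer (s m) ^^ n) h)" for n
    by (induction n) (simp_all add: h pt.cone_transfer)
  have iterate: "h \<sigma> \<le> (transfer (s m) ^^ n) h \<sigma>" if "\<sigma> \<in> Sigma_space" for n \<sigma>
    using that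
  proof (induction n arbitrary: \<sigma>)
    case (Suc n)
    have "transfer (s m) h \<sigma> \<le> transfer (s m) ((transfer (s m) ^^ n) h) \<sigma>"
      by (rule pt.transfer_mono[OF _ _ Suc.IH Suc.prems, where a = A and a' = "D * (transfer (s m) ^^ n) h (\<lambda>_. 1)"])
        (use hA cone_bounded[OF cone_n] in auto)
    with step[OF Suc.prems] show ?case by simp
  qed simp
  have le: "h (\<lambda>_. 1) \<le> A * ((\<Sum>m'. s m ^ m' * partition_sum V m') - (\<Sum>m'<n. s m ^ m' * partition_sum V m'))" for n
  proof -
    have "h (\<lambda>_. 1) \<le> (transfer (s m) ^^ n) h (\<lambda>_. 1)"
      by (rule iterate[OF ones_mem])
    also have "\<dots> = wsum (s m) (words n) (\<lambda>ks. h (prepend ks (\<lambda>_. 1))) (\<lambda>_. 1)"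
      by (rule transfer_iterate[of "s m" h A, OF pt.norm_r hA ones_mem])
    also have "\<dots> \<le> A * wsum (s m) (words n) (\<lambda>_. 1) (\<lambda>_. 1)"
      by (rule wsum_const_le[OF order_refl ones_mem]) (use s[of m] hA words_prepend_mem[OF _ ones_mem] in auto)
    also have "\<dots> \<le> A * ((\<Sum>m'. s m ^ m' * partition_sum V m') - (\<Sum>m'<n. s m ^ m' * partition_sum V m'))"
      using A s[of m] by (intro mult_left_mono wsum_le_tail ones_mem) auto
    finally show ?thesis .
  qed
  have "(\<lambda>n. A * ((\<Sum>m'. s m ^ m' * partition_sum V m') - (\<Sum>m'<n. s m ^ m' * partition_sum V m'))) \<longlonglongrightarrow> A * 0"
    using s[of m] by (intro tendsto_mult_left tail_tendsto_0) auto
  then have "h (\<lambda>_. 1) \<le> A * 0"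
    by (rule LIMSEQ_le_const) (use le in auto)
  with h1 show False by simp
qed

end

section \<open>The growth rate is the exponential of the pressure\<close>

context twisted_transfer
begin

lemma Lam_le_rho: "Lam n \<le> D * D * \<rho> ^ n"
  unfolding Lam_def by (rule cSUP_least[OF Sigma_space_nonempty]) (rule iter_le)

lemma Lam_ge_rho: "\<rho> ^ n \<le> D * D * Lam n"
proof -
  have "D * D * iter n (\<lambda>_. 1) \<le> D * D * Lam n"
    using D_ge_1 by (intro mult_left_mono iter_le_Lam ones_mem) auto
  with iter_ge[OF ones_mem, of n] show ?thesis by linarith
qed

text \<open>D * D is exp (2 K), so after taking logarithms the two-sided comparison of
  \<open>Lam n\<close> with \<rho>^n costs 2 K / n.\<close>

lemma ln_Lam_tendsto: "(\<lambda>n. ln (Lam n) / real n) \<longlonglongrightarrow> ln \<rho>"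
proof (rule Lim_null[THEN iffD2], rule Lim_null_comparison)
  have D0: "0 < D" using D_ge_1 by linarith
  have "norm (ln (Lam n) / real n - ln \<rho>) \<le> 2 * K / real n" if n: "0 < n" for n
  proof -
    have pow: "ln (\<rho> ^ n) = n * ln \<rho>" using \<rho> by (simp add: ln_realpow)
    have "ln (Lam n) \<le> ln (D * D * \<rho> ^ n)"
      using Lam_le_rho[of n] Lam_pos[of n] by (simp add: ln_mono)
    also have "\<dots> = 2 * K + n * ln \<rho>"
      using D0 \<rho> by (simp add: ln_mult_pos pow D_def)
    finally have 1: "ln (Lam n) \<le> 2 * K + n * ln \<rho>" .
    have "ln (\<rho> ^ n) \<le> ln (D * D * Lam n)"
      using Lam_ge_rho[of n] \<rho> by (simp add: ln_mono)
    also have "\<dots> = 2 * K + ln (Lam n)"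
      using D0 Lam_pos[of n] by (simp add: ln_mult_pos D_def)
    finally have 2: "n * ln \<rho> \<le> 2 * K + ln (Lam n)" unfolding pow .
    have "ln (Lam n) / real n - ln \<rho> = (ln (Lam n) - n * ln \<rho>) / n"
      using n by (simp add: field_simps)
    then have "norm (ln (Lam n) / real n - ln \<rho>) = \<bar>ln (Lam n) - n * ln \<rho>\<bar> / n"
      by simp
    also have "\<dots> \<le> 2 * K / n" using 1 2 by (intro divide_right_mono) auto
    finally show ?thesis .
  qed
  then show "\<forall>\<^sub>F n in sequentially. norm (ln (Lam n) / real n - ln \<rho>) \<le> 2 * K / real n"
    using eventually_gt_at_top[of 0] by (rule eventually_mono[rotated])
  show "(\<lambda>n. 2 * K / real n) \<longlonglongrightarrow> 0" by real_asymp
qed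

end

theorem theorem1:
  fixes V :: "(nat \<Rightarrow> bool) \<Rightarrow> real"
    and C1 C2 C3 \<theta> :: real
    and z :: complex
  assumes V_cont: "continuous_on UNIV V"
    and C1_pos: "C1 > 0"
    and V_bounds: "\<And>\<omega>. - C1 \<le> V \<omega> \<and> V \<omega> \<le> 0"
    and V_zero: "V (\<lambda>_. False) = 0"
    and W_summable: "(\<lambda>n. exp (SUP \<omega>\<in>A_set n. W V \<omega>)) summable_on {1..}"
    and W_sum: "(\<Sum>\<^sub>\<infinity>n\<in>{1..}. exp (SUP \<omega>\<in>A_set n. W V \<omega>)) < C2"
    and theta: "0 < \<theta>" "\<theta> < 1"
    and C3_pos: "C3 > 0"
    and W_var: "\<And>n. n \<ge> 1 \<Longrightarrow> Var_W V n \<le> ereal (C3 * \<theta> ^ n)"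
    and pressure_zero: "(\<lambda>n. ln (partition_sum V n) / real n) \<longlonglongrightarrow> 0"
    and z: "norm z \<le> 1"
  defines "X \<equiv> F_theta \<theta>"
    and "N \<equiv> norm_theta \<theta>"
    and "M \<equiv> M_op V z"
    and "\<rho> \<equiv> ext_exp (pressure V (norm z))"
  shows "spectral_radius_on X N M \<le> ereal \<rho> \<and>
    ess_spectral_radius_on X N M \<le> ereal (\<theta> * \<rho>) \<and>
    (\<forall>\<mu> \<nu>. eigenvalue_on X M \<mu> \<and> norm \<mu> = \<rho> \<and> eigenvalue_on X M \<nu> \<and> norm \<nu> = \<rho> \<longrightarrow> \<mu> = \<nu>) \<and>
    (z \<noteq> 0 \<longrightarrow>
      (\<forall>\<mu>. eigenvalue_on X M \<mu> \<and> norm \<mu> = \<rho> \<longrightarrow> isolated_eigenvalue_mult X N M \<mu> 1)) \<and>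
    (z \<in> \<real> \<and> Re z > 0 \<longrightarrow>
      {\<mu>. eigenvalue_on X M \<mu> \<and> norm \<mu> = \<rho>} = {complex_of_real (ext_exp (pressure V (Re z)))}) \<and>
    (\<exists>r<\<rho>. spectrum_on X N M - {\<mu>. eigenvalue_on X M \<mu> \<and> norm \<mu> = \<rho>} \<subseteq> cball 0 r) \<and>
    (z \<noteq> 1 \<longrightarrow> \<not> eigenvalue_on X M 1)"
proof -
  interpret pp: passage_potential V \<theta> C3
    by unfold_locales (use V_bounds theta C3_pos W_var W_summable pressure_zero in auto)
  show ?thesis
  proof (cases "z = 0")
    \<comment> \<open>The operator vanishes here and so does \<open>Lambda_n\<close> for n \<ge> 1;
      the pressure is - \<infinity> and \<rho> = 0. The Perron argument requires r > 0, so this case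
      stands apart.\<close>
    case True
    interpret fb: function_banach_space X N
      unfolding X_def N_def by (rule function_banach_space_F_theta[OF theta])
    have M0: "M f = 0" for f
    proof -
      have "(\<Sum>\<^sub>\<infinity>n\<in>{1..}. 0 ^ n * complex_of_real (psi V (prepend [n] \<sigma>)) * f (prepend [n] \<sigma>)) = 0" for \<sigma>
        by (rule infsum_0) simp
      then show ?thesis
        unfolding M_def M_op_def True fun_eq_iff by (simp only: if_cancel zero_fun_apply) simp
    qed
    have Lam0: "Lambda_n V n 0 = 0" if "1 \<le> n" for n
    proof -
      have "(\<Sum>\<^sub>\<infinity>ks\<in>{ks :: nat list. length ks = n \<and> set ks \<subseteq> {1..}}. 0 ^ sum_list ks * (\<Prod>i<n. psi V (prepend (drop i ks) \<sigma>))) = (0 :: real)" for \<sigma>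
      proof (rule infsum_0)
        fix ks :: "nat list" assume "ks \<in> {ks. length ks = n \<and> set ks \<subseteq> {1..}}"
        then have "n \<le> sum_list ks" by (intro words_sum_list_ge) (simp add: words_def)
        with that show "(0::real) ^ sum_list ks * (\<Prod>i<n. psi V (prepend (drop i ks) \<sigma>)) = 0" by simp
      qed
      then show ?thesis unfolding Lambda_n_def using Sigma_space_nonempty by simp
    qed
    have "(\<lambda>n. ext_ln (Lambda_n V n 0) / ereal (real n)) \<longlonglongrightarrow> - \<infinity>"
    proof (rule tendsto_eventually)
      show "\<forall>\<^sub>F n in sequentially. ext_ln (Lambda_n V n 0) / ereal (real n) = - \<infinity>"
        using eventually_ge_at_top[of 1] by eventually_elim (simp add: Lam0 ext_ln_def)
    qed
    then have \<rho>0: "\<rho> = 0"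
      unfolding \<rho>_def pressure_def True by (simp add: limI ext_exp_def)
    have ev0: "eigenvalue_on X M \<mu> \<longleftrightarrow> \<mu> = 0" for \<mu>
    proof
      assume "eigenvalue_on X M \<mu>"
      then obtain f where "f \<noteq> 0" "M f = cscale \<mu> f" unfolding eigenvalue_on_def by blast
      then show "\<mu> = 0" unfolding M0 by (auto simp: fun_eq_iff)
    next
      assume "\<mu> = 0"
      define f where "f = (\<lambda>\<sigma>. if \<sigma> \<in> Sigma_space then 1 else 0 :: complex)"
      have "f \<in> X"
        unfolding X_def by (rule F_thetaI(1)[OF theta, of _ 1 0]) (auto simp: f_def)
      moreover have "f \<noteq> 0" using ones_mem by (metis f_def zero_fun_apply zero_neq_one)
      moreover have "M f = cscale 0 f" unfolding M0 by (simp add: fun_eq_iff)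
      ultimately show "eigenvalue_on X M \<mu>" unfolding eigenvalue_on_def \<open>\<mu> = 0\<close> by blast
    qed
    have spec: "\<mu> = 0" if \<mu>: "\<mu> \<in> spectrum_on X N M" for \<mu>
    proof (rule ccontr)
      assume "\<mu> \<noteq> 0"
      have "is_resolvent_at X N M \<mu> (\<lambda>f. cscale (1 / \<mu>) f)"
        unfolding is_resolvent_at_def M0
        using \<open>\<mu> \<noteq> 0\<close> fb.bounded_op_cscale[OF fb.bounded_op_id, of "1 / \<mu>"] by (auto simp: fun_eq_iff)
      with \<mu> show False unfolding spectrum_on_def by blast
    qed
    have "spectral_radius_on X N M \<le> ereal \<rho>"
      unfolding spectral_radius_on_def using spec \<rho>0 by (intro SUP_least) auto
    moreover have "ess_spectral_radius_on X N M \<le> ereal (\<theta> * \<rho>)"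
      unfolding ess_spectral_radius_on_def ess_spectrum_on_def using spec \<rho>0 by (intro SUP_least) auto
    \<comment> \<open>Once the eigenvalue 0 is removed nothing remains, so a ball of negative
      radius, which is empty, will do.\<close>
    moreover have "\<exists>r<\<rho>. spectrum_on X N M - {\<mu>. eigenvalue_on X M \<mu> \<and> norm \<mu> = \<rho>} \<subseteq> cball 0 r"
      using spec \<rho>0 ev0 by (intro exI[of _ "-1"]) auto
    ultimately show ?thesis
      using True ev0 by auto
  next
    case False
    define r where "r = norm z"
    have r: "0 < r" "r \<le> 1" using False z by (auto simp: r_def)
    interpret pt: positive_transfer \<theta> C3 "psi V" pp.\<beta> r
      by unfold_locales (use r in auto)
    obtain \<rho>' h where \<rho>': "0 < \<rho>'" and h: "pp.cone h" and h_eigen: "\<And>\<sigma>. \<sigma> \<in> Sigma_space \<Longrightarrow> pp.transfer r h \<sigma> = \<rho>' * h \<sigma>"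
      by (rule pt.eigenfunction_exists) blast
    interpret tt: twisted_transfer \<theta> C3 "psi V" pp.\<beta> r z \<rho>' h
      by unfold_locales (use \<rho>' h h_eigen in \<open>auto simp: r_def\<close>)
    have M_eq: "M = tt.M"
      unfolding M_def tt.M_def M_op_def pp.transfer_def by (simp add: fun_eq_iff)
    have Lam_eq: "Lambda_n V n r = pt.Lam n" for n
      unfolding Lambda_n_def pt.Lam_def
    proof (rule SUP_cong[OF refl])
      fix \<sigma> assume \<sigma>: "\<sigma> \<in> Sigma_space"
      show "(\<Sum>\<^sub>\<infinity>ks\<in>{ks. length ks = n \<and> set ks \<subseteq> {1..}}. r ^ sum_list ks * (\<Prod>i<n. psi V (prepend (drop i ks) \<sigma>))) = pt.iter n \<sigma>"
        unfolding pt.iter_eq_wsum[OF \<sigma>] pp.wsum_def words_def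
        by (rule infsum_cong) (simp add: pp.wterm_def pp.weight_def)
    qed
    have "(\<lambda>n. ext_ln (Lambda_n V n r) / ereal (real n)) \<longlonglongrightarrow> ereal (ln \<rho>')"
    proof (rule Lim_transform_eventually)
      show "(\<lambda>n. ereal (ln (pt.Lam n) / real n)) \<longlonglongrightarrow> ereal (ln \<rho>')"
        using tt.ln_Lam_tendsto by simp
      show "\<forall>\<^sub>F n in sequentially. ereal (ln (pt.Lam n) / real n) = ext_ln (Lambda_n V n r) / ereal (real n)"
        using eventually_gt_at_top[of 0]
        by eventually_elim (use pt.Lam_pos in \<open>simp add: Lam_eq ext_ln_def less_imp_neq[symmetric]\<close>)
    qed
    then have "pressure V r = ereal (ln \<rho>')"
      unfolding pressure_def by (rule limI)
    then have press: "ext_exp (pressure V r) = \<rho>'"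
      using \<rho>' by (simp add: ext_exp_def)
    then have \<rho>_eq: "\<rho> = \<rho>'"
      by (simp add: \<rho>_def r_def)
    have peripheral: "z = of_real r \<and> \<mu> = of_real \<rho>'" if "eigenvalue_on X M \<mu>" "norm \<mu> = \<rho>'" for \<mu>
      using tt.peripheral_eigenvalue that unfolding X_def M_eq by blast
    have "spectral_radius_on X N M \<le> ereal \<rho>"
      unfolding spectral_radius_on_def X_def N_def M_eq \<rho>_eq using tt.spectrum_le by (intro SUP_least) simp
    moreover have "ess_spectral_radius_on X N M \<le> ereal (\<theta> * \<rho>)"
      unfolding ess_spectral_radius_on_def X_def N_def M_eq \<rho>_eq using tt.ess_spectrum_le by (intro SUP_least) simp
    moreover have "\<forall>\<mu> \<nu>. eigenvalue_on X M \<mu> \<and> norm \<mu> = \<rho> \<and> eigenvalue_on X M \<nu> \<and> norm \<nu> = \<rho> \<longrightarrow> \<mu> = \<nu>"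
      using peripheral unfolding \<rho>_eq by blast
    moreover have "isolated_eigenvalue_mult X N M \<mu> 1" if \<mu>: "eigenvalue_on X M \<mu>" "norm \<mu> = \<rho>" for \<mu>
    proof -
      have zr: "z = of_real r" and \<mu>\<rho>: "\<mu> = of_real \<rho>'"
        using peripheral[OF \<mu>(1)] \<mu>(2) unfolding \<rho>_eq by auto
      show ?thesis
        unfolding X_def N_def M_eq \<mu>\<rho> by (rule tt.isolated_simple_rho[OF zr])
    qed
    moreover have "{\<mu>. eigenvalue_on X M \<mu> \<and> norm \<mu> = \<rho>} = {complex_of_real (ext_exp (pressure V (Re z)))}"
      if "z \<in> \<real>" "Re z > 0"
    proof -
      have "z = of_real (Re z)" using that(1) by (auto simp: complex_is_Real_iff complex_eq_iff)
      then have zr: "Re z = r" "z = of_real r"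
        using that(2) by (metis abs_of_pos norm_of_real r_def)+
      have "eigenvalue_on X M (of_real \<rho>')"
        unfolding X_def M_eq by (rule tt.eigenvalue_rho[OF zr(2)])
      moreover have "norm (complex_of_real \<rho>') = \<rho>'"
        using \<rho>' by simp
      ultimately show ?thesis
        unfolding zr(1) press \<rho>_eq using peripheral by blast
    qed
    moreover have "\<exists>r<\<rho>. spectrum_on X N M - {\<mu>. eigenvalue_on X M \<mu> \<and> norm \<mu> = \<rho>} \<subseteq> cball 0 r"
      unfolding X_def N_def M_eq \<rho>_eq by (rule tt.spectral_gap)
    moreover have "\<not> eigenvalue_on X M 1" if "z \<noteq> 1"
    proof
      assume ev: "eigenvalue_on X M 1"
      show False
      proof (cases "r < 1")
        \<comment> \<open>Inside the unit disc f = M^n f is dominated by the tails of the convergent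
          partition series at r.\<close>
        case True
        obtain f where f: "f \<in> F_theta \<theta>" "f \<noteq> 0" "tt.M f = cscale 1 f"
          using ev unfolding eigenvalue_on_def X_def M_eq by blast
        have iter_f: "(tt.M ^^ n) f = f" for n
          by (induction n) (use f(3) in simp_all)
        have "f \<sigma> = 0" for \<sigma>
        proof (cases "\<sigma> \<in> Sigma_space")
          case \<sigma>: True
          have "norm (f \<sigma>) \<le> sup_norm f * ((\<Sum>m. r ^ m * partition_sum V m) - (\<Sum>m<n. r ^ m * partition_sum V m))" for n
          proof -
            have "norm (f \<sigma>) = norm (pp.wsum z (words n) (\<lambda>ks. f (prepend ks \<sigma>)) \<sigma>)"
              using tt.M_pow_eq[OF f(1) \<sigma>, of n] by (simp add: iter_f)
            also have "\<dots> \<le> pp.wsum r (words n) (\<lambda>ks. norm (f (prepend ks \<sigma>))) \<sigma>"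
              using pp.norm_wsum_le[OF order_refl \<sigma> tt.norm_z tt.f_words(1)[OF f(1) _ \<sigma>]] by (simp add: r_def)
            also have "\<dots> \<le> sup_norm f * pp.wsum r (words n) (\<lambda>_. 1) \<sigma>"
              by (rule pp.wsum_const_le[OF order_refl \<sigma>]) (use r tt.f_words(1)[OF f(1) _ \<sigma>] in auto)
            also have "\<dots> \<le> sup_norm f * ((\<Sum>m. r ^ m * partition_sum V m) - (\<Sum>m<n. r ^ m * partition_sum V m))"
              using tt.nonneg_parts(1)[OF f(1)] r True by (intro mult_left_mono pp.wsum_le_tail \<sigma>) auto
            finally show ?thesis .
          qed
          moreover have "(\<lambda>n. sup_norm f * ((\<Sum>m. r ^ m * partition_sum V m) - (\<Sum>m<n. r ^ m * partition_sum V m))) \<longlonglongrightarrow> sup_norm f * 0"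
            using r True by (intro tendsto_mult_left pp.tail_tendsto_0) auto
          ultimately have "norm (f \<sigma>) \<le> sup_norm f * 0"
            by (intro LIMSEQ_le_const) auto
          then show ?thesis by simp
        next
          case False
          then show ?thesis by (rule F_theta_outside[OF theta f(1)])
        qed
        with f(2) show False by (auto simp: fun_eq_iff)
      next
        \<comment> \<open>On the unit circle \<rho> \<le> 1, while eigenvalues have modulus at most
          \<rho>. So 1 would be a peripheral eigenvalue, which forces z = r = 1.\<close>
        case False
        then have r1: "r = 1" using r by simp
        have "\<rho>' \<le> 1"
          by (rule pp.growth_rate_le_1[OF h]) (use h_eigen in \<open>simp add: r1\<close>)
        moreover have "norm (1 :: complex) \<le> \<rho>'"
          by (rule tt.eigenvalue_le) (use ev in \<open>simp add: X_def M_eq\<close>)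
        ultimately have "z = of_real r"
          using peripheral[OF ev] by simp
        with r1 that show False by simp
      qed
    qed
    ultimately show ?thesis
      by blast
  qed
qed

end
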